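(* Consider the problem: given $n$ points in $\mathbb{TP}^2$, output the list of vertices of their tropical convex hull in counter-clockwise order; let $h$ denote the number of these vertices. (1) There is an algorithm solving this problem in $O(n\log h)$ time. (2) There is an algorithm solving this problem in expected linear time $O(n)$ when the input points are random (e.g. independently uniformly distributed in the unit square in normalized coordinates).
   Context: $\mathbb{TP}^2=\mathbb R^3/\mathbb R(1,1,1)$; points are normalized as $(0,\xi_1,\xi_2)$ and identified with $(\xi_1,\xi_2)\in\mathbb R^2$. Tropical operations: $\lambda\oplus\mu=\min\{\lambda,\mu\}$, $\lambda\odot\mu=\lambda+\mu$, with scalar $\odot$ adding to all coordinates and $\oplus$ componentwise. The tropical convex hull $\mathrm{tconv}(S)$ of a finite set $S$ is the set of all $\lambda_1\odot x_1\oplus\dots\oplus\lambda_n\odot x_n$ with $\lambda_i\in\mathbb R$, $x_i\in S$ (a tropical polygon). Its vertices form the unique inclusion-minimal subset $V\subseteq \mathrm{tconv}(S)$ with $\mathrm{tconv}(V)=\mathrm{tconv}(S)$; they are listed in counter-clockwise order along the boundary of the polygon. *)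

theory Defs
  imports "HOL-Complex_Analysis.Complex_Analysis" "HOL-Probability.Probability"
begin

section \<open>Tropical convexity in the tropical projective plane\<close>

text \<open>A point of $R^3 / R(1,1,1)$ is represented by the pair $(\xi_1, \xi_2)$ of coordinates
  of its representative $(0, \xi_1, \xi_2)$.\<close>

type_synonym tp2 = "real \<times> real"

definition homog :: "tp2 \<Rightarrow> real ^ 3" where
  "homog p = vector [0, fst p, snd p]"

definition normalize_tp2 :: "real ^ 3 \<Rightarrow> tp2" where
  "normalize_tp2 u = (u $ 2 - u $ 1, u $ 3 - u $ 1)"

text \<open>The tropical sum, over all $x$ in the finite nonempty set $F$, of
  $\lambda_x \odot x$: tropical addition is the componentwise minimum, and tropical
  multiplication by a scalar adds it to all coordinates.\<close>

definition trop_comb :: "tp2 set \<Rightarrow> (tp2 \<Rightarrow> real) \<Rightarrow> real ^ 3" where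
  "trop_comb F l = (\<chi> i. Min ((\<lambda>x. l x + homog x $ i) ` F))"

definition tconv :: "tp2 set \<Rightarrow> tp2 set" where
  "tconv S = {normalize_tp2 (trop_comb F l) | F l. finite F \<and> F \<noteq> {} \<and> F \<subseteq> S}"

definition tvertices :: "tp2 set \<Rightarrow> tp2 set" where
  "tvertices S = (THE V. V \<subseteq> tconv S \<and> tconv V = tconv S \<and> (\<forall>W. W \<subset> V \<longrightarrow> tconv W \<noteq> tconv S))"


section \<open>Counter-clockwise order\<close>

definition plane :: "tp2 \<Rightarrow> complex" where
  "plane p = Complex (fst p) (snd p)"

text \<open>A tropical polygon can have one-dimensional parts (it can even be a tree), so its
  boundary need not be a simple closed curve.  The counter-clockwise order along the boundary is
  therefore read off from a positively oriented Jordan curve which passes through the listed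
  points and encloses the polygon.  If the polygon is a closed disc, its own boundary is such a
  curve.  In general the cyclic order of the vertices does not depend on the curve:
  removing a vertex from a tropical polygon leaves a tropically convex, hence connected, set, so
  any three vertices are the ends of a triod, or are attached by disjoint arcs to a
  simple closed curve, inside the polygon; and this fixes their cyclic order on every enclosing
  Jordan curve.  The starting point of the list is arbitrary.\<close>

definition ccw_along_boundary :: "tp2 set \<Rightarrow> tp2 list \<Rightarrow> bool" where
  "ccw_along_boundary P vs \<longleftrightarrow>
     (\<exists>\<gamma> \<tau>. simple_path \<gamma> \<and> pathfinish \<gamma> = pathstart \<gamma> \<and>
        (\<forall>z \<in> inside (path_image \<gamma>). winding_number \<gamma> z = 1) \<and>
        plane ` P \<subseteq> path_image \<gamma> \<union> inside (path_image \<gamma>) \<and>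
        sorted_wrt (<) \<tau> \<and> set \<tau> \<subseteq> {0..<1} \<and> map \<gamma> \<tau> = map plane vs)"

definition ccw_vertex_list :: "tp2 set \<Rightarrow> tp2 list \<Rightarrow> bool" where
  "ccw_vertex_list S vs \<longleftrightarrow>
     distinct vs \<and> set vs = tvertices S \<and> ccw_along_boundary (tconv S) vs"


section \<open>The real RAM\<close>

text \<open>Unit-cost real RAM, with programs written as while programs.  The memory is split into
  arrays of natural numbers (for counting and addressing) and arrays of real numbers; a program
  mentions only finitely many array names, and scalars are the cells with index 0.  Real numbers
  can be added, subtracted, multiplied, divided and compared, but there is no rounding, nor any
  other conversion from reals to integers apart from branching on comparisons.\<close>

type_synonym name = string

datatype nexp =
    NConst nat
  | NCell name nexp
  | NAdd nexp nexp
  | NSub nexp nexp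
  | NHalf nexp

datatype rexp =
    RConst int
  | RCell name nexp
  | RAdd rexp rexp
  | RSub rexp rexp
  | RMul rexp rexp
  | RDiv rexp rexp

datatype bexp =
    NLess nexp nexp
  | RLess rexp rexp
  | BNot bexp
  | BAnd bexp bexp

datatype cmd =
    Skip
  | NStore name nexp nexp
  | RStore name nexp rexp
  | Seq cmd cmd
  | Cond bexp cmd cmd
  | While bexp cmd

record state =
  nmem :: "name \<Rightarrow> nat \<Rightarrow> nat"
  rmem :: "name \<Rightarrow> nat \<Rightarrow> real"

fun nval :: "nexp \<Rightarrow> state \<Rightarrow> nat" where
  "nval (NConst k) s = k"
| "nval (NCell a e) s = nmem s a (nval e s)"
| "nval (NAdd e f) s = nval e s + nval f s"
| "nval (NSub e f) s = nval e s - nval f s"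
| "nval (NHalf e) s = nval e s div 2"

fun rval :: "rexp \<Rightarrow> state \<Rightarrow> real" where
  "rval (RConst k) s = of_int k"
| "rval (RCell a e) s = rmem s a (nval e s)"
| "rval (RAdd e f) s = rval e s + rval f s"
| "rval (RSub e f) s = rval e s - rval f s"
| "rval (RMul e f) s = rval e s * rval f s"
| "rval (RDiv e f) s = rval e s / rval f s"

fun bval :: "bexp \<Rightarrow> state \<Rightarrow> bool" where
  "bval (NLess e f) s \<longleftrightarrow> nval e s < nval f s"
| "bval (RLess e f) s \<longleftrightarrow> rval e s < rval f s"
| "bval (BNot b) s \<longleftrightarrow> \<not> bval b s"
| "bval (BAnd b c) s \<longleftrightarrow> bval b s \<and> bval c s"

definition nstore :: "name \<Rightarrow> nat \<Rightarrow> nat \<Rightarrow> state \<Rightarrow> state" where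
  "nstore a i x s = s\<lparr>nmem := (nmem s)(a := (nmem s a)(i := x))\<rparr>"

definition rstore :: "name \<Rightarrow> nat \<Rightarrow> real \<Rightarrow> state \<Rightarrow> state" where
  "rstore a i x s = s\<lparr>rmem := (rmem s)(a := (rmem s a)(i := x))\<rparr>"

text \<open>\<open>exec c s t s'\<close>: program \<open>c\<close>, started in state \<open>s\<close>, halts in state \<open>s'\<close> after \<open>t\<close> steps.
  Every elementary command and every test costs one step; as the expressions occurring in
  a fixed program have bounded size, counting the individual arithmetic operations
  would change running times by a constant factor only.\<close>

inductive exec :: "cmd \<Rightarrow> state \<Rightarrow> nat \<Rightarrow> state \<Rightarrow> bool" where
  exec_Skip: "exec Skip s 1 s"
| exec_NStore: "exec (NStore a e f) s 1 (nstore a (nval e s) (nval f s) s)"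
| exec_RStore: "exec (RStore a e f) s 1 (rstore a (nval e s) (rval f s) s)"
| exec_Seq: "exec c s t s' \<Longrightarrow> exec d s' u s'' \<Longrightarrow> exec (Seq c d) s (t + u) s''"
| exec_CondTrue: "bval b s \<Longrightarrow> exec c s t s' \<Longrightarrow> exec (Cond b c d) s (1 + t) s'"
| exec_CondFalse: "\<not> bval b s \<Longrightarrow> exec d s t s' \<Longrightarrow> exec (Cond b c d) s (1 + t) s'"
| exec_WhileFalse: "\<not> bval b s \<Longrightarrow> exec (While b c) s 1 s"
| exec_WhileTrue: "bval b s \<Longrightarrow> exec c s t s' \<Longrightarrow> exec (While b c) s' u s'' \<Longrightarrow>
    exec (While b c) s (1 + t + u) s''"

text \<open>The input consists of the number \<open>n\<close> of points and the arrays \<open>x\<close>, \<open>y\<close> of their normalized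
  coordinates, the output of the number \<open>h\<close> of listed points and the arrays \<open>u\<close>, \<open>v\<close> of
  their normalized coordinates.  All other cells are initially 0.\<close>

definition input_state :: "tp2 list \<Rightarrow> state" where
  "input_state ps = \<lparr>
     nmem = (\<lambda>a i. if a = ''n'' \<and> i = 0 then length ps else 0),
     rmem = (\<lambda>a i. if i < length ps then
                      (if a = ''x'' then fst (ps ! i) else if a = ''y'' then snd (ps ! i) else 0)
                    else 0)\<rparr>"

definition output_list :: "state \<Rightarrow> tp2 list" where
  "output_list s = map (\<lambda>i. (rmem s ''u'' i, rmem s ''v'' i)) [0..<nmem s ''h'' 0]"

definition run_time :: "cmd \<Rightarrow> tp2 list \<Rightarrow> nat" where
  "run_time alg ps = (THE t. \<exists>s'. exec alg (input_state ps) t s')"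

definition solves_tropical_hull :: "cmd \<Rightarrow> bool" where
  "solves_tropical_hull alg \<longleftrightarrow>
     (\<forall>ps. ps \<noteq> [] \<longrightarrow>
        (\<exists>t s'. exec alg (input_state ps) t s' \<and> ccw_vertex_list (set ps) (output_list s')))"


section \<open>Random input\<close>

definition random_points :: "nat \<Rightarrow> (nat \<Rightarrow> tp2) measure" where
  "random_points n = (\<Pi>\<^sub>M i\<in>{..<n}. uniform_measure lborel ({0..1} \<times> {0..1}))"

text \<open>For an algorithm that halts on all inputs the running time is a measurable function of the
  input, so the nonnegative integral below is its expectation (and is infinite if the
  expectation does not exist).\<close>

definition expected_run_time :: "cmd \<Rightarrow> nat \<Rightarrow> ennreal" where
  "expected_run_time alg n =
     (\<integral>\<^sup>+ \<omega>. of_nat (run_time alg (map \<omega> [0..<n])) \<partial>random_points n)"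

end

theory Submission
  imports Defs "HOL-Real_Asymp.Real_Asymp"
begin

text \<open>A point \<open>q\<close> lies in the tropical hull of \<open>S\<close> iff each of its three closed sectors contains a
  point of \<open>S\<close>.  Hence the vertices are the points that are maximal for one of three linearly
  transformed coordinatewise orders, and the hull is found by three computations of planar maxima.
  Any two points are incomparable for at most one of the orders; so two of the three staircases
  share at most one point, and concatenating them gives the counter-clockwise order: the third
  staircase runs from left to right along a graph below the hull, the other two run
  back along a graph above it.

  Maxima are computed in time \<open>O(n log h)\<close> by bottom-up merge sort with early exit: when the points
  are sorted in groups of size \<open>w\<close>, then \<open>w\<close> further maxima are extracted in time \<open>O(n)\<close> by walking
  through all groups simultaneously, and the sizes \<open>w\<close> are doubled until \<open>w \<ge> h\<close>.

  Before that, all points below a pivot are thrown away.  For \<open>n\<close> random points in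
  the square, put \<open>\<delta> = n powr (-1/4)\<close>: except with probability at most \<open>3 * exp (- sqrt n)\<close> the \<open>\<delta>\<close>-corners are
  hit, and then only points at distance \<open>O(\<delta>)\<close> from the boundary of the square survive, so sorting them costs
  \<open>O(n powr (3/4) log n)\<close> on average.\<close>

section \<open>While programs with running times\<close>

text \<open>One program proves both claims, and it knows neither \<open>h\<close> nor a bound on it:
  an exponent \<open>J\<close> with \<open>h \<le> 2 ^ J\<close> occurs only in the analysis, taken
  from \<open>h\<close> in the worst case and from \<open>n\<close> for random input. A stage is
  linear because extracting at most \<open>w + 1\<close> points inspects about \<open>n / w\<close>
  group heads per point, while the group pointers only advance and so make at most \<open>n\<close>
  moves altogether. The geometric obstacle is that \<open>ccw_along_boundary\<close> demands a
  Jordan curve of winding number 1, whereas the hull may be a segment or a tree. Its own boundary is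
  therefore avoided: two strictly separated continuous graphs enclose the hull and touch it at the
  listed points, and the curve is a rectangle sheared into the strip between them. The exponent -1/4
  is a choice of convenience: \<open>n * \<delta>^2\<close> must tend to infinity so that corners
  are hit, and \<open>n * \<delta>\<close> must stay below \<open>n / log n\<close>, so any exponent
  strictly between -1/2 and 0 would serve.\<close>

lemma exec_deterministic: "exec c s t s' \<Longrightarrow> exec c s t2 s2 \<Longrightarrow> t2 = t \<and> s2 = s'"
proof (induction arbitrary: t2 s2 rule: exec.induct)
  case (exec_Skip s) then show ?case by (auto elim: exec.cases)
next
  case (exec_NStore a e f s) then show ?case by (auto elim: exec.cases)
next
  case (exec_RStore a e f s) then show ?case by (auto elim: exec.cases)
next
  case (exec_Seq c s t s' d u s'')
  from exec_Seq.prems exec_Seq.IH show ?case by (cases rule: exec.cases) blast+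
next
  case (exec_CondTrue b s c t s' d)
  from exec_CondTrue.prems exec_CondTrue.IH exec_CondTrue.hyps show ?case by (cases rule: exec.cases) blast+
next
  case (exec_CondFalse b s d t s' c)
  from exec_CondFalse.prems exec_CondFalse.IH exec_CondFalse.hyps show ?case by (cases rule: exec.cases) blast+
next
  case (exec_WhileFalse b s c)
  from exec_WhileFalse.prems exec_WhileFalse.hyps show ?case by (cases rule: exec.cases) blast+
next
  case (exec_WhileTrue b s c t s' u s'')
  from exec_WhileTrue.prems exec_WhileTrue.IH exec_WhileTrue.hyps show ?case by (cases rule: exec.cases) blast+
qed

lemma run_time_eq: "exec alg (input_state ps) t s' \<Longrightarrow> run_time alg ps = t"
  unfolding run_time_def using exec_deterministic by (intro the_equality) blast+

text \<open>Total correctness with time: the postcondition also receives the step count. As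
  execution is deterministic, the rules for loop-free commands are equivalences, and symbolic
  execution becomes rewriting.\<close>

definition wp :: "cmd \<Rightarrow> (nat \<Rightarrow> state \<Rightarrow> bool) \<Rightarrow> state \<Rightarrow> bool" where
  "wp c Q s \<longleftrightarrow> (\<exists>t s'. exec c s t s' \<and> Q t s')"

lemma wp_mono: "wp c Q s \<Longrightarrow> (\<And>t s'. Q t s' \<Longrightarrow> R t s') \<Longrightarrow> wp c R s"
  unfolding wp_def by blast

lemma wp_Skip [simp]: "wp Skip Q s \<longleftrightarrow> Q 1 s"
  unfolding wp_def by (metis exec_Skip exec_deterministic)

lemma wp_NStore [simp]: "wp (NStore a e f) Q s \<longleftrightarrow> Q 1 (nstore a (nval e s) (nval f s) s)"
  unfolding wp_def by (metis exec_NStore exec_deterministic)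

lemma wp_RStore [simp]: "wp (RStore a e f) Q s \<longleftrightarrow> Q 1 (rstore a (nval e s) (rval f s) s)"
  unfolding wp_def by (metis exec_RStore exec_deterministic)

lemma wp_Seq [simp]: "wp (Seq c d) Q s \<longleftrightarrow> wp c (\<lambda>t. wp d (\<lambda>u. Q (t + u))) s"
proof
  assume "wp (Seq c d) Q s"
  then obtain t s' where e: "exec (Seq c d) s t s'" "Q t s'" by (auto simp: wp_def)
  from e(1) obtain t1 t2 s1 where "exec c s t1 s1" "exec d s1 t2 s'" "t = t1 + t2"
    by (cases rule: exec.cases) auto
  with e(2) show "wp c (\<lambda>t. wp d (\<lambda>u. Q (t + u))) s" by (auto simp: wp_def)
next
  assume "wp c (\<lambda>t. wp d (\<lambda>u. Q (t + u))) s"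
  then show "wp (Seq c d) Q s" by (auto simp: wp_def intro: exec.intros)
qed

lemma wp_Cond [simp]:
  "wp (Cond b c d) Q s \<longleftrightarrow> (if bval b s then wp c (\<lambda>t. Q (1 + t)) s else wp d (\<lambda>t. Q (1 + t)) s)"
proof
  assume "wp (Cond b c d) Q s"
  then obtain t s' where e: "exec (Cond b c d) s t s'" "Q t s'" by (auto simp: wp_def)
  from e(1) e(2) show "if bval b s then wp c (\<lambda>t. Q (1 + t)) s else wp d (\<lambda>t. Q (1 + t)) s"
    by (cases rule: exec.cases) (auto simp: wp_def)
next
  assume "if bval b s then wp c (\<lambda>t. Q (1 + t)) s else wp d (\<lambda>t. Q (1 + t)) s"
  then show "wp (Cond b c d) Q s"
    unfolding wp_def by (cases "bval b s") (simp_all, (blast intro: exec_CondTrue[simplified] exec_CondFalse[simplified])+)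
qed

text \<open>\<open>I k s\<close> carries a time budget: each iteration pays for its test and its
  body out of \<open>k\<close>. The final \<open>+ 1\<close> pays for the test that fails.\<close>

lemma wp_While:
  assumes step: "\<And>k s. I k s \<Longrightarrow> bval b s \<Longrightarrow> wp c (\<lambda>t s'. \<exists>k'. I k' s' \<and> 1 + t + k' \<le> k) s"
    and "I k s"
  shows "wp (While b c) (\<lambda>t s'. t \<le> k + 1 \<and> \<not> bval b s' \<and> (\<exists>k'. I k' s')) s"
  using \<open>I k s\<close>
proof (induction k arbitrary: s rule: less_induct)
  case (less k)
  show ?case
  proof (cases "bval b s")
    case True
    from step[OF less.prems True] obtain t s' k'
      where e: "exec c s t s'" and k': "I k' s'" "1 + t + k' \<le> k" by (auto simp: wp_def)
    then obtain u s'' where "exec (While b c) s' u s''"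
        "u \<le> k' + 1 \<and> \<not> bval b s'' \<and> (\<exists>k'. I k' s'')"
      using less.IH[of k' s'] by (auto simp: wp_def)
    moreover from this(1) e True have "exec (While b c) s (1 + t + u) s''"
      by (blast intro: exec_WhileTrue)
    ultimately show ?thesis
      unfolding wp_def using k' by (intro exI[of _ "1 + t + u"] exI[of _ s'']) auto
  next
    case False
    with less.prems show ?thesis
      unfolding wp_def by (intro exI[of _ 1] exI[of _ s]) (auto intro: exec_WhileFalse[simplified])
  qed
qed

fun nwrites :: "cmd \<Rightarrow> name set" where
  "nwrites Skip = {}"
| "nwrites (NStore a e f) = {a}"
| "nwrites (RStore a e f) = {}"
| "nwrites (Seq c d) = nwrites c \<union> nwrites d"
| "nwrites (Cond b c d) = nwrites c \<union> nwrites d"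
| "nwrites (While b c) = nwrites c"

fun rwrites :: "cmd \<Rightarrow> name set" where
  "rwrites Skip = {}"
| "rwrites (NStore a e f) = {}"
| "rwrites (RStore a e f) = {a}"
| "rwrites (Seq c d) = rwrites c \<union> rwrites d"
| "rwrites (Cond b c d) = rwrites c \<union> rwrites d"
| "rwrites (While b c) = rwrites c"

text \<open>A syntactic frame condition; it allows the specification of a subprogram to omit the
  arrays that it never writes.\<close>

definition unchanged :: "cmd \<Rightarrow> state \<Rightarrow> state \<Rightarrow> bool" where
  "unchanged c s s' \<longleftrightarrow>
     (\<forall>a. a \<notin> nwrites c \<longrightarrow> nmem s' a = nmem s a) \<and> (\<forall>a. a \<notin> rwrites c \<longrightarrow> rmem s' a = rmem s a)"

lemma exec_unchanged: "exec c s t s' \<Longrightarrow> unchanged c s s'"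
  unfolding unchanged_def
  by (induction rule: exec.induct) (auto simp: nstore_def rstore_def)

lemma wp_frame: "wp c Q s \<Longrightarrow> wp c (\<lambda>t s'. Q t s' \<and> unchanged c s s') s"
  unfolding wp_def using exec_unchanged by blast

lemma nmem_nstore [simp]: "nmem (nstore a i x s) b = (if b = a then (nmem s a)(i := x) else nmem s b)"
  by (simp add: nstore_def)

lemma rmem_nstore [simp]: "rmem (nstore a i x s) = rmem s"
  by (simp add: nstore_def)

lemma rmem_rstore [simp]: "rmem (rstore a i x s) b = (if b = a then (rmem s a)(i := x) else rmem s b)"
  by (simp add: rstore_def)

lemma nmem_rstore [simp]: "nmem (rstore a i x s) = nmem s"
  by (simp add: rstore_def)

section \<open>Jordan curves between two graphs\<close>

text \<open>For positive \<open>r\<close> this maps the strip \<open>-1 \<le> Im z \<le> 1\<close>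
  fibrewise onto the region between the graphs of \<open>m - r\<close> and
  \<open>m + r\<close>.\<close>

definition shear :: "(real \<Rightarrow> real) \<Rightarrow> (real \<Rightarrow> real) \<Rightarrow> complex \<Rightarrow> complex" where
  "shear m r z = Complex (Re z) (m (Re z) + r (Re z) * Im z)"

lemma Re_shear [simp]: "Re (shear m r z) = Re z"
  and Im_shear [simp]: "Im (shear m r z) = m (Re z) + r (Re z) * Im z"
  by (simp_all add: shear_def)

lemma continuous_on_shear:
  assumes "continuous_on UNIV m" "continuous_on UNIV r"
  shows "continuous_on S (shear m r)"
proof -
  have "continuous_on S (\<lambda>z. m (Re z))" "continuous_on S (\<lambda>z. r (Re z))"
    by (auto intro!: continuous_on_compose2[OF assms(1)] continuous_on_compose2[OF assms(2)]
        continuous_intros)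
  then show ?thesis
    unfolding shear_def Complex_eq by (intro continuous_intros)
qed

lemma inj_shear: "(\<And>x. r x > 0) \<Longrightarrow> inj (shear m r)"
  by (intro injI complex_eqI) (auto simp: complex_eq_iff less_le)

text \<open>\<open>rectpath\<close> nests three \<open>joinpaths\<close>, so its sides occupy the
  parameter intervals [0, 1/2], [1/2, 3/4], [3/4, 7/8] and [7/8, 1]. Hence the scaling 1/2 here and
  the constants 3/4 and 1/8 for the top.\<close>

lemma rectpath_bottom:
  assumes "a \<in> {a1..b1}" "a1 < b1"
  shows "rectpath (Complex a1 a2) (Complex b1 b2) ((a - a1) / (b1 - a1) / 2) = Complex a a2"
proof -
  define u where "u = (a - a1) / (b1 - a1)"
  have "u * (b1 - a1) = a - a1" "u \<le> 1" using assms by (simp_all add: u_def)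
  then show ?thesis unfolding u_def[symmetric]
    by (simp add: rectpath_def Let_def joinpaths_def linepath_def complex_eq_iff algebra_simps)
qed

lemma rectpath_top:
  assumes "a \<in> {a1..<b1}"
  shows "rectpath (Complex a1 a2) (Complex b1 b2) (3/4 + (b1 - a) / (b1 - a1) / 8) = Complex a b2"
proof -
  define u where "u = (b1 - a) / (b1 - a1)"
  have "u * (b1 - a1) = b1 - a" "0 < u" "u \<le> 1" using assms by (simp_all add: u_def)
  then show ?thesis unfolding u_def[symmetric]
    by (auto simp: rectpath_def Let_def joinpaths_def linepath_def complex_eq_iff algebra_simps)
qed

text \<open>Along the rectangle the vertical coordinate of the sheared path and of the shifted rectangle
  lie on the same side of \<open>m (Re z)\<close>, so the straight line homotopy avoids the centre.\<close>

lemma winding_number_shear_rectpath: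
  assumes cont: "continuous_on UNIV m" "continuous_on UNIV r" and pos: "\<And>x. r x > 0"
    and z: "z \<in> box a b" "Im z = 0"
  shows "winding_number (shear m r \<circ> rectpath a b) (shear m r z) = 1"
proof -
  let ?R = "rectpath a b"
  have ab: "Re a < Re b" "Im a < Im b" using z by (auto simp: in_box_complex_iff)
  define d where "d = Complex 0 (m (Re z))"
  have zd: "shear m r z = z + d" by (simp add: complex_eq_iff d_def z)
  have "homotopic_loops (- {shear m r z}) (shear m r \<circ> ?R) (\<lambda>t. ?R t + d)"
  proof (rule homotopic_loops_linear)
    show "path (shear m r \<circ> ?R)"
      by (intro path_continuous_image continuous_on_shear cont) auto
    have "path ((\<lambda>w. w + d) \<circ> ?R)"
      by (intro path_continuous_image) (auto intro!: continuous_intros)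
    then show "path (\<lambda>t. ?R t + d)" by (simp add: o_def)
    show "pathfinish (shear m r \<circ> ?R) = pathstart (shear m r \<circ> ?R)"
      by (simp add: pathfinish_compose pathstart_compose)
    show "pathfinish (\<lambda>t. ?R t + d) = pathstart (\<lambda>t. ?R t + d)"
      using pathfinish_rectpath[of a b] pathstart_rectpath[of a b]
      by (simp add: pathfinish_def pathstart_def)
    fix t :: real assume t: "t \<in> {0..1}"
    have "?R t \<in> path_image ?R" using t by (auto simp: path_image_def)
    then have nz: "?R t \<noteq> z"
      using path_image_rectpath_cbox_minus_box[of a b] ab z by auto
    show "closed_segment ((shear m r \<circ> ?R) t) (?R t + d) \<subseteq> - {shear m r z}"
    proof
      fix w assume "w \<in> closed_segment ((shear m r \<circ> ?R) t) (?R t + d)"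
      then obtain u where u: "0 \<le> u" "u \<le> 1"
        and w: "w = (1 - u) *\<^sub>R shear m r (?R t) + u *\<^sub>R (?R t + d)"
        by (auto simp: closed_segment_def)
      have "w \<noteq> z + d"
      proof
        assume "w = z + d"
        then have *: "Re w = Re z" "Im w = m (Re z)" by (simp_all add: d_def z)
        then have Re: "Re (?R t) = Re z" by (simp add: w d_def algebra_simps)
        \<comment> \<open>Both ends of the segment lie on the vertical line through
          \<open>z\<close>, at height \<open>m (Re z)\<close> plus a positive multiple of
          \<open>Im (?R t)\<close>; so does every point between them.\<close>
        with * have "((1 - u) * r (Re z) + u) * Im (?R t) = 0"
          by (simp add: w d_def algebra_simps)
        moreover have "(1 - u) * r (Re z) + u > 0"
          using u pos[of "Re z"] by (cases "u = 0") (auto intro: add_nonneg_pos)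
        ultimately have "Im (?R t) = 0" by auto
        with Re nz z show False by (auto simp: complex_eq_iff)
      qed
      then show "w \<in> - {shear m r z}" by (simp add: zd)
    qed
  qed
  then have "winding_number (shear m r \<circ> ?R) (shear m r z) = winding_number (\<lambda>t. ?R t + d) (z + d)"
    using winding_number_homotopic_loops zd by metis
  also have "\<dots> = winding_number ?R z"
    by (subst winding_number_offset, subst (2) winding_number_offset) simp
  also have "\<dots> = 1" using z by (intro winding_number_rectpath) auto
  finally show ?thesis .
qed

text \<open>\<open>P\<close> may touch the curve; only the graphs must be strictly apart. The lower
  list follows the bottom side from left to right and the upper list returns along the top, which is
  the sense of \<open>rectpath\<close>.\<close>

lemma ccw_along_boundary_between_graphs:
  fixes f g :: "real \<Rightarrow> real"
  assumes ab: "a < b" and cont: "continuous_on UNIV f" "continuous_on UNIV g"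
    and less: "\<And>x. g x < f x"
    and P: "\<And>x y. (x, y) \<in> P \<Longrightarrow> a \<le> x \<and> x \<le> b \<and> g x \<le> y \<and> y \<le> f x"
    and L: "sorted_wrt (\<lambda>p q. fst p < fst q) L" "\<And>x y. (x, y) \<in> set L \<Longrightarrow> a < x \<and> x < b \<and> y = g x"
    and U: "sorted_wrt (\<lambda>p q. fst p > fst q) U" "\<And>x y. (x, y) \<in> set U \<Longrightarrow> a < x \<and> x < b \<and> y = f x"
  shows "ccw_along_boundary P (L @ U)"
proof -
  define m r where "m x = (f x + g x) / 2" and "r x = (f x - g x) / 2" for x
  define A B where "A = Complex a (-1)" and "B = Complex b 1"
  let ?R = "rectpath A B"
  define \<gamma> where "\<gamma> = shear m r \<circ> ?R"
  have contmr: "continuous_on UNIV m" "continuous_on UNIV r"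
    unfolding m_def r_def by (intro continuous_intros cont; simp)+
  have pos: "r x > 0" for x using less[of x] by (simp add: r_def)
  note inj = inj_shear[of r m, OF pos]
  have simple: "simple_path \<gamma>" unfolding \<gamma>_def
    by (intro simple_path_continuous_image continuous_on_shear contmr inj_on_subset[OF inj])
       (use ab in \<open>auto simp: A_def B_def\<close>)
  have loop: "pathfinish \<gamma> = pathstart \<gamma>"
    by (simp add: \<gamma>_def pathfinish_compose pathstart_compose)
  have img: "path_image \<gamma> = shear m r ` (cbox A B - box A B)"
    using ab by (simp add: \<gamma>_def path_image_compose path_image_rectpath_cbox_minus_box A_def B_def)
  \<comment> \<open>One point of winding number 1 suffices, since the inside is connected and the
    winding number is constant on it.\<close>
  define z where "z = Complex ((a + b) / 2) 0"
  have z: "z \<in> box A B" "Im z = 0" using ab by (auto simp: z_def A_def B_def in_box_complex_iff)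
  have wz: "winding_number \<gamma> (shear m r z) = 1"
    unfolding \<gamma>_def using z by (intro winding_number_shear_rectpath contmr pos)
  have disj: "shear m r ` box A B \<inter> path_image \<gamma> = {}"
    unfolding img using inj by (auto simp: inj_def)
  have z_in: "shear m r z \<in> inside (path_image \<gamma>)"
  proof -
    have "shear m r z \<notin> outside (path_image \<gamma>)"
      using winding_number_zero_in_outside[of \<gamma> "shear m r z"] wz simple loop
      by (auto simp: simple_path_imp_path)
    moreover have "shear m r z \<notin> path_image \<gamma>" using disj z by auto
    ultimately show ?thesis using inside_Un_outside[of "path_image \<gamma>"] by blast
  qed
  \<comment> \<open>The sheared open rectangle is connected, misses the curve and contains a point
    of the inside.\<close>
  have box_in: "shear m r ` box A B \<subseteq> inside (path_image \<gamma>)"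
  proof
    fix w assume w: "w \<in> shear m r ` box A B"
    have "connected (shear m r ` box A B)"
      by (intro connected_continuous_image continuous_on_shear contmr) (simp add: convex_connected)
    with w z disj have "connected_component (- path_image \<gamma>) (shear m r z) w"
      unfolding connected_component_def by (intro exI[of _ "shear m r ` box A B"]) auto
    with z_in show "w \<in> inside (path_image \<gamma>)" by (rule inside_same_component[rotated])
  qed
  have wn: "winding_number \<gamma> w = 1" if "w \<in> inside (path_image \<gamma>)" for w
  proof -
    have "connected (inside (path_image \<gamma>))"
      using Jordan_inside_outside[OF simple loop] by blast
    then have "winding_number \<gamma> w = winding_number \<gamma> (shear m r z)"
      using that z_in simple loop inside_no_overlap[of "path_image \<gamma>"]
      by (intro winding_number_eq[of \<gamma> _ "inside (path_image \<gamma>)"]) (auto simp: simple_path_imp_path)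
    with wz show ?thesis by simp
  qed
  have region: "Complex x y \<in> shear m r ` cbox A B" if "a \<le> x" "x \<le> b" "g x \<le> y" "y \<le> f x" for x y
  proof (rule image_eqI)
    show "Complex x y = shear m r (Complex x ((y - m x) / r x))"
      using pos[of x] by (simp add: complex_eq_iff)
    show "Complex x ((y - m x) / r x) \<in> cbox A B"
      using that pos[of x] by (auto simp: A_def B_def in_cbox_complex_iff field_simps m_def r_def)
  qed
  have "plane ` P \<subseteq> shear m r ` cbox A B"
    using region P by (auto simp: plane_def)
  then have enc: "plane ` P \<subseteq> path_image \<gamma> \<union> inside (path_image \<gamma>)"
    using box_in unfolding img by blast
  define \<tau> where "\<tau> = map (\<lambda>p. (fst p - a) / (b - a) / 2) L
    @ map (\<lambda>p. 3/4 + (b - fst p) / (b - a) / 8) U"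
  have frac: "0 < (x - a) / (b - a) / 2 \<and> (x - a) / (b - a) / 2 < 1/2 \<and>
      (b - x) / (b - a) / 8 > 0 \<and> (b - x) / (b - a) / 8 < 1/8" if "a < x" "x < b" for x
    using that ab by (auto simp: field_simps)
  have Lab: "a < fst p \<and> fst p < b \<and> snd p = g (fst p)" if "p \<in> set L" for p
    using L(2)[of "fst p" "snd p"] that by simp
  have Uab: "a < fst p \<and> fst p < b \<and> snd p = f (fst p)" if "p \<in> set U" for p
    using U(2)[of "fst p" "snd p"] that by simp
  have "sorted_wrt (<) \<tau>"
    unfolding \<tau>_def sorted_wrt_append sorted_wrt_map
  proof (intro conjI ballI)
    show "sorted_wrt (\<lambda>p q. (fst p - a) / (b - a) / 2 < (fst q - a) / (b - a) / 2) L"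
      by (rule sorted_wrt_mono_rel[OF _ L(1)]) (use ab in \<open>auto simp: divide_strict_right_mono\<close>)
    show "sorted_wrt (\<lambda>p q. 3/4 + (b - fst p) / (b - a) / 8 < 3/4 + (b - fst q) / (b - a) / 8) U"
      by (rule sorted_wrt_mono_rel[OF _ U(1)]) (use ab in \<open>auto simp: divide_strict_right_mono\<close>)
  next
    fix s t assume "s \<in> set (map (\<lambda>p. (fst p - a) / (b - a) / 2) L)"
      "t \<in> set (map (\<lambda>p. 3/4 + (b - fst p) / (b - a) / 8) U)"
    then obtain p q where "p \<in> set L" "s = (fst p - a) / (b - a) / 2"
      "q \<in> set U" "t = 3/4 + (b - fst q) / (b - a) / 8" by auto
    then show "s < t" using frac[of "fst p"] frac[of "fst q"] Lab[of p] Uab[of q] by linarith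
  qed
  moreover have "set \<tau> \<subseteq> {0..<1}"
  proof
    fix t assume "t \<in> set \<tau>"
    then obtain p where "p \<in> set L \<and> t = (fst p - a) / (b - a) / 2 \<or>
      p \<in> set U \<and> t = 3/4 + (b - fst p) / (b - a) / 8" by (auto simp: \<tau>_def)
    then have "0 \<le> t \<and> t < 1" using frac[of "fst p"] Lab[of p] Uab[of p] by linarith
    then show "t \<in> {0..<1}" by simp
  qed
  moreover have "map \<gamma> \<tau> = map plane (L @ U)"
  proof -
    have "\<gamma> ((fst p - a) / (b - a) / 2) = plane p" if "p \<in> set L" for p
      using Lab[OF that] ab rectpath_bottom[of "fst p" a b "-1" 1]
      by (simp add: \<gamma>_def A_def B_def plane_def complex_eq_iff m_def r_def) (simp add: field_simps)
    moreover have "\<gamma> (3/4 + (b - fst p) / (b - a) / 8) = plane p" if "p \<in> set U" for p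
      using Uab[OF that] ab rectpath_top[of "fst p" a b "-1" 1]
      by (simp add: \<gamma>_def A_def B_def plane_def complex_eq_iff m_def r_def) (simp add: field_simps)
    ultimately show ?thesis by (auto simp: \<tau>_def)
  qed
  ultimately show ?thesis
    unfolding ccw_along_boundary_def using simple loop wn enc by blast
qed

section \<open>Tropical hulls and maxima\<close>

text \<open>In homogeneous coordinates this is the cyclic shift of (0, x, y) to (x, y, 0), followed
  by normalization.\<close>

definition rot :: "tp2 \<Rightarrow> tp2" where
  "rot p = (snd p - fst p, - fst p)"

text \<open>The closed sector \<open>k\<close> at \<open>q\<close> consists of the points \<open>s\<close> with \<open>dom_le (key k q) (key k s)\<close>; the rotation
  \<open>rot\<close> has order 3 and permutes the sectors.\<close>

definition key :: "nat \<Rightarrow> tp2 \<Rightarrow> tp2" where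
  "key k = rot ^^ k"

definition dom_le :: "tp2 \<Rightarrow> tp2 \<Rightarrow> bool" where
  "dom_le p q \<longleftrightarrow> fst p \<le> fst q \<and> snd p \<le> snd q"

definition maxima :: "nat \<Rightarrow> tp2 set \<Rightarrow> tp2 set" where
  "maxima k S = {p \<in> S. \<forall>s\<in>S. dom_le (key k p) (key k s) \<longrightarrow> s = p}"

lemma key_0 [simp]: "key 0 p = p"
  and key_1: "key (Suc 0) p = (snd p - fst p, - fst p)"
  and key_2: "key 2 p = (- snd p, fst p - snd p)"
  by (simp_all add: key_def rot_def numeral_2_eq_2)

lemmas key_simps = key_1 key_2 dom_le_def

lemma inj_key: "inj (key k)"
proof -
  have "inj rot" by (auto simp: inj_def rot_def prod_eq_iff)
  then show ?thesis unfolding key_def by (induction k) (auto intro: inj_compose)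
qed

lemma dom_le_refl [simp]: "dom_le p p"
  by (simp add: dom_le_def)

lemma dom_le_trans: "dom_le p q \<Longrightarrow> dom_le q r \<Longrightarrow> dom_le p r"
  by (auto simp: dom_le_def)

lemma dom_le_antisym: "dom_le p q \<Longrightarrow> dom_le q p \<Longrightarrow> p = q"
  by (auto simp: dom_le_def prod_eq_iff)

lemma maxima_subset: "maxima k S \<subseteq> S"
  by (auto simp: maxima_def)

text \<open>Among the points dominating \<open>s\<close>, one with the largest sum of key
  coordinates is maximal: whatever dominates it has at least the same sum, hence the same
  key.\<close>

lemma ex_maxima_above:
  assumes "finite S" "s \<in> S"
  obtains m where "m \<in> maxima k S" "dom_le (key k s) (key k m)"
proof -
  define w where "w t = fst (key k t) + snd (key k t)" for t
  define T where "T = {t \<in> S. dom_le (key k s) (key k t)}"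
  have T: "finite T" "T \<noteq> {}" using assms dom_le_refl unfolding T_def by (simp, blast)
  then obtain m where m: "m \<in> T" "\<And>t. t \<in> T \<Longrightarrow> w t \<le> w m"
    using Max_in[of "w ` T"] Max_ge[of "w ` T"] by (metis (no_types, lifting) finite_imageI image_iff image_is_empty)
  have "t = m" if t: "t \<in> S" "dom_le (key k m) (key k t)" for t
  proof -
    have "t \<in> T" using t m(1) by (auto simp: T_def intro: dom_le_trans)
    with m(2) t(2) have "key k t = key k m"
      by (fastforce simp: w_def dom_le_def prod_eq_iff)
    then show ?thesis using inj_key[of k] by (rule injD[rotated])
  qed
  with m(1) show ?thesis by (intro that[of m]) (auto simp: maxima_def T_def)
qed

lemma homog_nth [simp]: "homog p $ 1 = 0" "homog p $ 2 = fst p" "homog p $ 3 = snd p"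
  by (simp_all add: homog_def)

lemma all_less_3: "(\<forall>k<3. P k) \<longleftrightarrow> P 0 \<and> P (Suc 0) \<and> P (2 :: nat)"
  by (auto simp: numeral_eq_Suc less_Suc_eq)

text \<open>A tropical combination attains each coordinate at some point, and the point attaining
  coordinate \<open>i\<close> lies in the corresponding sector. Conversely, one point from each
  sector is enough to generate \<open>q\<close>.\<close>

lemma mem_tconv_iff:
  "q \<in> tconv S \<longleftrightarrow> (\<forall>k<3. \<exists>s\<in>S. dom_le (key k q) (key k s))"
proof
  assume "q \<in> tconv S"
  then obtain F l where F: "finite F" "F \<noteq> {}" "F \<subseteq> S" and q: "q = normalize_tp2 (trop_comb F l)"
    by (auto simp: tconv_def)
  let ?u = "trop_comb F l"
  have *: "\<exists>x\<in>S. \<forall>j. homog x $ i - ?u $ i \<le> homog x $ j - ?u $ j" for i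
  proof -
    have "?u $ i \<in> (\<lambda>x. l x + homog x $ i) ` F"
      using F by (simp add: trop_comb_def)
    then obtain x where x: "x \<in> F" "?u $ i = l x + homog x $ i" by auto
    have "?u $ j \<le> l x + homog x $ j" for j
      using F x by (simp add: trop_comb_def)
    with x F show ?thesis by (intro bexI[of _ x]) (auto simp: algebra_simps)
  qed
  have "\<exists>s\<in>S. dom_le (key 0 q) (key 0 s)"
  proof -
    obtain x where "x \<in> S" "\<forall>j. homog x $ 1 - ?u $ 1 \<le> homog x $ j - ?u $ j" using *[of 1] by blast
    then show ?thesis
      unfolding forall_3 homog_nth q normalize_tp2_def key_0 key_simps fst_conv snd_conv
      by (intro bexI[of _ x]) linarith+
  qed
  moreover have "\<exists>s\<in>S. dom_le (key (Suc 0) q) (key (Suc 0) s)"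
  proof -
    obtain x where "x \<in> S" "\<forall>j. homog x $ 2 - ?u $ 2 \<le> homog x $ j - ?u $ j" using *[of 2] by blast
    then show ?thesis
      unfolding forall_3 homog_nth q normalize_tp2_def key_0 key_simps fst_conv snd_conv
      by (intro bexI[of _ x]) linarith+
  qed
  moreover have "\<exists>s\<in>S. dom_le (key 2 q) (key 2 s)"
  proof -
    obtain x where "x \<in> S" "\<forall>j. homog x $ 3 - ?u $ 3 \<le> homog x $ j - ?u $ j" using *[of 3] by blast
    then show ?thesis
      unfolding forall_3 homog_nth q normalize_tp2_def key_0 key_simps fst_conv snd_conv
      by (intro bexI[of _ x]) linarith+
  qed
  ultimately show "\<forall>k<3. \<exists>s\<in>S. dom_le (key k q) (key k s)"
    unfolding all_less_3 by blast
next
  assume *: "\<forall>k<3. \<exists>s\<in>S. dom_le (key k q) (key k s)"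
  obtain s0 s1 s2 where s: "s0 \<in> S" "dom_le (key 0 q) (key 0 s0)" "s1 \<in> S"
    "dom_le (key (Suc 0) q) (key (Suc 0) s1)" "s2 \<in> S" "dom_le (key 2 q) (key 2 s2)"
    using * unfolding all_less_3 by blast
  define F where "F = {s0, s1, s2}"
  \<comment> \<open>The least coefficient that lifts \<open>x\<close> to at least \<open>q\<close>
    in every coordinate; the witness of a sector then attains equality in the coordinate of that
    sector.\<close>
  define l where "l x = max 0 (max (fst q - fst x) (snd q - snd x))" for x
  have eq: "Min ((\<lambda>x. l x + homog x $ i) ` F) = homog q $ i"
    if "x \<in> F" "l x + homog x $ i = homog q $ i" for i x
  proof (rule Min_eqI)
    have "homog q $ i \<le> l y + homog y $ i" for y
      using exhaust_3[of i] by (auto simp: l_def)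
    then show "\<And>y. y \<in> (\<lambda>x. l x + homog x $ i) ` F \<Longrightarrow> homog q $ i \<le> y" by auto
    show "homog q $ i \<in> (\<lambda>x. l x + homog x $ i) ` F" using that by force
  qed (simp add: F_def)
  have "l s0 + homog s0 $ 1 = homog q $ 1" "l s1 + homog s1 $ 2 = homog q $ 2"
    "l s2 + homog s2 $ 3 = homog q $ 3"
    using s by (auto simp: l_def key_simps)
  then have "trop_comb F l = homog q"
    using eq[of s0 1] eq[of s1 2] eq[of s2 3] by (simp add: vec_eq_iff forall_3 trop_comb_def F_def)
  then have "q = normalize_tp2 (trop_comb F l)" by (simp add: normalize_tp2_def)
  then show "q \<in> tconv S" using s unfolding tconv_def F_def by blast
qed

lemma subset_tconv: "S \<subseteq> tconv S"
  using dom_le_refl unfolding subset_iff mem_tconv_iff by blast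

lemma tconv_mono: "S \<subseteq> T \<Longrightarrow> tconv S \<subseteq> tconv T"
  unfolding tconv_def by blast

text \<open>The maxima generate the hull and lie in every set generating it, even one not contained
  in \<open>S\<close>. They are thus the least generating set, and minimality forces any other
  candidate to equal it.\<close>

lemma tvertices_eq:
  assumes S: "finite S"
  shows "tvertices S = (\<Union>k<3. maxima k S)"
proof -
  let ?E = "\<Union>k<3. maxima k S"
  have sub: "?E \<subseteq> S" using maxima_subset by auto
  have eq: "tconv ?E = tconv S"
  proof
    show "tconv ?E \<subseteq> tconv S" by (rule tconv_mono[OF sub])
    show "tconv S \<subseteq> tconv ?E"
    proof
      fix q assume q: "q \<in> tconv S"
      have "\<exists>s\<in>?E. dom_le (key k q) (key k s)" if k: "k < 3" for k
      proof -
        obtain s where "s \<in> S" "dom_le (key k q) (key k s)" using q k unfolding mem_tconv_iff by blast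
        moreover from this S obtain m where "m \<in> maxima k S" "dom_le (key k s) (key k m)"
          using ex_maxima_above by blast
        ultimately show ?thesis using k by (blast intro: dom_le_trans)
      qed
      then show "q \<in> tconv ?E" by (simp add: mem_tconv_iff)
    qed
  qed
  have least: "?E \<subseteq> V" if V: "tconv V = tconv S" for V
  proof
    fix p assume "p \<in> ?E"
    then obtain k where k: "k < 3" "p \<in> maxima k S" by auto
    then have "p \<in> tconv V" using subset_tconv[of S] V by (auto simp: maxima_def)
    then obtain v where v: "v \<in> V" "dom_le (key k p) (key k v)" using k unfolding mem_tconv_iff by blast
    then have "v \<in> tconv S" using subset_tconv[of V] V by auto
    then obtain s where s: "s \<in> S" "dom_le (key k v) (key k s)" using k unfolding mem_tconv_iff by blast
    have "dom_le (key k p) (key k s)" using v(2) s(2) by (rule dom_le_trans)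
    then have "s = p" using k s(1) by (simp add: maxima_def)
    then have "key k v = key k p" using v(2) s(2) dom_le_antisym by blast
    then have "v = p" using inj_key[of k] by (rule injD[rotated])
    with v show "p \<in> V" by simp
  qed
  show ?thesis
    unfolding tvertices_def
  proof (rule the_equality)
    have "tconv W \<noteq> tconv S" if "W \<subset> ?E" for W
      using least[of W] that by (auto simp only: psubset_eq)
    with sub subset_tconv[of S] eq
    show "?E \<subseteq> tconv S \<and> tconv ?E = tconv S \<and> (\<forall>W. W \<subset> ?E \<longrightarrow> tconv W \<noteq> tconv S)"
      by (meson order_trans)
    fix V assume V: "V \<subseteq> tconv S \<and> tconv V = tconv S \<and> (\<forall>W. W \<subset> V \<longrightarrow> tconv W \<noteq> tconv S)"
    then have "?E \<subseteq> V" using least by simp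
    moreover have "\<not> ?E \<subset> V" using V eq by metis
    ultimately show "V = ?E" by (simp only: psubset_eq) auto
  qed
qed

text \<open>Apart from a possible common point, staircase 1 lies strictly to the left of staircase
  0; this lets the two be joined into one upper list.\<close>

lemma maxima_fst_less:
  assumes "p \<in> maxima (Suc 0) S" "q \<in> maxima 0 S" "p \<noteq> q"
  shows "fst p < fst q"
proof -
  have "\<not> dom_le (key (Suc 0) p) (key (Suc 0) q)" "\<not> dom_le (key 0 q) (key 0 p)"
    using assms by (auto simp: maxima_def)
  then show ?thesis unfolding key_simps key_0 fst_conv snd_conv by linarith
qed

text \<open>A point common to staircases 0 and 2 is the unique rightmost point of \<open>S\<close>,
  and one common to 1 and 2 is the unique leftmost one. This locates the possible duplicates in the
  output.\<close>

lemma maxima_0_2_fst_less: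
  assumes "p \<in> maxima 0 S" "p \<in> maxima 2 S" "q \<in> S" "p \<noteq> q"
  shows "fst q < fst p"
proof -
  have "\<not> dom_le (key 2 p) (key 2 q)" "\<not> dom_le (key 0 p) (key 0 q)"
    using assms unfolding maxima_def by blast+
  then show ?thesis unfolding key_simps key_0 fst_conv snd_conv by linarith
qed

lemma maxima_1_2_fst_less:
  assumes "p \<in> maxima (Suc 0) S" "p \<in> maxima 2 S" "q \<in> S" "p \<noteq> q"
  shows "fst p < fst q"
proof -
  have "\<not> dom_le (key 2 p) (key 2 q)" "\<not> dom_le (key (Suc 0) p) (key (Suc 0) q)"
    using assms unfolding maxima_def by blast+
  then show ?thesis unfolding key_simps key_0 fst_conv snd_conv by linarith
qed

section \<open>Continuous graphs enclosing the hull\<close>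

lemma continuous_on_Max_image:
  fixes f :: "'i \<Rightarrow> real \<Rightarrow> real"
  assumes "finite A" "A \<noteq> {}" "\<And>i. i \<in> A \<Longrightarrow> continuous_on T (f i)"
  shows "continuous_on T (\<lambda>x. Max ((\<lambda>i. f i x) ` A))"
  using assms by (induction rule: finite_ne_induct) (auto intro!: continuous_on_max)

lemma continuous_on_Min_image:
  fixes f :: "'i \<Rightarrow> real \<Rightarrow> real"
  assumes "finite A" "A \<noteq> {}" "\<And>i. i \<in> A \<Longrightarrow> continuous_on T (f i)"
  shows "continuous_on T (\<lambda>x. Min ((\<lambda>i. f i x) ` A))"
  using assms by (induction rule: finite_ne_induct) (auto intro!: continuous_on_min)

text \<open>Supplies the gap that pushes a graph away from the hull except at the listed abscissae.
  For empty \<open>X\<close> the product is the constant 1.\<close>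

lemma ex_continuous_vanishing_on:
  fixes X :: "real set"
  assumes "finite X"
  shows "\<exists>d :: real \<Rightarrow> real. continuous_on UNIV d \<and> (\<forall>x. d x \<ge> 0) \<and> (\<forall>x. d x = 0 \<longleftrightarrow> x \<in> X)"
proof (intro exI conjI allI)
  let ?d = "\<lambda>x. \<Prod>y\<in>X. \<bar>x - y\<bar>"
  show "continuous_on UNIV ?d" by (intro continuous_intros)
  show "?d x \<ge> 0" for x by (simp add: prod_nonneg)
  show "?d x = 0 \<longleftrightarrow> x \<in> X" for x using assms by auto
qed

text \<open>A common slope for all ramps, large enough to dominate the differences of
  \<open>snd\<close> and of \<open>snd - fst\<close> alike.\<close>

lemma ex_slope_bound:
  assumes "finite S"
  shows "\<exists>K::real. K \<ge> 0 \<and> (\<forall>p\<in>S. \<forall>q\<in>S. fst (p :: tp2) \<noteq> fst q \<longrightarrow>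
       \<bar>snd q - snd p\<bar> + \<bar>fst q - fst p\<bar> \<le> K * \<bar>fst q - fst p\<bar>)"
proof -
  define h where "h z = (\<bar>snd (snd z) - snd (fst z)\<bar> + \<bar>fst (snd z) - fst (fst z)\<bar>)
    / \<bar>fst (snd z) - fst (fst z)\<bar>" for z :: "tp2 \<times> tp2"
  define K where "K = Max (insert 0 (h ` (S \<times> S)))"
  have fin: "finite (insert 0 (h ` (S \<times> S)))" using assms by simp
  show ?thesis
  proof (intro exI conjI ballI impI)
    show "K \<ge> 0" unfolding K_def by (rule Max_ge[OF fin]) simp
    fix p q :: tp2 assume pq: "p \<in> S" "q \<in> S" "fst p \<noteq> fst q"
    then have "h (p, q) \<le> K" unfolding K_def by (intro Max_ge[OF fin]) auto
    with pq show "\<bar>snd q - snd p\<bar> + \<bar>fst q - fst p\<bar> \<le> K * \<bar>fst q - fst p\<bar>"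
      by (simp add: h_def pos_divide_le_eq)
  qed
qed

lemma tconv_bounds:
  assumes "(x, y) \<in> tconv S"
  obtains s t u where "s \<in> S" "x \<le> fst s" "y \<le> snd s"
    "t \<in> S" "fst t \<le> x" "y - x \<le> snd t - fst t"
    "u \<in> S" "snd u \<le> y" "x - y \<le> fst u - snd u"
  using assms unfolding mem_tconv_iff all_less_3 by (auto simp: key_simps)

text \<open>The upper graph dominates the two staircases formed by the corresponding maxima, with the
  jumps replaced by steep ramps; the lower graph is the lower envelope of the hull.  Both are
  pushed apart except at the abscissae of the points to be listed.\<close>

lemma ex_enclosing_graphs:
  assumes S: "finite S" "S \<noteq> {}" and L: "L \<subseteq> maxima 2 S"
    and U: "U \<subseteq> maxima 0 S \<union> maxima (Suc 0) S" and disj: "L \<inter> U = {}"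
  shows "\<exists>f g :: real \<Rightarrow> real. continuous_on UNIV f \<and> continuous_on UNIV g \<and>
    (\<forall>x. Min (fst ` S) \<le> x \<longrightarrow> x \<le> Max (fst ` S) \<longrightarrow> g x < f x) \<and>
    (\<forall>x y. (x, y) \<in> tconv S \<longrightarrow> g x \<le> y \<and> y \<le> f x) \<and>
    (\<forall>p\<in>L. g (fst p) = snd p) \<and> (\<forall>p\<in>U. f (fst p) = snd p)"
proof -
  obtain K where "K \<ge> 0 \<and> (\<forall>p\<in>S. \<forall>q\<in>S. fst (p :: tp2) \<noteq> fst q \<longrightarrow>
       \<bar>snd q - snd p\<bar> + \<bar>fst q - fst p\<bar> \<le> K * \<bar>fst q - fst p\<bar>)"
    using ex_slope_bound[OF S(1)] ..
  then have K: "K \<ge> 0" "\<And>p q :: tp2. p \<in> S \<Longrightarrow> q \<in> S \<Longrightarrow> fst p \<noteq> fst q \<Longrightarrow>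
       \<bar>snd q - snd p\<bar> + \<bar>fst q - fst p\<bar> \<le> K * \<bar>fst q - fst p\<bar>"
    by blast+
  have LS: "L \<subseteq> S" and US: "U \<subseteq> S" using L U by (auto simp: maxima_def)
  obtain dU :: "real \<Rightarrow> real" where "continuous_on UNIV dU \<and> (\<forall>x. dU x \<ge> 0) \<and> (\<forall>x. dU x = 0 \<longleftrightarrow> x \<in> fst ` U)"
    using ex_continuous_vanishing_on[OF finite_imageI[of U fst, OF finite_subset[OF US S(1)]]] ..
  then have dU: "continuous_on UNIV dU" "\<And>x. dU x \<ge> 0" "\<And>x. dU x = 0 \<longleftrightarrow> x \<in> fst ` U"
    by blast+
  obtain dL :: "real \<Rightarrow> real" where "continuous_on UNIV dL \<and> (\<forall>x. dL x \<ge> 0) \<and> (\<forall>x. dL x = 0 \<longleftrightarrow> x \<in> fst ` L)"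
    using ex_continuous_vanishing_on[OF finite_imageI[of L fst, OF finite_subset[OF LS S(1)]]] ..
  then have dL: "continuous_on UNIV dL" "\<And>x. dL x \<ge> 0" "\<And>x. dL x = 0 \<longleftrightarrow> x \<in> fst ` L"
    by blast+
  \<comment> \<open>A point \<open>s\<close> in sector 0 bounds the height by \<open>snd s\<close>
    to the left of \<open>s\<close>; in sector 1 it gives a line of slope 1 to the right. Ramps of
    slope \<open>K\<close> replace the jumps on the other sides. \<open>e2\<close> is the lower edge
    of the region whose points see \<open>s\<close> in sector 2.\<close>
  define e0 where "e0 s x = snd s - K * max 0 (x - fst s)" for s :: tp2 and x
  define e1 where "e1 s x = snd s + x - fst s - K * max 0 (fst s - x)" for s :: tp2 and x
  define e2 where "e2 s x = snd s + max 0 (x - fst s)" for s :: tp2 and x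
  define f0 where "f0 x = Max ((\<lambda>s. e0 s x) ` S)" for x
  define f1 where "f1 x = Max ((\<lambda>s. e1 s x) ` S)" for x
  define g0 where "g0 x = Min ((\<lambda>s. e2 s x) ` S)" for x
  \<comment> \<open>A hull point needs a point in sector 0 and one in sector 1, hence the minimum of
    the two upper bounds.\<close>
  define f where "f x = min (f0 x) (f1 x) + dU x" for x
  define g where "g x = g0 x - dL x" for x
  have cont: "continuous_on UNIV f" "continuous_on UNIV g"
    unfolding f_def f0_def f1_def e0_def e1_def g_def g0_def e2_def using S
    by (intro continuous_intros continuous_on_Max_image continuous_on_Min_image dU dL; simp)+
  have f0_ge: "snd s \<le> f0 x" if "s \<in> S" "x \<le> fst s" for s x
  proof -
    have "e0 s x \<le> f0 x" unfolding f0_def using S that by (intro Max_ge) auto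
    then show ?thesis using that by (simp add: e0_def)
  qed
  have f1_ge: "snd s + x - fst s \<le> f1 x" if "s \<in> S" "fst s \<le> x" for s x
  proof -
    have "e1 s x \<le> f1 x" unfolding f1_def using S that by (intro Max_ge) auto
    then show ?thesis using that by (simp add: e1_def)
  qed
  have g0_le: "g0 x \<le> snd s + max 0 (x - fst s)" if "s \<in> S" for s x
    unfolding g0_def e2_def[symmetric] using S that by (intro Min_le) auto
  have f_at: "f0 (fst p) \<ge> snd p" "f1 (fst p) \<ge> snd p" "g0 (fst p) \<le> snd p" if "p \<in> S" for p
    using f0_ge[OF that, of "fst p"] f1_ge[OF that, of "fst p"] g0_le[OF that, of "fst p"] by auto
  have f0_eq: "f0 (fst p) = snd p" if p: "p \<in> maxima 0 S" for p
  proof -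
    have "e0 s (fst p) \<le> snd p" if s: "s \<in> S" for s
    proof (cases "fst p \<le> fst s")
      case True
      then have "\<not> snd s > snd p"
        using p s by (auto simp: maxima_def dom_le_def)
      then show ?thesis using True by (simp add: e0_def)
    next
      case False
      then show ?thesis using K(2)[of p s] s p by (auto simp: e0_def maxima_def)
    qed
    then have "f0 (fst p) \<le> snd p" unfolding f0_def using S by (intro Max.boundedI) auto
    then show ?thesis using f_at(1)[of p] p by (auto simp: maxima_def)
  qed
  have f1_eq: "f1 (fst p) = snd p" if p: "p \<in> maxima (Suc 0) S" for p
  proof -
    have "e1 s (fst p) \<le> snd p" if s: "s \<in> S" for s
    proof (cases "fst s \<le> fst p")
      case True
      have "\<not> snd s - fst s > snd p - fst p"
      proof
        assume *: "snd s - fst s > snd p - fst p"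
        then have "s = p" using p s True by (auto simp: maxima_def key_simps)
        with * show False by simp
      qed
      then show ?thesis using True by (simp add: e1_def)
    next
      case False
      then show ?thesis using K(2)[of p s] s p by (auto simp: e1_def maxima_def)
    qed
    then have "f1 (fst p) \<le> snd p" unfolding f1_def using S by (intro Max.boundedI) auto
    then show ?thesis using f_at(2)[of p] p by (auto simp: maxima_def)
  qed
  have g0_eq: "g0 (fst p) = snd p" if p: "p \<in> maxima 2 S" for p
  proof -
    have "snd p \<le> e2 s (fst p)" if s: "s \<in> S" for s
    proof (rule ccontr)
      assume *: "\<not> snd p \<le> e2 s (fst p)"
      then have "s = p" using p s by (auto simp: maxima_def key_simps e2_def)
      with * show False by (simp add: e2_def)
    qed
    then have "g0 (fst p) \<ge> snd p" unfolding g0_def using S by (intro Min.boundedI) auto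
    then show ?thesis using f_at(3)[of p] p by (auto simp: maxima_def)
  qed
  \<comment> \<open>The restriction to the abscissae of the hull matters: further out the ramps can
    fall below \<open>g0\<close>.\<close>
  have between: "g0 x \<le> min (f0 x) (f1 x)" if x: "Min (fst ` S) \<le> x" "x \<le> Max (fst ` S)" for x
  proof -
    have "Min (fst ` S) \<in> fst ` S" "Max (fst ` S) \<in> fst ` S"
      using S by (intro Min_in Max_in; simp)+
    then obtain s t where st: "s \<in> S" "fst s \<le> x" "t \<in> S" "x \<le> fst t"
      using x by (metis imageE)
    have "g0 x \<le> snd t" using g0_le[OF st(3), of x] st by simp
    moreover have "g0 x \<le> snd s + x - fst s" using g0_le[OF st(1), of x] st by simp
    ultimately show ?thesis using f0_ge[OF st(3,4)] f1_ge[OF st(1,2)] by linarith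
  qed
  show ?thesis
  proof (rule exI[of _ f], rule exI[of _ g], intro conjI cont allI ballI impI)
    show "g x < f x" if x: "Min (fst ` S) \<le> x" "x \<le> Max (fst ` S)" for x
    \<comment> \<open>If both gaps vanish at \<open>x\<close>, two distinct listed points share this
      abscissa, and maximality for order 2 puts the one in \<open>L\<close> strictly lower.\<close>
    proof (cases "x \<in> fst ` U \<and> x \<in> fst ` L")
      case True
      then obtain p q where pq: "p \<in> U" "q \<in> L" "x = fst p" "x = fst q" by auto
      then have mem: "p \<in> S" "q \<in> S" "p \<noteq> q" using disj LS US by auto
      have "\<not> dom_le (key 2 q) (key 2 p)" using mem pq L by (auto simp: maxima_def)
      then have "snd q < snd p" using pq by (auto simp: key_simps)
      moreover have "g0 x = snd q" using g0_eq[of q] pq L by auto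
      moreover have "snd p \<le> min (f0 x) (f1 x)" using f_at[of p] mem pq by auto
      ultimately show ?thesis using dU(2)[of x] dL(2)[of x] unfolding f_def g_def by linarith
    next
      case False
      then have "dU x > 0 \<or> dL x > 0" using dU(2,3)[of x] dL(2,3)[of x] by (auto simp: less_le)
      then show ?thesis using between[OF x] dU(2)[of x] dL(2)[of x] unfolding f_def g_def by linarith
    qed
    have "g x \<le> y \<and> y \<le> f x" if xy: "(x, y) \<in> tconv S" for x y
    proof -
      obtain s t u where *: "s \<in> S" "x \<le> fst s" "y \<le> snd s"
        "t \<in> S" "fst t \<le> x" "y - x \<le> snd t - fst t"
        "u \<in> S" "snd u \<le> y" "x - y \<le> fst u - snd u"
        using xy by (rule tconv_bounds)
      have "y \<le> min (f0 x) (f1 x)" using f0_ge[of s x] f1_ge[of t x] * by simp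
      moreover have "g0 x \<le> y" using g0_le[of u x] * by simp
      ultimately show ?thesis using dU(2)[of x] dL(2)[of x] unfolding f_def g_def by linarith
    qed
    then show "g x \<le> y" "y \<le> f x" if "(x, y) \<in> tconv S" for x y using that by blast+
    show "g (fst p) = snd p" if "p \<in> L" for p
      using g0_eq[of p] L dL(3)[of "fst p"] that by (auto simp: g_def)
    show "f (fst p) = snd p" if "p \<in> U" for p
    proof -
      have "dU (fst p) = 0" using dU(3) that by auto
      moreover have "p \<in> S" using that US by auto
      ultimately show ?thesis using f_at[of p] f0_eq[of p] f1_eq[of p] U that by (auto simp: f_def)
    qed
  qed
qed

lemma ccw_along_boundary_tconv:
  assumes S: "finite S" "S \<noteq> {}" and L: "set L \<subseteq> maxima 2 S" "sorted_wrt (\<lambda>p q. fst p < fst q) L"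
    and U: "set U \<subseteq> maxima 0 S \<union> maxima (Suc 0) S" "sorted_wrt (\<lambda>p q. fst p > fst q) U"
    and disj: "set L \<inter> set U = {}"
  shows "ccw_along_boundary (tconv S) (L @ U)"
proof -
  obtain f :: "real \<Rightarrow> real" where "\<exists>g :: real \<Rightarrow> real. continuous_on UNIV f \<and> continuous_on UNIV g \<and>
    (\<forall>x. Min (fst ` S) \<le> x \<longrightarrow> x \<le> Max (fst ` S) \<longrightarrow> g x < f x) \<and>
    (\<forall>x y. (x, y) \<in> tconv S \<longrightarrow> g x \<le> y \<and> y \<le> f x) \<and>
    (\<forall>p\<in>set L. g (fst p) = snd p) \<and> (\<forall>p\<in>set U. f (fst p) = snd p)"
    using ex_enclosing_graphs[OF S L(1) U(1) disj] ..
  then obtain g :: "real \<Rightarrow> real" where "continuous_on UNIV f \<and> continuous_on UNIV g \<and>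
    (\<forall>x. Min (fst ` S) \<le> x \<longrightarrow> x \<le> Max (fst ` S) \<longrightarrow> g x < f x) \<and>
    (\<forall>x y. (x, y) \<in> tconv S \<longrightarrow> g x \<le> y \<and> y \<le> f x) \<and>
    (\<forall>p\<in>set L. g (fst p) = snd p) \<and> (\<forall>p\<in>set U. f (fst p) = snd p)" ..
  then have fg: "continuous_on UNIV f" "continuous_on UNIV g"
    "\<And>x. Min (fst ` S) \<le> x \<Longrightarrow> x \<le> Max (fst ` S) \<Longrightarrow> g x < f x"
    "\<And>x y. (x, y) \<in> tconv S \<Longrightarrow> g x \<le> y \<and> y \<le> f x"
    "\<And>p. p \<in> set L \<Longrightarrow> g (fst p) = snd p" "\<And>p. p \<in> set U \<Longrightarrow> f (fst p) = snd p"
    by blast+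
  define a b where "a = Min (fst ` S)" and "b = Max (fst ` S)"
  have inS: "a \<le> fst s \<and> fst s \<le> b" if "s \<in> S" for s
    using that S by (auto simp: a_def b_def)
  then have ab: "a \<le> b" using S by fastforce
  have LS: "set L \<subseteq> S" and US: "set U \<subseteq> S" using L(1) U(1) by (auto simp: maxima_def)
  \<comment> \<open>Clamping continues the graphs as constants beyond the abscissae of
    \<open>S\<close>. A margin of one unit keeps the listed points off the vertical sides, also when
    all abscissae agree.\<close>
  define c where "c x = max a (min b x)" for x
  have c: "c x = x" if "a \<le> x" "x \<le> b" for x using that by (simp add: c_def)
  have cont_c: "continuous_on UNIV c" unfolding c_def by (intro continuous_intros)
  show ?thesis
  proof (rule ccw_along_boundary_between_graphs[where a = "a - 1" and b = "b + 1"
        and f = "\<lambda>x. f (c x)" and g = "\<lambda>x. g (c x)"])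
    show "a - 1 < b + 1" using ab by simp
    show "continuous_on UNIV (\<lambda>x. f (c x))" "continuous_on UNIV (\<lambda>x. g (c x))"
      by (intro continuous_on_compose2[OF fg(1) cont_c] continuous_on_compose2[OF fg(2) cont_c]; simp)+
    show "g (c x) < f (c x)" for x
      by (rule fg(3)) (use ab in \<open>auto simp: c_def a_def b_def\<close>)
    show "a - 1 \<le> x \<and> x \<le> b + 1 \<and> g (c x) \<le> y \<and> y \<le> f (c x)" if xy: "(x, y) \<in> tconv S" for x y
    proof -
      obtain s t where "s \<in> S" "x \<le> fst s" "t \<in> S" "fst t \<le> x"
        using xy by (rule tconv_bounds)
      then have "a \<le> x" "x \<le> b" using inS[of s] inS[of t] by auto
      then show ?thesis using fg(4)[OF xy] c by auto
    qed
    show "a - 1 < x \<and> x < b + 1 \<and> y = g (c x)" if "(x, y) \<in> set L" for x y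
      using inS[of "(x, y)"] fg(5)[OF that] LS that c[of x] by auto
    show "a - 1 < x \<and> x < b + 1 \<and> y = f (c x)" if "(x, y) \<in> set U" for x y
      using inS[of "(x, y)"] fg(6)[OF that] US that c[of x] by auto
  qed (use L U in auto)
qed

section \<open>Reading, filtering and writing points\<close>

lemma wp_While_measure:
  fixes \<phi> :: "state \<Rightarrow> nat"
  assumes "\<And>s. I s \<Longrightarrow> bval b s \<Longrightarrow> wp c (\<lambda>t s'. I s' \<and> 1 + t + \<phi> s' \<le> \<phi> s) s"
    and "I s"
  shows "wp (While b c) (\<lambda>t s'. t \<le> \<phi> s + 1 \<and> \<not> bval b s' \<and> I s') s"
  by (rule wp_mono[OF wp_While[where I = "\<lambda>k s. I s \<and> k = \<phi> s" and k = "\<phi> s"]])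
     (use assms in \<open>auto intro: wp_mono\<close>)

abbreviation nvar :: "name \<Rightarrow> nexp" where "nvar a \<equiv> NCell a (NConst 0)"
abbreviation rvar :: "name \<Rightarrow> rexp" where "rvar a \<equiv> RCell a (NConst 0)"
abbreviation nset :: "name \<Rightarrow> nexp \<Rightarrow> cmd" where "nset a \<equiv> NStore a (NConst 0)"
abbreviation rset :: "name \<Rightarrow> rexp \<Rightarrow> cmd" where "rset a \<equiv> RStore a (NConst 0)"
abbreviation incr :: "name \<Rightarrow> cmd" where "incr a \<equiv> nset a (NAdd (nvar a) (NConst 1))"
abbreviation BOr :: "bexp \<Rightarrow> bexp \<Rightarrow> bexp" where "BOr b c \<equiv> BNot (BAnd (BNot b) (BNot c))"

abbreviation req :: "rexp \<Rightarrow> rexp \<Rightarrow> bexp" where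
  "req e f \<equiv> BAnd (BNot (RLess e f)) (BNot (RLess f e))"

fun block :: "cmd list \<Rightarrow> cmd" where
  "block [] = Skip"
| "block [c] = c"
| "block (c # cs) = Seq c (block cs)"

definition arr :: "(nat \<Rightarrow> real) \<Rightarrow> (nat \<Rightarrow> real) \<Rightarrow> nat \<Rightarrow> tp2 list" where
  "arr a b n = map (\<lambda>i. (a i, b i)) [0..<n]"

lemma length_arr [simp]: "length (arr a b n) = n"
  and nth_arr [simp]: "i < n \<Longrightarrow> arr a b n ! i = (a i, b i)"
  and set_arr: "set (arr a b n) = (\<lambda>i. (a i, b i)) ` {..<n}"
  and arr_0 [simp]: "arr a b 0 = []"
  by (auto simp: arr_def)

lemma arr_Suc: "arr a b (Suc n) = arr a b n @ [(a n, b n)]"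
  by (simp add: arr_def)

lemma arr_upd [simp]: "n \<le> i \<Longrightarrow> arr (a(i := x)) b n = arr a b n" "n \<le> i \<Longrightarrow> arr a (b(i := x)) n = arr a b n"
  by (auto simp: arr_def)

fun keyx keyy unkeyx unkeyy :: "nat \<Rightarrow> rexp \<Rightarrow> rexp \<Rightarrow> rexp" where
  "keyx 0 e f = e"
| "keyx (Suc 0) e f = RSub f e"
| "keyx _ e f = RSub (RConst 0) f"
| "keyy 0 e f = f"
| "keyy (Suc 0) e f = RSub (RConst 0) e"
| "keyy _ e f = RSub e f"
| "unkeyx 0 e f = e"
| "unkeyx (Suc 0) e f = RSub (RConst 0) f"
| "unkeyx _ e f = RSub f e"
| "unkeyy 0 e f = f"
| "unkeyy (Suc 0) e f = RSub e f"
| "unkeyy _ e f = RSub (RConst 0) e"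

definition unkey :: "nat \<Rightarrow> tp2 \<Rightarrow> tp2" where
  "unkey k = inv (key k)"

lemma unkey_key [simp]: "unkey k (key k p) = p"
  unfolding unkey_def by (rule inv_f_f[OF inj_key])

lemma less_3_cases: "k < 3 \<Longrightarrow> k = 0 \<or> k = Suc 0 \<or> k = Suc (Suc 0)"
  by auto

lemma key_unkey_eq:
  "key 0 p = p" "key (Suc 0) (- snd p, fst p - snd p) = p"
  "key (Suc (Suc 0)) (snd p - fst p, - fst p) = p"
  using key_2 by (auto simp: key_1 numeral_2_eq_2)

lemma unkey_simps:
  "unkey 0 p = p" "unkey (Suc 0) p = (- snd p, fst p - snd p)"
  "unkey (Suc (Suc 0)) p = (snd p - fst p, - fst p)"
  using unkey_key[of 0 p] unkey_key[of "Suc 0" "(- snd p, fst p - snd p)"]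
    unkey_key[of "Suc (Suc 0)" "(snd p - fst p, - fst p)"]
  unfolding key_unkey_eq by simp_all

lemma key_unkey [simp]: "k < 3 \<Longrightarrow> key k (unkey k p) = p"
  using less_3_cases[of k] key_unkey_eq[of p] by (auto simp: unkey_simps)

lemma rval_key [simp]:
  assumes "k < 3"
  shows "rval (keyx k e f) s = fst (key k (rval e s, rval f s))"
    "rval (keyy k e f) s = snd (key k (rval e s, rval f s))"
    "rval (unkeyx k e f) s = fst (unkey k (rval e s, rval f s))"
    "rval (unkeyy k e f) s = snd (unkey k (rval e s, rval f s))"
  using less_3_cases[OF assms] by (auto simp: key_1 key_2[unfolded numeral_2_eq_2] unkey_simps)

definition has_input :: "tp2 list \<Rightarrow> state \<Rightarrow> bool" where
  "has_input ps s \<longleftrightarrow> nmem s ''n'' 0 = length ps \<and> arr (rmem s ''x'') (rmem s ''y'') (length ps) = ps"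

lemma has_input_nth:
  "has_input ps s \<Longrightarrow> i < length ps \<Longrightarrow> (rmem s ''x'' i, rmem s ''y'' i) = ps ! i"
  unfolding has_input_def by (metis nth_arr)

text \<open>Cells of the programs: \<open>P\<close>, \<open>Q\<close> are the keys of the pivot and \<open>T\<close>, \<open>R\<close> those of the current point;
  \<open>A\<close>, \<open>B\<close> the keys of the \<open>N\<close> surviving points, \<open>C\<close>, \<open>D\<close> a buffer for merging, \<open>E\<close>, \<open>F\<close> the keys of
  the \<open>c\<close> maxima found so far; \<open>w\<close> is the group size, \<open>p\<close> holds at each group start a pointer into
  that group, \<open>q\<close> is the start of the current group, \<open>b\<close> the best candidate (if \<open>f\<close> is set), and
  \<open>d\<close> signals success.\<close>

definition read_key :: "nat \<Rightarrow> cmd" where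
  "read_key \<kappa> = Seq (rset ''T'' (keyx \<kappa> (RCell ''x'' (nvar ''k'')) (RCell ''y'' (nvar ''k''))))
     (rset ''R'' (keyy \<kappa> (RCell ''x'' (nvar ''k'')) (RCell ''y'' (nvar ''k''))))"

definition pivot_loop :: "nat \<Rightarrow> cmd" where
  "pivot_loop \<kappa> = While (NLess (nvar ''k'') (nvar ''n'')) (block [
     read_key \<kappa>,
     Cond (RLess (RAdd (rvar ''P'') (rvar ''Q'')) (RAdd (rvar ''T'') (rvar ''R'')))
       (Seq (rset ''P'' (rvar ''T'')) (rset ''Q'' (rvar ''R'')))
       Skip,
     incr ''k''])"

definition pivot :: "nat \<Rightarrow> cmd" where
  "pivot \<kappa> = block [
     nset ''k'' (NConst 0),
     read_key \<kappa>,
     rset ''P'' (rvar ''T''),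
     rset ''Q'' (rvar ''R''),
     pivot_loop \<kappa>]"

text \<open>The sum of the keys is maximized by one linear scan, and any single point near the best
  corner of the unit square forces the pivot close to that corner.\<close>

definition is_pivot :: "nat \<Rightarrow> tp2 list \<Rightarrow> tp2 \<Rightarrow> bool" where
  "is_pivot \<kappa> ps z \<longleftrightarrow> z \<in> set ps \<and>
     (\<forall>p\<in>set ps. fst (key \<kappa> p) + snd (key \<kappa> p) \<le> fst (key \<kappa> z) + snd (key \<kappa> z))"

lemma wp_pivot:
  assumes \<kappa>: "\<kappa> < 3" and inp: "has_input ps s" and ne: "ps \<noteq> []"
  shows "wp (pivot \<kappa>) (\<lambda>t s'. t \<le> 10 * length ps + 10 \<and>
    (\<exists>z. is_pivot \<kappa> ps z \<and> (rmem s' ''P'' 0, rmem s' ''Q'' 0) = key \<kappa> z)) s"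
proof -
  define w :: "tp2 \<Rightarrow> real" where "w p = fst (key \<kappa> p) + snd (key \<kappa> p)" for p
  define I where "I s \<longleftrightarrow> has_input ps s \<and> nmem s ''k'' 0 \<le> length ps \<and>
    (\<exists>z\<in>set ps. (rmem s ''P'' 0, rmem s ''Q'' 0) = key \<kappa> z \<and>
       (\<forall>i<nmem s ''k'' 0. w (ps ! i) \<le> w z))" for s
  \<comment> \<open>One iteration with its test takes fewer than 10 steps; the weights of the later
    loops are rounded up in the same way.\<close>
  define \<phi> where "\<phi> s = 10 * (length ps - nmem s ''k'' 0)" for s :: state
  have loop: "wp (pivot_loop \<kappa>) (\<lambda>t s'. t \<le> \<phi> s + 1 \<and>
      \<not> bval (NLess (nvar ''k'') (nvar ''n'')) s' \<and> I s') s" if "I s" for s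
    unfolding pivot_loop_def
  proof (rule wp_While_measure[where I = I and \<phi> = \<phi>, OF _ that])
    fix s assume I: "I s" and b: "bval (NLess (nvar ''k'') (nvar ''n'')) s"
    define k where "k = nmem s ''k'' 0"
    have k: "k < length ps" using b I by (auto simp: I_def has_input_def k_def)
    obtain z where z: "z \<in> set ps" "(rmem s ''P'' 0, rmem s ''Q'' 0) = key \<kappa> z"
      "\<And>i. i < k \<Longrightarrow> w (ps ! i) \<le> w z" using I by (auto simp: I_def k_def)
    have d: "length ps - k = Suc (length ps - Suc k)" using k by simp
    have xy: "(rmem s ''x'' k, rmem s ''y'' k) = ps ! k"
      using I k by (auto simp: I_def intro: has_input_nth)
    have PQ: "rmem s ''P'' 0 + rmem s ''Q'' 0 = w z"
      by (simp add: w_def z(2)[symmetric])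
    have z': "\<exists>z'\<in>set ps. key \<kappa> (if w z < w (ps ! k) then ps ! k else z) = key \<kappa> z' \<and>
       (\<forall>i<Suc k. w (ps ! i) \<le> w z')"
      using z(1,3) k by (intro bexI[of _ "if w z < w (ps ! k) then ps ! k else z"])
        (fastforce simp: less_Suc_eq)+
    show "wp (block [read_key \<kappa>, Cond (RLess (RAdd (rvar ''P'') (rvar ''Q'')) (RAdd (rvar ''T'') (rvar ''R'')))
       (Seq (rset ''P'' (rvar ''T'')) (rset ''Q'' (rvar ''R''))) Skip, incr ''k''])
       (\<lambda>t s'. I s' \<and> 1 + t + \<phi> s' \<le> \<phi> s) s"
      using \<kappa> I k z' by (simp add: read_key_def k_def[symmetric] xy PQ w_def[symmetric] I_def has_input_def \<phi>_def z(2) d split: if_splits)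
  qed
  define s0 where "s0 = rstore ''Q'' 0 (snd (key \<kappa> (ps ! 0))) (rstore ''P'' 0 (fst (key \<kappa> (ps ! 0)))
     (rstore ''R'' 0 (snd (key \<kappa> (ps ! 0))) (rstore ''T'' 0 (fst (key \<kappa> (ps ! 0))) (nstore ''k'' 0 0 s))))"
  have "(rmem s ''x'' 0, rmem s ''y'' 0) = ps ! 0" using ne by (intro has_input_nth[OF inp]) auto
  then have pre: "wp (pivot \<kappa>) Q s \<longleftrightarrow> wp (pivot_loop \<kappa>) (\<lambda>t. Q (5 + t)) s0" for Q
    using \<kappa> by (simp add: pivot_def read_key_def s0_def numeral_eq_Suc)
  show ?thesis unfolding pre
  proof (rule wp_mono[OF loop])
    show "I s0" using inp ne by (auto simp: I_def s0_def has_input_def)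
    fix t s'
    assume *: "t \<le> \<phi> s0 + 1 \<and> \<not> bval (NLess (nvar ''k'') (nvar ''n'')) s' \<and> I s'"
    then obtain z where z: "z \<in> set ps" "(rmem s' ''P'' 0, rmem s' ''Q'' 0) = key \<kappa> z"
      "\<forall>i<length ps. w (ps ! i) \<le> w z" by (auto simp: I_def has_input_def)
    then have "is_pivot \<kappa> ps z" unfolding is_pivot_def by (metis in_set_conv_nth w_def)
    moreover have "\<phi> s0 \<le> 10 * length ps" by (simp add: \<phi>_def)
    ultimately show "5 + t \<le> 10 * length ps + 10 \<and>
        (\<exists>z. is_pivot \<kappa> ps z \<and> (rmem s' ''P'' 0, rmem s' ''Q'' 0) = key \<kappa> z)"
      using * z(2) by (auto simp del: split_paired_Ex)
  qed
qed

definition filter_loop :: "nat \<Rightarrow> cmd" where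
  "filter_loop \<kappa> = While (NLess (nvar ''k'') (nvar ''n'')) (block [
     read_key \<kappa>,
     Cond (BOr (RLess (rvar ''P'') (rvar ''T'')) (RLess (rvar ''Q'') (rvar ''R'')))
       (block [RStore ''A'' (nvar ''N'') (rvar ''T''), RStore ''B'' (nvar ''N'') (rvar ''R''), incr ''N''])
       Skip,
     incr ''k''])"

definition survivors_prog :: "nat \<Rightarrow> cmd" where
  "survivors_prog \<kappa> = block [
     RStore ''A'' (NConst 0) (rvar ''P''),
     RStore ''B'' (NConst 0) (rvar ''Q''),
     nset ''N'' (NConst 1),
     nset ''k'' (NConst 0),
     filter_loop \<kappa>]"

definition survives :: "nat \<Rightarrow> tp2 \<Rightarrow> tp2 \<Rightarrow> bool" where
  "survives \<kappa> z p \<longleftrightarrow> fst (key \<kappa> z) < fst (key \<kappa> p) \<or> snd (key \<kappa> z) < snd (key \<kappa> p)"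

text \<open>The strict test rejects the pivot itself, so it is put in front; this also keeps the
  list nonempty.\<close>

definition survivors :: "nat \<Rightarrow> tp2 \<Rightarrow> tp2 list \<Rightarrow> tp2 list" where
  "survivors \<kappa> z ps = z # filter (survives \<kappa> z) ps"

lemma wp_survivors:
  assumes \<kappa>: "\<kappa> < 3" and inp: "has_input ps s" and z: "(rmem s ''P'' 0, rmem s ''Q'' 0) = key \<kappa> z"
  shows "wp (survivors_prog \<kappa>) (\<lambda>t s'. t \<le> 10 * length ps + 10 \<and>
    arr (rmem s' ''A'') (rmem s' ''B'') (nmem s' ''N'' 0) = map (key \<kappa>) (survivors \<kappa> z ps)) s"
proof -
  define I where "I s \<longleftrightarrow> has_input ps s \<and> nmem s ''k'' 0 \<le> length ps \<and>
    rmem s ''P'' 0 = fst (key \<kappa> z) \<and> rmem s ''Q'' 0 = snd (key \<kappa> z) \<and>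
    arr (rmem s ''A'') (rmem s ''B'') (nmem s ''N'' 0)
      = map (key \<kappa>) (survivors \<kappa> z (take (nmem s ''k'' 0) ps))" for s
  define \<phi> where "\<phi> s = 10 * (length ps - nmem s ''k'' 0)" for s :: state
  have loop: "wp (filter_loop \<kappa>) (\<lambda>t s'. t \<le> \<phi> s + 1 \<and>
      \<not> bval (NLess (nvar ''k'') (nvar ''n'')) s' \<and> I s') s" if "I s" for s
    unfolding filter_loop_def
  proof (rule wp_While_measure[where I = I and \<phi> = \<phi>, OF _ that])
    fix s assume I: "I s" and b: "bval (NLess (nvar ''k'') (nvar ''n'')) s"
    define k where "k = nmem s ''k'' 0"
    have k: "k < length ps" using b I by (auto simp: I_def has_input_def k_def)
    have d: "length ps - k = Suc (length ps - Suc k)" using k by simp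
    have xy: "(rmem s ''x'' k, rmem s ''y'' k) = ps ! k"
      using I k by (auto simp: I_def intro: has_input_nth)
    show "wp (block [read_key \<kappa>, Cond (BOr (RLess (rvar ''P'') (rvar ''T'')) (RLess (rvar ''Q'') (rvar ''R'')))
       (block [RStore ''A'' (nvar ''N'') (rvar ''T''), RStore ''B'' (nvar ''N'') (rvar ''R''), incr ''N''])
       Skip, incr ''k'']) (\<lambda>t s'. I s' \<and> 1 + t + \<phi> s' \<le> \<phi> s) s"
      using \<kappa> I k by (simp add: read_key_def k_def[symmetric] xy I_def has_input_def \<phi>_def
          take_Suc_conv_app_nth survivors_def survives_def arr_Suc d)
  qed
  define s0 where "s0 = nstore ''k'' 0 0 (nstore ''N'' 0 1
     (rstore ''B'' 0 (rmem s ''Q'' 0) (rstore ''A'' 0 (rmem s ''P'' 0) s)))"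
  have pre: "wp (survivors_prog \<kappa>) Q s \<longleftrightarrow> wp (filter_loop \<kappa>) (\<lambda>t. Q (4 + t)) s0" for Q
    by (simp add: survivors_prog_def s0_def numeral_eq_Suc)
  show ?thesis unfolding pre
  proof (rule wp_mono[OF loop])
    show "I s0" using inp z
      by (auto simp: I_def s0_def has_input_def survivors_def arr_Suc prod_eq_iff)
    fix t s'
    assume "t \<le> \<phi> s0 + 1 \<and> \<not> bval (NLess (nvar ''k'') (nvar ''n'')) s' \<and> I s'"
    moreover have "\<phi> s0 \<le> 10 * length ps" by (simp add: \<phi>_def)
    ultimately show "4 + t \<le> 10 * length ps + 10 \<and>
        arr (rmem s' ''A'') (rmem s' ''B'') (nmem s' ''N'' 0) = map (key \<kappa>) (survivors \<kappa> z ps)"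
      by (auto simp: I_def has_input_def)
  qed
qed

definition emit_loop :: "nat \<Rightarrow> cmd" where
  "emit_loop \<kappa> = While (NLess (nvar ''k'') (nvar ''c'')) (block [
     rset ''T'' (unkeyx \<kappa> (RCell ''E'' (nvar ''k'')) (RCell ''F'' (nvar ''k''))),
     rset ''R'' (unkeyy \<kappa> (RCell ''E'' (nvar ''k'')) (RCell ''F'' (nvar ''k''))),
     Cond (BAnd (NLess (NConst 0) (nvar ''z''))
         (BOr (BAnd (req (rvar ''T'') (rvar ''u'')) (req (rvar ''R'') (rvar ''v'')))
              (BAnd (req (rvar ''T'') (RCell ''u'' (NSub (nvar ''z'') (NConst 1))))
                    (req (rvar ''R'') (RCell ''v'' (NSub (nvar ''z'') (NConst 1)))))))
       Skip
       (block [RStore ''u'' (nvar ''h'') (rvar ''T''), RStore ''v'' (nvar ''h'') (rvar ''R''), incr ''h'']),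
     incr ''k''])"

text \<open>\<open>z\<close> freezes the length of the output at the start of the pass, so
  duplicates are sought only among earlier points while \<open>h\<close> grows.\<close>

definition emit :: "nat \<Rightarrow> cmd" where
  "emit \<kappa> = block [nset ''z'' (nvar ''h''), nset ''k'' (NConst 0), emit_loop \<kappa>]"

text \<open>Two staircases share at most one point, and this is an end of the part of the output written
  before, so duplicates are detected by comparing with the first and the last point.\<close>

definition fresh_in :: "tp2 list \<Rightarrow> tp2 \<Rightarrow> bool" where
  "fresh_in out p \<longleftrightarrow> out = [] \<or> p \<noteq> hd out \<and> p \<noteq> last out"

lemma wp_emit:
  assumes \<kappa>: "\<kappa> < 3" and E: "arr (rmem s ''E'') (rmem s ''F'') (nmem s ''c'' 0) = map (key \<kappa>) l"
    and out: "arr (rmem s ''u'') (rmem s ''v'') (nmem s ''h'' 0) = out"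
  shows "wp (emit \<kappa>) (\<lambda>t s'. t \<le> 10 * length l + 10 \<and>
    arr (rmem s' ''u'') (rmem s' ''v'') (nmem s' ''h'' 0) = out @ filter (fresh_in out) l) s"
proof -
  define I where "I s \<longleftrightarrow> nmem s ''k'' 0 \<le> length l \<and> nmem s ''c'' 0 = length l \<and>
    arr (rmem s ''E'') (rmem s ''F'') (nmem s ''c'' 0) = map (key \<kappa>) l \<and>
    nmem s ''z'' 0 = length out \<and> length out \<le> nmem s ''h'' 0 \<and>
    arr (rmem s ''u'') (rmem s ''v'') (length out) = out \<and>
    arr (rmem s ''u'') (rmem s ''v'') (nmem s ''h'' 0)
      = out @ filter (fresh_in out) (take (nmem s ''k'' 0) l)" for s :: state
  define \<phi> where "\<phi> s = 10 * (length l - nmem s ''k'' 0)" for s :: state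
  have len: "nmem s ''c'' 0 = length l" using E by (metis length_arr length_map)
  have loop: "wp (emit_loop \<kappa>) (\<lambda>t s'. t \<le> \<phi> s + 1 \<and>
      \<not> bval (NLess (nvar ''k'') (nvar ''c'')) s' \<and> I s') s" if "I s" for s
    unfolding emit_loop_def
  proof (rule wp_While_measure[where I = I and \<phi> = \<phi>, OF _ that], goal_cases)
    case (1 s)
    define k where "k = nmem s ''k'' 0"
    have k: "k < length l" using 1 by (auto simp: I_def k_def)
    have d: "length l - k = Suc (length l - Suc k)" using k by simp
    have EF: "(rmem s ''E'' k, rmem s ''F'' k) = key \<kappa> (l ! k)"
    proof -
      have "arr (rmem s ''E'') (rmem s ''F'') (length l) = map (key \<kappa>) l"
        using 1(1) unfolding I_def by metis
      then have "arr (rmem s ''E'') (rmem s ''F'') (length l) ! k = map (key \<kappa>) l ! k" by simp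
      then show ?thesis using k by simp
    qed
    have ends: "(rmem s ''u'' 0, rmem s ''v'' 0) = hd out"
      "(rmem s ''u'' (length out - Suc 0), rmem s ''v'' (length out - Suc 0)) = last out" if "out \<noteq> []"
    proof -
      have "arr (rmem s ''u'') (rmem s ''v'') (length out) = out" using 1 by (simp add: I_def)
      with that show "(rmem s ''u'' 0, rmem s ''v'' 0) = hd out"
        "(rmem s ''u'' (length out - Suc 0), rmem s ''v'' (length out - Suc 0)) = last out"
        by (metis hd_conv_nth last_conv_nth length_arr length_greater_0_conv nth_arr
            diff_Suc_less One_nat_def)+
    qed
    have fresh: "fresh_in out (l ! k) \<longleftrightarrow> \<not> (0 < length out \<and>
       (fst (l ! k) = rmem s ''u'' 0 \<and> snd (l ! k) = rmem s ''v'' 0 \<or>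
        fst (l ! k) = rmem s ''u'' (length out - Suc 0) \<and> snd (l ! k) = rmem s ''v'' (length out - Suc 0)))"
      using ends by (cases "out = []") (auto simp: fresh_in_def prod_eq_iff)
    show ?case
      using 1(1) \<kappa> k
      by (auto simp: k_def[symmetric] EF I_def \<phi>_def take_Suc_conv_app_nth arr_Suc fresh d)
  qed
  define s0 where "s0 = nstore ''k'' 0 0 (nstore ''z'' 0 (nmem s ''h'' 0) s)"
  have pre: "wp (emit \<kappa>) Q s \<longleftrightarrow> wp (emit_loop \<kappa>) (\<lambda>t. Q (2 + t)) s0" for Q
    by (simp add: emit_def s0_def numeral_eq_Suc)
  show ?thesis unfolding pre
  proof (rule wp_mono[OF loop])
    show "I s0" using E out len by (auto simp: I_def s0_def)
    fix t s'
    assume "t \<le> \<phi> s0 + 1 \<and> \<not> bval (NLess (nvar ''k'') (nvar ''c'')) s' \<and> I s'"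
    moreover have "\<phi> s0 \<le> 10 * length l" by (simp add: \<phi>_def)
    ultimately show "2 + t \<le> 10 * length l + 10 \<and>
        arr (rmem s' ''u'') (rmem s' ''v'') (nmem s' ''h'' 0) = out @ filter (fresh_in out) l"
      by (auto simp: I_def)
  qed
qed

section \<open>Staircases of maxima\<close>

definition lexle :: "tp2 \<Rightarrow> tp2 \<Rightarrow> bool" where
  "lexle p q \<longleftrightarrow> fst p < fst q \<or> fst p = fst q \<and> snd p \<le> snd q"

lemma lexle_refl [simp]: "lexle p p"
  by (simp add: lexle_def)

lemma lexle_trans: "lexle p q \<Longrightarrow> lexle q r \<Longrightarrow> lexle p r"
  by (auto simp: lexle_def)

lemma lexle_linear: "\<not> lexle p q \<Longrightarrow> lexle q p"
  by (auto simp: lexle_def)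

definition mx :: "tp2 set \<Rightarrow> tp2 set" where
  "mx T = {p \<in> T. \<forall>s\<in>T. dom_le p s \<longrightarrow> s = p}"

definition above_last :: "tp2 list \<Rightarrow> tp2 \<Rightarrow> bool" where
  "above_last out p \<longleftrightarrow> out = [] \<or> snd (last out) < snd p"

text \<open>A correct prefix of the staircase, climbed from right to left: the maxima still missing
  are all higher than the last one listed.\<close>

definition stair :: "tp2 set \<Rightarrow> tp2 list \<Rightarrow> bool" where
  "stair T out \<longleftrightarrow> set out \<subseteq> mx T \<and> sorted_wrt (\<lambda>p q. fst q < fst p \<and> snd p < snd q) out \<and>
     (\<forall>m\<in>mx T. m \<in> set out \<or> above_last out m)"

lemma stair_Nil: "stair T []"
  by (simp add: stair_def above_last_def)

text \<open>A point dominating \<open>b\<close> would also be above the last output, hence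
  lexicographically at most \<open>b\<close>. A maximum skipped at or below the height of
  \<open>b\<close> would be dominated by \<open>b\<close>.\<close>

lemma stair_snoc:
  assumes st: "stair T out" and b: "b \<in> T" "above_last out b"
    and max: "\<And>s. s \<in> T \<Longrightarrow> above_last out s \<Longrightarrow> lexle s b"
  shows "stair T (out @ [b])"
proof -
  have b_max: "b \<in> mx T"
    unfolding mx_def
  proof (safe intro!: b)
    fix x y assume s: "(x, y) \<in> T" "dom_le b (x, y)"
    then have "above_last out (x, y)" using b(2) by (auto simp: above_last_def dom_le_def)
    then have "lexle (x, y) b" using max s by blast
    with s(2) show "(x, y) = b" by (auto simp: lexle_def dom_le_def prod_eq_iff)
  qed
  have less: "fst b < fst p \<and> snd p < snd b" if p: "p \<in> set out" for p
  proof -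
    have ne: "out \<noteq> []" using p by auto
    let ?l = "last out"
    have l: "?l \<in> mx T" "snd ?l < snd b"
      using st ne b(2) by (auto simp: stair_def above_last_def)
    \<comment> \<open>Otherwise \<open>b\<close>, being higher, would dominate the last
      output.\<close>
    have lb: "fst b < fst ?l"
    proof (rule ccontr)
      assume "\<not> fst b < fst ?l"
      then have "dom_le ?l b" using l(2) by (simp add: dom_le_def)
      then have "b = ?l" using l(1) b(1) by (auto simp: mx_def)
      with l(2) show False by simp
    qed
    have "sorted_wrt (\<lambda>p q. fst q < fst p \<and> snd p < snd q) (butlast out @ [?l])"
      using st ne by (simp add: stair_def)
    moreover have "p \<in> set (butlast out) \<or> p = ?l"
      using p ne by (metis append_butlast_last_id in_set_conv_decomp_last rotate1.simps(2) set_ConsD set_rotate1)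
    ultimately show ?thesis using lb l(2) by (fastforce simp: sorted_wrt_append)
  qed
  have cover: "m = b \<or> snd b < snd m" if m: "m \<in> mx T" "m \<notin> set out" for m
  proof (rule ccontr)
    assume *: "\<not> ?thesis"
    have "m \<in> T" using m by (auto simp: mx_def)
    moreover have "above_last out m" using m st by (auto simp: stair_def)
    ultimately have "lexle m b" by (rule max)
    with * have "dom_le m b" by (auto simp: dom_le_def lexle_def)
    with m b(1) have "b = m" by (auto simp: mx_def)
    with * show False by simp
  qed
  show ?thesis
    using st b_max less cover unfolding stair_def by (auto simp: sorted_wrt_append above_last_def)
qed

lemma stair_finished: "stair T out \<Longrightarrow> (\<And>s. s \<in> T \<Longrightarrow> \<not> above_last out s) \<Longrightarrow> set out = mx T"
  by (auto simp: stair_def mx_def)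

text \<open>An output of more than \<open>w\<close> points thus proves that there are more than
  \<open>w\<close> maxima, which justifies doubling \<open>w\<close>.\<close>

lemma stair_length:
  assumes "stair T out" "finite T"
  shows "length out \<le> card (mx T)"
proof -
  have "sorted_wrt (\<lambda>p q :: tp2. fst q < fst p \<and> snd p < snd q) out"
    using assms(1) by (simp add: stair_def)
  then have "distinct out" by (induction out) auto
  then show ?thesis
    using assms card_mono[of "mx T" "set out"] by (auto simp: stair_def distinct_card mx_def)
qed

text \<open>Descending order within each block of \<open>w\<close> indices, of which the last may be
  shorter, so that the best candidate of a group comes first.\<close>

definition gsorted :: "nat \<Rightarrow> (nat \<Rightarrow> tp2) \<Rightarrow> nat \<Rightarrow> bool" where
  "gsorted w a n \<longleftrightarrow> (\<forall>r s. r < s \<longrightarrow> s < n \<longrightarrow> r div w = s div w \<longrightarrow> lexle (a s) (a r))"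

lemma gsortedD:
  assumes "gsorted w a n" "r \<le> s" "s < n" "w * g \<le> r" "s < w * g + w"
  shows "lexle (a s) (a r)"
proof (cases "r = s")
  case False
  have "r div w = g" "s div w = g"
    using assms by (auto intro!: div_nat_eqI simp: mult.commute)
  then show ?thesis using assms False unfolding gsorted_def by simp
qed simp

text \<open>The pointer \<open>p (w * g)\<close> has passed only points of group \<open>g\<close> that are not above the last output; \<open>b\<close> is
  the lexicographically largest point above it in the groups before \<open>q\<close>, if there is any (\<open>f \<noteq> 0\<close>).\<close>

definition scan_inv :: "nat \<Rightarrow> nat \<Rightarrow> (nat \<Rightarrow> tp2) \<Rightarrow> (nat \<Rightarrow> nat) \<Rightarrow> nat \<Rightarrow> nat \<Rightarrow> nat \<Rightarrow> tp2 list \<Rightarrow> bool" where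
  "scan_inv w n a p q f b out \<longleftrightarrow> w dvd q \<and>
     (\<forall>g. w * g < n \<longrightarrow> w * g \<le> p (w * g)) \<and>
     (\<forall>g r. w * g \<le> r \<longrightarrow> r < p (w * g) \<longrightarrow> r < n \<longrightarrow> \<not> above_last out (a r)) \<and>
     (f = 0 \<longrightarrow> (\<forall>r<q. r < n \<longrightarrow> \<not> above_last out (a r))) \<and>
     (f \<noteq> 0 \<longrightarrow> b < n \<and> above_last out (a b) \<and>
        (\<forall>r<q. r < n \<longrightarrow> above_last out (a r) \<longrightarrow> lexle (a r) (a b)))"

lemma scan_inv_start: "(\<And>r. r < n \<Longrightarrow> p r = r) \<Longrightarrow> scan_inv w n a p 0 0 b []"
  unfolding scan_inv_def by auto

lemma scan_inv_move:
  assumes "scan_inv w n a p q f b out" "\<not> above_last out (a (p q))"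
  shows "scan_inv w n a (p(q := Suc (p q))) q f b out"
  using assms unfolding scan_inv_def by (auto simp: less_Suc_eq)

text \<open>The place where the pointer stops holds the best candidate of its group: everything
  before it is too low, everything after it lexicographically no larger. The \<open>if\<close>
  copies the test of the program.\<close>

lemma scan_inv_next:
  assumes inv: "scan_inv w n a p q f b out" and w: "w > 0" and q: "q < n"
    and srt: "gsorted w a n"
    and stop: "p q < n \<and> p q < q + w \<Longrightarrow> above_last out (a (p q))"
  shows "if p q < n \<and> p q < q + w \<and> (f = 0 \<or> \<not> lexle (a (p q)) (a b))
    then scan_inv w n a p (q + w) (Suc 0) (p q) out else scan_inv w n a p (q + w) f b out"
proof -
  have "w dvd q" using inv by (simp add: scan_inv_def)
  then obtain g where g: "q = w * g" by (rule dvdE)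
  have pq: "q \<le> p q" using inv q by (auto simp: scan_inv_def g)
  have group: "p q < n \<and> p q < q + w \<and> lexle (a r) (a (p q))"
    if "q \<le> r" "r < q + w" "r < n" "above_last out (a r)" for r
  proof -
    have "p q \<le> r"
      using inv that g unfolding scan_inv_def by (metis not_le)
    then show ?thesis using gsortedD[OF srt, of "p q" r g] that pq by (auto simp: g)
  qed
  show ?thesis
  proof (cases "p q < n \<and> p q < q + w \<and> (f = 0 \<or> \<not> lexle (a (p q)) (a b))")
    case True
    have "lexle (a r) (a (p q))" if r: "r < q + w" "r < n" "above_last out (a r)" for r
    proof (cases "r < q")
      case True': True
      then have "f \<noteq> 0" "lexle (a r) (a b)" using inv r by (auto simp: scan_inv_def)
      with True show ?thesis using lexle_linear lexle_trans by blast
    qed (use group r in auto)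
    with True inv stop show ?thesis by (auto simp: scan_inv_def)
  next
    case False
    have "f \<noteq> 0 \<and> lexle (a r) (a b)" if r: "r < q + w" "r < n" "above_last out (a r)" for r
    proof (cases "r < q")
      case True
      then show ?thesis using inv r by (auto simp: scan_inv_def)
    next
      case False': False
      then have *: "p q < n \<and> p q < q + w \<and> lexle (a r) (a (p q))"
        using group[of r] r by (simp add: not_less)
      then have "f \<noteq> 0 \<and> lexle (a (p q)) (a b)" using False by simp
      with * show ?thesis using lexle_trans[of "a r" "a (p q)" "a b"] by simp
    qed
    with False inv show ?thesis by (auto simp: scan_inv_def)
  qed
qed

text \<open>A new output only raises the threshold, so rejected points stay rejected and the
  pointers are never moved back. This is why all outputs of a stage share \<open>n\<close> pointer
  moves.\<close>

lemma scan_inv_output: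
  assumes "scan_inv w n a p q f b out" "f \<noteq> 0"
  shows "scan_inv w n a p 0 0 b' (out @ [a b])"
proof -
  have up: "above_last out r" if "above_last (out @ [a b]) r" for r
    using that assms by (auto simp: scan_inv_def above_last_def)
  show ?thesis
    using assms(1) unfolding scan_inv_def by (simp del: split_paired_All) (blast dest: up)
qed

text \<open>A potential for the pointer moves: the positions not yet passed, where
  \<open>w * (r div w)\<close> is the start of the group of \<open>r\<close>.\<close>

definition moves :: "nat \<Rightarrow> nat \<Rightarrow> (nat \<Rightarrow> nat) \<Rightarrow> nat" where
  "moves w n p = card {r. r < n \<and> p (w * (r div w)) \<le> r}"

lemma moves_le: "moves w n p \<le> n"
proof -
  have "card {r. r < n \<and> p (w * (r div w)) \<le> r} \<le> card {..<n}" by (intro card_mono) auto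
  then show ?thesis by (simp add: moves_def)
qed

lemma moves_Suc:
  assumes "w dvd q" "q \<le> p q" "p q < n" "p q < q + w"
  shows "moves w n (p(q := Suc (p q))) < moves w n p"
  unfolding moves_def
proof (rule psubset_card_mono)
  obtain g where "q = w * g" using assms(1) by auto
  then have "p q div w = g" using assms by (intro div_nat_eqI) (auto simp: mult.commute)
  with \<open>q = w * g\<close> have q: "w * (p q div w) = q" by simp
  let ?P = "\<lambda>p. {r. r < n \<and> p (w * (r div w)) \<le> r}"
  have "?P (p(q := Suc (p q))) \<subseteq> ?P p" by (intro Collect_mono) (simp add: Suc_le_eq)
  moreover have "p q \<in> ?P p" "p q \<notin> ?P (p(q := Suc (p q)))" using assms(3) by (simp_all add: q)
  ultimately show "?P (p(q := Suc (p q))) \<subset> ?P p" by blast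
qed simp

text \<open>\<open>i < m\<close> and \<open>j < e\<close> are the next positions in the two groups being merged, the pair of groups starts
  at \<open>2 * w * g\<close>, and \<open>k\<close> is the next position of the output.\<close>

definition merge_inv ::
  "nat \<Rightarrow> nat \<Rightarrow> (nat \<Rightarrow> tp2) \<Rightarrow> (nat \<Rightarrow> tp2) \<Rightarrow> nat \<Rightarrow> nat \<Rightarrow> nat \<Rightarrow> nat \<Rightarrow> nat \<Rightarrow> bool" where
  "merge_inv w n a c k i j m e \<longleftrightarrow> k \<le> n \<and> gsorted (2 * w) c k \<and>
     c ` {..<k} = a ` ({..<i} \<union> {m..<j}) \<and>
     (e = 0 \<and> k = 0 \<and> i = 0 \<and> j = 0 \<and> m = 0 \<or>
      (\<exists>g. e = 2 * w * g + 2 * w \<and> m = 2 * w * g + w \<and> 2 * w * g \<le> i \<and> i \<le> m \<and> m \<le> j \<and> j \<le> e \<and>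
         i + j = k + m \<and> i \<le> n \<and> (j \<le> n \<or> j = m) \<and>
         (\<forall>r s. 2 * w * g \<le> r \<longrightarrow> r < k \<longrightarrow> i \<le> s \<and> s < m \<or> j \<le> s \<and> s < e \<longrightarrow> s < n \<longrightarrow>
            lexle (a s) (c r))))"

lemma gsorted_0 [simp]: "gsorted w a 0"
  by (simp add: gsorted_def)

lemma gsorted_1 [simp]: "gsorted (Suc 0) a n"
  by (simp add: gsorted_def)

lemma merge_inv_start: "merge_inv w n a c 0 0 0 0 0"
  by (simp add: merge_inv_def)

text \<open>A pair is exhausted exactly when \<open>i = m\<close> and \<open>j = k = e\<close>, so
  the next one starts at \<open>k\<close>. The initial state with \<open>e = 0\<close> opens the
  first pair in the same way.\<close>

lemma merge_inv_next:
  assumes inv: "merge_inv w n a c k i j m e" and "\<not> k < e"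
  shows "merge_inv w n a c k k (k + w) (k + w) (k + w + w)"
proof -
  have "\<exists>g. k = 2 * w * g \<and> a ` ({..<i} \<union> {m..<j}) = a ` {..<k}"
  proof (cases "e = 0 \<and> k = 0 \<and> i = 0 \<and> j = 0 \<and> m = 0")
    case False
    then obtain g where *: "e = 2 * w * g + 2 * w" "m = 2 * w * g + w" "i \<le> m" "m \<le> j" "j \<le> e"
      "i + j = k + m"
      using inv unfolding merge_inv_def by blast
    then have eq: "i = m" "j = k" "k = e" using assms(2) by linarith+
    have "{..<i} \<union> {m..<j} = {..<j}" using *(4) unfolding eq(1) by auto
    then show ?thesis using *(1) eq by (intro exI[of _ "Suc g"]) simp
  qed auto
  then obtain g where g: "k = 2 * w * g" "a ` ({..<i} \<union> {m..<j}) = a ` {..<k}" by blast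
  show ?thesis
    using inv g unfolding merge_inv_def by (intro conjI disjI2 exI[of _ g]) auto
qed

lemma gsorted_snoc:
  assumes "gsorted (2 * w) c k" "2 * w * g \<le> k" "k < 2 * w * g + 2 * w"
    and "\<And>r. 2 * w * g \<le> r \<Longrightarrow> r < k \<Longrightarrow> lexle x (c r)"
  shows "gsorted (2 * w) (c(k := x)) (Suc k)"
proof -
  have "2 * w * g \<le> r" if "r div (2 * w) = k div (2 * w)" for r
  proof -
    have "k div (2 * w) = g" using assms(2,3) by (intro div_nat_eqI) (auto simp: algebra_simps)
    then show ?thesis using that by (metis div_times_less_eq_dividend mult.commute)
  qed
  then show ?thesis using assms(1,4) unfolding gsorted_def by (auto simp: less_Suc_eq)
qed

text \<open>The larger head is lexicographically at least all that remains of the pair, and by the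
  invariant at most all that the pair has already written; so appending it keeps the order
  descending.\<close>

lemma merge_inv_step:
  assumes inv: "merge_inv w n a c k i j m e" and "k < e" "k < n" and srt: "gsorted w a n"
  shows "if i < m \<and> i < n \<and> \<not> (j < e \<and> j < n \<and> \<not> lexle (a j) (a i))
    then merge_inv w n a (c(k := a i)) (Suc k) (Suc i) j m e
    else merge_inv w n a (c(k := a j)) (Suc k) i (Suc j) m e"
proof -
  obtain g where g: "e = 2 * w * g + 2 * w" "m = 2 * w * g + w" "2 * w * g \<le> i" "i \<le> m" "m \<le> j" "j \<le> e"
      "i + j = k + m" "i \<le> n" "j \<le> n \<or> j = m"
    and low: "\<And>r s. 2 * w * g \<le> r \<Longrightarrow> r < k \<Longrightarrow> i \<le> s \<and> s < m \<or> j \<le> s \<and> s < e \<Longrightarrow> s < n \<Longrightarrow>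
            lexle (a s) (c r)"
    using inv \<open>k < e\<close> unfolding merge_inv_def by auto
  have k: "2 * w * g \<le> k" "k < 2 * w * g + 2 * w" using g \<open>k < e\<close> by linarith+
  have img: "c ` {..<k} = a ` ({..<i} \<union> {m..<j})" and gs: "gsorted (2 * w) c k"
    using inv by (auto simp: merge_inv_def)
  \<comment> \<open>With respect to width \<open>w\<close>, the halves of pair \<open>g\<close> are
    the groups \<open>2 * g\<close> and \<open>2 * g + 1\<close>.\<close>
  have left: "lexle (a s) (a i)" if "i \<le> s" "s < m" "s < n" for s
    using gsortedD[OF srt, of i s "2 * g"] that g by (simp add: algebra_simps)
  have right: "lexle (a s) (a j)" if "j \<le> s" "s < e" "s < n" for s
    using gsortedD[OF srt, of j s "2 * g + 1"] that g by (simp add: algebra_simps)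
  have img': "(c(k := x)) ` {..<Suc k} = insert x (c ` {..<k})" for x
    by (auto simp: lessThan_Suc)
  show ?thesis
  proof (cases "i < m \<and> i < n \<and> \<not> (j < e \<and> j < n \<and> \<not> lexle (a j) (a i))")
    case True
    have all: "lexle (a s) (a i)" if "i \<le> s \<and> s < m \<or> j \<le> s \<and> s < e" "s < n" for s
    proof (cases "i \<le> s \<and> s < m")
      case False
      then have s: "j \<le> s" "s < e" using that by auto
      then have "lexle (a j) (a i)" using True that by auto
      with right[OF s that(2)] show ?thesis by (rule lexle_trans)
    qed (use left that in auto)
    have "gsorted (2 * w) (c(k := a i)) (Suc k)"
      using low[of _ i] True by (intro gsorted_snoc[OF gs k]) auto
    moreover have "insert (a i) (a ` ({..<i} \<union> {m..<j})) = a ` ({..<Suc i} \<union> {m..<j})"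
      by (auto simp: lessThan_Suc)
    moreover have "\<exists>g. e = 2 * w * g + 2 * w \<and> m = 2 * w * g + w \<and> 2 * w * g \<le> Suc i \<and> Suc i \<le> m \<and> m \<le> j \<and> j \<le> e \<and>
         Suc i + j = Suc k + m \<and> Suc i \<le> n \<and> (j \<le> n \<or> j = m) \<and>
         (\<forall>r s. 2 * w * g \<le> r \<longrightarrow> r < Suc k \<longrightarrow> Suc i \<le> s \<and> s < m \<or> j \<le> s \<and> s < e \<longrightarrow> s < n \<longrightarrow>
            lexle (a s) ((c(k := a i)) r))"
      using g True low all by (intro exI[of _ g]) (auto simp: less_Suc_eq)
    ultimately show ?thesis
      using \<open>k < n\<close> unfolding if_P[OF True] merge_inv_def img' img by simp
  next
    case False
    \<comment> \<open>If the left half ends at \<open>m\<close>, then \<open>i + j = k + m\<close>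
      gives \<open>j = k\<close>. It cannot end early at \<open>n\<close>, since the right half
      would then be empty and \<open>k = n\<close>.\<close>
    have j: "j < e" "j < n"
    proof -
      have "j < e \<and> j < n" if "i < m" "i < n" using False that by auto
      moreover have "j < e \<and> j < n" if "i = m" using that g \<open>k < e\<close> \<open>k < n\<close> by linarith
      moreover have "False" if "i = n" "i < m" using that g \<open>k < n\<close> by linarith
      ultimately show "j < e" "j < n" using g(4,8) by (metis le_neq_implies_less)+
    qed
    have all: "lexle (a s) (a j)" if "i \<le> s \<and> s < m \<or> Suc j \<le> s \<and> s < e" "s < n" for s
    proof (cases "i \<le> s \<and> s < m")
      case True
      then have "i < n" "i < m" using that by auto
      then have "lexle (a i) (a j)" using False lexle_linear by auto
      with left True that show ?thesis using lexle_trans by blast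
    qed (use right that in auto)
    have "gsorted (2 * w) (c(k := a j)) (Suc k)"
      using low[of _ j] j by (intro gsorted_snoc[OF gs k]) auto
    moreover have "insert (a j) (a ` ({..<i} \<union> {m..<j})) = a ` ({..<i} \<union> {m..<Suc j})"
      using g(5) by (auto simp: atLeastLessThanSuc)
    moreover have "\<exists>g. e = 2 * w * g + 2 * w \<and> m = 2 * w * g + w \<and> 2 * w * g \<le> i \<and> i \<le> m \<and> m \<le> Suc j \<and> Suc j \<le> e \<and>
         i + Suc j = Suc k + m \<and> i \<le> n \<and> (Suc j \<le> n \<or> Suc j = m) \<and>
         (\<forall>r s. 2 * w * g \<le> r \<longrightarrow> r < Suc k \<longrightarrow> i \<le> s \<and> s < m \<or> Suc j \<le> s \<and> s < e \<longrightarrow> s < n \<longrightarrow>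
            lexle (a s) ((c(k := a j)) r))"
      using g j low all by (intro exI[of _ g]) (auto simp: less_Suc_eq)
    ultimately show ?thesis
      using \<open>k < n\<close> unfolding if_not_P[OF False] merge_inv_def img' img by simp
  qed
qed

text \<open>The array may end inside the last pair, so \<open>k\<close> need not reach
  \<open>e\<close>; the equation \<open>i + j = n + m\<close> shows instead that everything below
  \<open>n\<close> has been used.\<close>

lemma merge_inv_finish:
  assumes "merge_inv w n a c n i j m e"
  shows "gsorted (2 * w) c n" "c ` {..<n} = a ` {..<n}"
proof -
  have "{..<i} \<union> {m..<j} = {..<n}"
  proof (cases "e = 0 \<and> n = 0 \<and> i = 0 \<and> j = 0 \<and> m = 0")
    case False
    then have "i \<le> m" "m \<le> j" "i + j = n + m" "i \<le> n" "j \<le> n \<or> j = m"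
      using assms unfolding merge_inv_def by blast+
    then show ?thesis by (cases "j = m") auto
  qed auto
  then show "gsorted (2 * w) c n" "c ` {..<n} = a ` {..<n}"
    using assms by (auto simp: merge_inv_def)
qed

section \<open>Extraction and merging loops\<close>

definition prs :: "(nat \<Rightarrow> real) \<Rightarrow> (nat \<Rightarrow> real) \<Rightarrow> nat \<Rightarrow> tp2" where
  "prs a b = (\<lambda>i. (a i, b i))"

lemma prs_apply [simp]: "prs a b i = (a i, b i)"
  by (simp add: prs_def)

lemma prs_upd [simp]: "prs (a(i := x)) (b(i := y)) = (prs a b)(i := (x, y))"
  by (auto simp: prs_def)

definition lexless :: "rexp \<Rightarrow> rexp \<Rightarrow> rexp \<Rightarrow> rexp \<Rightarrow> bexp" where
  "lexless e f e' f' = BOr (RLess e e') (BAnd (BNot (RLess e' e)) (RLess f f'))"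

lemma bval_lexless [simp]:
  "bval (lexless e f e' f') s \<longleftrightarrow> \<not> lexle (rval e' s, rval f' s) (rval e s, rval f s)"
  by (auto simp: lexless_def lexle_def)

text \<open>Opening the next pair inside the loop over output positions turns all merges of a pass
  into one flat loop, whose linear time is immediate.\<close>

definition merge_loop :: cmd where
  "merge_loop = While (NLess (nvar ''k'') (nvar ''N'')) (block [
     Cond (NLess (nvar ''k'') (nvar ''e'')) Skip (block [
       nset ''i'' (nvar ''k''),
       nset ''m'' (NAdd (nvar ''k'') (nvar ''w'')),
       nset ''j'' (nvar ''m''),
       nset ''e'' (NAdd (nvar ''m'') (nvar ''w''))]),
     Cond (BAnd (BAnd (NLess (nvar ''i'') (nvar ''m'')) (NLess (nvar ''i'') (nvar ''N'')))
         (BNot (BAnd (BAnd (NLess (nvar ''j'') (nvar ''e'')) (NLess (nvar ''j'') (nvar ''N'')))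
           (lexless (RCell ''A'' (nvar ''i'')) (RCell ''B'' (nvar ''i''))
              (RCell ''A'' (nvar ''j'')) (RCell ''B'' (nvar ''j''))))))
       (block [
         RStore ''C'' (nvar ''k'') (RCell ''A'' (nvar ''i'')),
         RStore ''D'' (nvar ''k'') (RCell ''B'' (nvar ''i'')),
         incr ''i''])
       (block [
         RStore ''C'' (nvar ''k'') (RCell ''A'' (nvar ''j'')),
         RStore ''D'' (nvar ''k'') (RCell ''B'' (nvar ''j'')),
         incr ''j'']),
     incr ''k''])"

lemma wp_merge_loop:
  assumes "nmem s ''N'' 0 = n" "nmem s ''w'' 0 = w" "prs (rmem s ''A'') (rmem s ''B'') = a"
    and "nmem s ''k'' 0 = 0" "nmem s ''i'' 0 = 0" "nmem s ''j'' 0 = 0" "nmem s ''m'' 0 = 0" "nmem s ''e'' 0 = 0"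
    and w: "w > 0" and srt: "gsorted w a n"
  shows "wp merge_loop (\<lambda>t s'. t \<le> 20 * n + 1 \<and> gsorted (2 * w) (prs (rmem s' ''C'') (rmem s' ''D'')) n \<and>
     prs (rmem s' ''C'') (rmem s' ''D'') ` {..<n} = a ` {..<n}) s"
proof -
  define I where "I s \<longleftrightarrow> nmem s ''N'' 0 = n \<and> nmem s ''w'' 0 = w \<and> prs (rmem s ''A'') (rmem s ''B'') = a \<and>
    merge_inv w n a (prs (rmem s ''C'') (rmem s ''D'')) (nmem s ''k'' 0) (nmem s ''i'' 0)
      (nmem s ''j'' 0) (nmem s ''m'' 0) (nmem s ''e'' 0)" for s :: state
  define \<phi> where "\<phi> s = 20 * (n - nmem s ''k'' 0)" for s :: state
  have "wp merge_loop (\<lambda>t s'. t \<le> \<phi> s + 1 \<and> \<not> bval (NLess (nvar ''k'') (nvar ''N'')) s' \<and> I s') s"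
    unfolding merge_loop_def
  proof (rule wp_While_measure[where I = I and \<phi> = \<phi>])
    show "I s" using assms merge_inv_start by (simp add: I_def)
    fix s assume I: "I s" and b: "bval (NLess (nvar ''k'') (nvar ''N'')) s"
    define k where "k = nmem s ''k'' 0"
    have k: "k < n" using I b by (auto simp: I_def k_def)
    have d: "n - k = Suc (n - Suc k)" using k by simp
    have inv: "merge_inv w n a (prs (rmem s ''C'') (rmem s ''D'')) k (nmem s ''i'' 0)
        (nmem s ''j'' 0) (nmem s ''m'' 0) (nmem s ''e'' 0)"
      and vars: "nmem s ''N'' 0 = n" "nmem s ''w'' 0 = w" "prs (rmem s ''A'') (rmem s ''B'') = a"
      using I by (simp_all add: I_def k_def)
    have a: "a i = (rmem s ''A'' i, rmem s ''B'' i)" for i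
      using vars(3) prs_apply by metis
    show "wp (block [
       Cond (NLess (nvar ''k'') (nvar ''e'')) Skip (block [
         nset ''i'' (nvar ''k''),
         nset ''m'' (NAdd (nvar ''k'') (nvar ''w'')),
         nset ''j'' (nvar ''m''),
         nset ''e'' (NAdd (nvar ''m'') (nvar ''w''))]),
       Cond (BAnd (BAnd (NLess (nvar ''i'') (nvar ''m'')) (NLess (nvar ''i'') (nvar ''N'')))
           (BNot (BAnd (BAnd (NLess (nvar ''j'') (nvar ''e'')) (NLess (nvar ''j'') (nvar ''N'')))
             (lexless (RCell ''A'' (nvar ''i'')) (RCell ''B'' (nvar ''i''))
                (RCell ''A'' (nvar ''j'')) (RCell ''B'' (nvar ''j''))))))
         (block [
           RStore ''C'' (nvar ''k'') (RCell ''A'' (nvar ''i'')),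
           RStore ''D'' (nvar ''k'') (RCell ''B'' (nvar ''i'')),
           incr ''i''])
         (block [
           RStore ''C'' (nvar ''k'') (RCell ''A'' (nvar ''j'')),
           RStore ''D'' (nvar ''k'') (RCell ''B'' (nvar ''j'')),
           incr ''j'']),
       incr ''k'']) (\<lambda>t s'. I s' \<and> 1 + t + \<phi> s' \<le> \<phi> s) s"
    proof (cases "k < nmem s ''e'' 0")
      case True
      show ?thesis
        using merge_inv_step[OF inv True k srt] True vars k
        by (auto simp: k_def[symmetric] I_def \<phi>_def d a split: if_splits)
    next
      case False
      have "k < k + w + w" using w by simp
      from merge_inv_step[OF merge_inv_next[OF inv False] this k srt] show ?thesis
        using False vars k w
        by (auto simp: k_def[symmetric] I_def \<phi>_def d a split: if_splits)
    qed
  qed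
  then show ?thesis
  proof (rule wp_mono)
    fix t s'
    assume *: "t \<le> \<phi> s + 1 \<and> \<not> bval (NLess (nvar ''k'') (nvar ''N'')) s' \<and> I s'"
    then have inv: "merge_inv w n a (prs (rmem s' ''C'') (rmem s' ''D'')) (nmem s' ''k'' 0) (nmem s' ''i'' 0)
      (nmem s' ''j'' 0) (nmem s' ''m'' 0) (nmem s' ''e'' 0)" and "nmem s' ''k'' 0 \<ge> n"
      by (simp_all add: I_def)
    moreover from inv have "nmem s' ''k'' 0 \<le> n" unfolding merge_inv_def by (rule conjunct1)
    ultimately have "nmem s' ''k'' 0 = n" by simp
    note merge_inv_finish[OF inv[unfolded this]]
    moreover have "\<phi> s \<le> 20 * n" by (simp add: \<phi>_def)
    ultimately show "t \<le> 20 * n + 1 \<and> gsorted (2 * w) (prs (rmem s' ''C'') (rmem s' ''D'')) n \<and>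
     prs (rmem s' ''C'') (rmem s' ''D'') ` {..<n} = a ` {..<n}"
      using * by simp
  qed
qed

definition copy_loop :: cmd where
  "copy_loop = While (NLess (nvar ''k'') (nvar ''N'')) (block [
     RStore ''A'' (nvar ''k'') (RCell ''C'' (nvar ''k'')),
     RStore ''B'' (nvar ''k'') (RCell ''D'' (nvar ''k'')),
     incr ''k''])"

lemma wp_copy_loop:
  assumes "nmem s ''N'' 0 = n" "nmem s ''k'' 0 = 0"
  shows "wp copy_loop (\<lambda>t s'. t \<le> 10 * n + 1 \<and>
     (\<forall>r<n. prs (rmem s' ''A'') (rmem s' ''B'') r = prs (rmem s ''C'') (rmem s ''D'') r)) s"
proof -
  define I where "I s' \<longleftrightarrow> nmem s' ''N'' 0 = n \<and> nmem s' ''k'' 0 \<le> n \<and>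
    rmem s' ''C'' = rmem s ''C'' \<and> rmem s' ''D'' = rmem s ''D'' \<and>
    (\<forall>r<nmem s' ''k'' 0. rmem s' ''A'' r = rmem s ''C'' r \<and> rmem s' ''B'' r = rmem s ''D'' r)" for s' :: state
  define \<phi> where "\<phi> s = 10 * (n - nmem s ''k'' 0)" for s :: state
  have "wp copy_loop (\<lambda>t s'. t \<le> \<phi> s + 1 \<and> \<not> bval (NLess (nvar ''k'') (nvar ''N'')) s' \<and> I s') s"
    unfolding copy_loop_def
  proof (rule wp_While_measure[where I = I and \<phi> = \<phi>], goal_cases)
    case (1 s)
    then show ?case by (auto simp: I_def \<phi>_def less_Suc_eq)
  qed (use assms in \<open>simp add: I_def\<close>)
  then show ?thesis
    by (rule wp_mono) (use assms in \<open>auto simp: I_def \<phi>_def\<close>)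
qed

definition init_loop :: cmd where
  "init_loop = While (NLess (nvar ''k'') (nvar ''N''))
     (Seq (NStore ''p'' (nvar ''k'') (nvar ''k'')) (incr ''k''))"

lemma wp_init_loop:
  assumes "nmem s ''N'' 0 = n" "nmem s ''k'' 0 = 0"
  shows "wp init_loop (\<lambda>t s'. t \<le> 10 * n + 1 \<and> (\<forall>r<n. nmem s' ''p'' r = r)) s"
proof -
  define I where "I s' \<longleftrightarrow> nmem s' ''N'' 0 = n \<and> nmem s' ''k'' 0 \<le> n \<and>
    (\<forall>r<nmem s' ''k'' 0. nmem s' ''p'' r = r)" for s' :: state
  define \<phi> where "\<phi> s = 10 * (n - nmem s ''k'' 0)" for s :: state
  have "wp init_loop (\<lambda>t s'. t \<le> \<phi> s + 1 \<and> \<not> bval (NLess (nvar ''k'') (nvar ''N'')) s' \<and> I s') s"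
    unfolding init_loop_def
  proof (rule wp_While_measure[where I = I and \<phi> = \<phi>], goal_cases)
    case (1 s)
    then show ?case by (auto simp: I_def \<phi>_def less_Suc_eq)
  qed (use assms in \<open>simp add: I_def\<close>)
  then show ?thesis
    by (rule wp_mono) (use assms in \<open>auto simp: I_def \<phi>_def\<close>)
qed

text \<open>One transition of a flattened nest of loops: advance a pointer, finish a group, output
  the candidate of a finished scan, or signal success. A single measure then bounds the
  time.\<close>

definition scan_body :: cmd where
  "scan_body =
     Cond (NLess (nvar ''q'') (nvar ''N''))
       (Cond (BAnd (BAnd (NLess (NCell ''p'' (nvar ''q'')) (nvar ''N''))
                 (NLess (NCell ''p'' (nvar ''q'')) (NAdd (nvar ''q'') (nvar ''w''))))
               (BAnd (NLess (NConst 0) (nvar ''c''))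
                 (BNot (RLess (RCell ''F'' (NSub (nvar ''c'') (NConst 1)))
                   (RCell ''B'' (NCell ''p'' (nvar ''q'')))))))
         (NStore ''p'' (nvar ''q'') (NAdd (NCell ''p'' (nvar ''q'')) (NConst 1)))
         (Seq
           (Cond (BAnd (BAnd (NLess (NCell ''p'' (nvar ''q'')) (nvar ''N''))
                 (NLess (NCell ''p'' (nvar ''q'')) (NAdd (nvar ''q'') (nvar ''w''))))
               (BOr (BNot (NLess (NConst 0) (nvar ''f'')))
                 (lexless (RCell ''A'' (nvar ''b'')) (RCell ''B'' (nvar ''b''))
                   (RCell ''A'' (NCell ''p'' (nvar ''q''))) (RCell ''B'' (NCell ''p'' (nvar ''q''))))))
             (Seq (nset ''b'' (NCell ''p'' (nvar ''q''))) (nset ''f'' (NConst 1)))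
             Skip)
           (nset ''q'' (NAdd (nvar ''q'') (nvar ''w'')))))
       (Cond (NLess (NConst 0) (nvar ''f''))
         (block [
           RStore ''E'' (nvar ''c'') (RCell ''A'' (nvar ''b'')),
           RStore ''F'' (nvar ''c'') (RCell ''B'' (nvar ''b'')),
           incr ''c'',
           nset ''q'' (NConst 0),
           nset ''f'' (NConst 0)])
         (nset ''d'' (NConst 1)))"

text \<open>Up to \<open>w + 1\<close> points may be written: only the excess point proves that the
  group size was too small.\<close>

definition scan_loop :: cmd where
  "scan_loop = While (BAnd (BNot (NLess (NConst 0) (nvar ''d''))) (BNot (NLess (nvar ''w'') (nvar ''c'')))) scan_body"

text \<open>The number of remaining iterations: pointer moves, groups left in the current scan and its
  final output step, and full scans for the outputs still allowed.\<close>

definition scan_measure :: "nat \<Rightarrow> nat \<Rightarrow> (nat \<Rightarrow> nat) \<Rightarrow> nat \<Rightarrow> nat \<Rightarrow> nat" where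
  "scan_measure w n p q c = (if c \<le> w then
     moves w n p + ((n - q + w - 1) div w + 1) + (w - c) * ((n + w - 1) div w + 1) else 0)"

lemma scan_measure_next:
  assumes "w > 0" "q < n" "c \<le> w"
  shows "scan_measure w n p (q + w) c < scan_measure w n p q c"
proof -
  have "(n - (q + w) + w - 1) div w < (n - q + w - 1) div w"
  proof (cases "q + w \<le> n")
    case True
    then have "n - q + w - 1 = (n - (q + w) + w - 1) + w" using assms by linarith
    then have "(n - q + w - 1) div w = (n - (q + w) + w - 1) div w + 1" using assms(1) by (metis div_add_self2 less_irrefl)
    then show ?thesis by linarith
  next
    case False
    then have "n - (q + w) + w - 1 < w" using assms by linarith
    then have "(n - (q + w) + w - 1) div w = 0" by (rule div_less)
    moreover have "w \<le> n - q + w - 1" using assms by linarith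
    then have "w div w \<le> (n - q + w - 1) div w" by (rule div_le_mono)
    ultimately show ?thesis using assms by simp
  qed
  then show ?thesis unfolding scan_measure_def if_P[OF assms(3)] by linarith
qed

lemma scan_measure_output:
  assumes "n \<le> q" "c \<le> w"
  shows "scan_measure w n p 0 (Suc c) < scan_measure w n p q c"
\<comment> \<open>For \<open>c = w\<close> the new measure is 0, and the old one is positive thanks
  to its \<open>+ 1\<close> for the output step.\<close>
proof (cases "c = w")
  case False
  then have c: "Suc c \<le> w" using assms(2) by simp
  define g where "g = (n + w - 1) div w + 1"
  have "w - c = Suc (w - Suc c)" using c by simp
  then have "(w - c) * g = g + (w - Suc c) * g" by simp
  then show ?thesis unfolding scan_measure_def if_P[OF c] if_P[OF assms(2)] g_def[symmetric]
    by (simp add: g_def)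
qed (simp add: scan_measure_def)

lemma scan_measure_move:
  assumes "w dvd q" "q \<le> p q" "p q < n" "p q < q + w" "c \<le> w"
  shows "scan_measure w n (p(q := Suc (p q))) q c < scan_measure w n p q c"
  using moves_Suc[of w q p n, OF assms(1-4)] unfolding scan_measure_def if_P[OF assms(5)] by linarith

text \<open>With \<open>g\<close> groups, \<open>g \<le> n\<close> and \<open>w * g < n + w\<close>,
  so moves, first scan and \<open>w\<close> further scans amount to
  \<open>n + (g + 1) + w * (g + 1) \<le> 7 * n\<close>.\<close>

lemma scan_measure_start:
  assumes "0 < w" "w \<le> 2 * n"
  shows "scan_measure w n p 0 0 \<le> 7 * n"
proof -
  let ?g = "(n + w - 1) div w"
  have "w * ?g \<le> n + w - 1" using div_times_less_eq_dividend[of "n + w - 1" w] by (simp add: mult.commute)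
  moreover have "?g \<le> n"
  proof -
    have "n + w - 1 \<le> n * w" using assms by (cases n; cases w) auto
    then have "?g \<le> (n * w) div w" by (rule div_le_mono)
    then show ?thesis using assms by simp
  qed
  ultimately have "?g + w * ?g + w + 1 \<le> 6 * n" using assms by linarith
  then show ?thesis using moves_le[of w n p] by (simp add: scan_measure_def algebra_simps)
qed

definition attempt :: cmd where
  "attempt = block [
     nset ''k'' (NConst 0),
     init_loop,
     nset ''c'' (NConst 0),
     nset ''q'' (NConst 0),
     nset ''f'' (NConst 0),
     nset ''d'' (NConst 0),
     scan_loop]"

lemma wp_scan_loop:
  assumes cells: "nmem s ''N'' 0 = n" "nmem s ''w'' 0 = w" "prs (rmem s ''A'') (rmem s ''B'') = a"
    and "nmem s ''c'' 0 = 0" "nmem s ''q'' 0 = 0" "nmem s ''f'' 0 = 0" "nmem s ''d'' 0 = 0"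
    and p: "\<And>r. r < n \<Longrightarrow> nmem s ''p'' r = r"
    and w: "w > 0" "w \<le> 2 * n" and srt: "gsorted w a n"
  shows "wp scan_loop (\<lambda>t s'. t \<le> 70 * n + 1 \<and>
     stair (a ` {..<n}) (arr (rmem s' ''E'') (rmem s' ''F'') (nmem s' ''c'' 0)) \<and>
     (if nmem s' ''d'' 0 = 0 then w < card (mx (a ` {..<n}))
      else set (arr (rmem s' ''E'') (rmem s' ''F'') (nmem s' ''c'' 0)) = mx (a ` {..<n}))) s"
proof -
  define out where "out s = arr (rmem s ''E'') (rmem s ''F'') (nmem s ''c'' 0)" for s :: state
  define I where "I s \<longleftrightarrow> nmem s ''N'' 0 = n \<and> nmem s ''w'' 0 = w \<and> prs (rmem s ''A'') (rmem s ''B'') = a \<and>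
    stair (a ` {..<n}) (out s) \<and>
    (if nmem s ''d'' 0 = 0 then scan_inv w n a (nmem s ''p'') (nmem s ''q'' 0) (nmem s ''f'' 0) (nmem s ''b'' 0) (out s)
     else set (out s) = mx (a ` {..<n}))" for s :: state
  define \<phi> where "\<phi> s = (if nmem s ''d'' 0 = 0 then
    10 * scan_measure w n (nmem s ''p'') (nmem s ''q'' 0) (nmem s ''c'' 0) else 0)" for s :: state
  let ?b = "BAnd (BNot (NLess (NConst 0) (nvar ''d''))) (BNot (NLess (nvar ''w'') (nvar ''c'')))"
  have "wp scan_loop (\<lambda>t s'. t \<le> \<phi> s + 1 \<and> \<not> bval ?b s' \<and> I s') s"
    unfolding scan_loop_def
  proof (rule wp_While_measure[where I = I and \<phi> = \<phi>])
    show "I s" using assms by (simp add: I_def out_def stair_Nil scan_inv_start)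
    fix s assume I: "I s" and b: "bval ?b s"
    define p q f b c where "p = nmem s ''p''" and "q = nmem s ''q'' 0" and "f = nmem s ''f'' 0"
      and "b = nmem s ''b'' 0" and "c = nmem s ''c'' 0"
    note fold = this[symmetric]
    have inv: "scan_inv w n a p q f b (out s)" and st: "stair (a ` {..<n}) (out s)"
      and vars: "nmem s ''N'' 0 = n" "nmem s ''w'' 0 = w" "prs (rmem s ''A'') (rmem s ''B'') = a"
      and d: "nmem s ''d'' 0 = 0" and c: "c \<le> w"
      using I \<open>bval ?b s\<close> by (simp_all add: I_def p_def q_def f_def b_def c_def)
    have a: "a i = (rmem s ''A'' i, rmem s ''B'' i)" for i
      using vars(3) prs_apply by metis
    have above: "above_last (out s) (a i) \<longleftrightarrow> \<not> (0 < c \<and> \<not> rmem s ''F'' (c - Suc 0) < rmem s ''B'' i)" for i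
      by (cases c) (auto simp: above_last_def out_def fold arr_Suc a)
    have dvd: "w dvd q" and qp: "q < n \<Longrightarrow> q \<le> p q"
      using inv by (auto simp: scan_inv_def)
    have meas: "1 + t + 10 * m' \<le> 10 * m" if "m' < m" "t \<le> 9" for t m' m :: nat
      using that by simp
    show "wp scan_body (\<lambda>t s'. I s' \<and> 1 + t + \<phi> s' \<le> \<phi> s) s"
    proof (cases "q < n")
      case q: True
      show ?thesis
      proof (cases "p q < n \<and> p q < q + w \<and> \<not> above_last (out s) (a (p q))")
        case True
        have "scan_inv w n a (p(q := Suc (p q))) q f b (out s)"
          using scan_inv_move[OF inv] True by blast
        moreover have "scan_measure w n (p(q := Suc (p q))) q c < scan_measure w n p q c"
          using scan_measure_move[of w q p n c, OF dvd _ _ _ c] qp q True by blast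
        ultimately show ?thesis
          using True q vars d st meas[of _ _ 3] unfolding above
          by (simp add: scan_body_def fold I_def \<phi>_def out_def)
      next
        case False
        note next_inv = scan_inv_next[OF inv w(1) q srt]
        have "scan_measure w n p (q + w) c < scan_measure w n p q c"
          using scan_measure_next[OF w(1) q c] .
        then show ?thesis
          using False next_inv q vars d st meas unfolding above
          by (auto simp: scan_body_def fold I_def \<phi>_def out_def a split: if_splits)
      qed
    next
      case q: False
      show ?thesis
      proof (cases "f = 0")
        case True
        have "set (out s) = mx (a ` {..<n})"
          using st by (rule stair_finished) (use inv True q in \<open>auto simp: scan_inv_def\<close>)
        moreover have "1 \<le> scan_measure w n p q c" using c by (simp add: scan_measure_def)
        ultimately show ?thesis
          using q True vars d st by (simp add: scan_body_def fold I_def \<phi>_def out_def)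
      next
        case False
        have "stair (a ` {..<n}) (out s @ [a b])"
          using inv False q by (intro stair_snoc[OF st]) (auto simp: scan_inv_def)
        moreover have "scan_inv w n a p 0 0 b (out s @ [a b])"
          using scan_inv_output[OF inv False] .
        moreover have "scan_measure w n p 0 (Suc c) < scan_measure w n p q c"
          using scan_measure_output[of n q c w p] q c by simp
        ultimately show ?thesis
          using q False vars d meas by (simp add: scan_body_def fold I_def \<phi>_def out_def arr_Suc a)
      qed
    qed
  qed
  then show ?thesis
  proof (rule wp_mono)
    fix t s'
    assume *: "t \<le> \<phi> s + 1 \<and> \<not> bval ?b s' \<and> I s'"
    have "\<phi> s \<le> 70 * n"
      using scan_measure_start[OF w, of "nmem s ''p''"] assms by (simp add: \<phi>_def)
    moreover have st: "stair (a ` {..<n}) (out s')" using * by (simp add: I_def)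
    moreover have "length (out s') = nmem s' ''c'' 0" by (simp add: out_def)
    ultimately show "t \<le> 70 * n + 1 \<and>
     stair (a ` {..<n}) (arr (rmem s' ''E'') (rmem s' ''F'') (nmem s' ''c'' 0)) \<and>
     (if nmem s' ''d'' 0 = 0 then w < card (mx (a ` {..<n}))
      else set (arr (rmem s' ''E'') (rmem s' ''F'') (nmem s' ''c'' 0)) = mx (a ` {..<n}))"
      using * stair_length[OF st] by (auto simp: I_def out_def split: if_splits)
  qed
qed

lemma wp_attempt:
  assumes cells: "nmem s ''N'' 0 = n" "nmem s ''w'' 0 = w" "prs (rmem s ''A'') (rmem s ''B'') = a"
    and w: "w > 0" "w \<le> 2 * n" and srt: "gsorted w a n"
  shows "wp attempt (\<lambda>t s'. t \<le> 80 * n + 10 \<and>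
     nmem s' ''N'' 0 = n \<and> nmem s' ''w'' 0 = w \<and> prs (rmem s' ''A'') (rmem s' ''B'') = a \<and>
     stair (a ` {..<n}) (arr (rmem s' ''E'') (rmem s' ''F'') (nmem s' ''c'' 0)) \<and>
     (if nmem s' ''d'' 0 = 0 then w < card (mx (a ` {..<n}))
      else set (arr (rmem s' ''E'') (rmem s' ''F'') (nmem s' ''c'' 0)) = mx (a ` {..<n}))) s"
proof -
  have "wp (Seq init_loop (block [nset ''c'' (NConst 0), nset ''q'' (NConst 0), nset ''f'' (NConst 0),
       nset ''d'' (NConst 0), scan_loop]))
     (\<lambda>t s'. t \<le> 80 * n + 9 \<and>
       stair (a ` {..<n}) (arr (rmem s' ''E'') (rmem s' ''F'') (nmem s' ''c'' 0)) \<and>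
       (if nmem s' ''d'' 0 = 0 then w < card (mx (a ` {..<n}))
        else set (arr (rmem s' ''E'') (rmem s' ''F'') (nmem s' ''c'' 0)) = mx (a ` {..<n})))
     (nstore ''k'' 0 0 s)"
    unfolding wp_Seq
  proof (rule wp_mono[OF wp_frame[OF wp_init_loop[where n = n]]])
    fix t s1
    assume *: "(t \<le> 10 * n + 1 \<and> (\<forall>r<n. nmem s1 ''p'' r = r)) \<and> unchanged init_loop (nstore ''k'' 0 0 s) s1"
    then have u: "nmem s1 ''N'' 0 = n" "nmem s1 ''w'' 0 = w" "rmem s1 = rmem s"
      using cells by (auto simp: unchanged_def init_loop_def)
    define s2 where "s2 = nstore ''d'' 0 0 (nstore ''f'' 0 0 (nstore ''q'' 0 0 (nstore ''c'' 0 0 s1)))"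
    have "wp scan_loop (\<lambda>t s'. t \<le> 70 * n + 1 \<and>
       stair (a ` {..<n}) (arr (rmem s' ''E'') (rmem s' ''F'') (nmem s' ''c'' 0)) \<and>
       (if nmem s' ''d'' 0 = 0 then w < card (mx (a ` {..<n}))
        else set (arr (rmem s' ''E'') (rmem s' ''F'') (nmem s' ''c'' 0)) = mx (a ` {..<n}))) s2"
      by (rule wp_scan_loop[OF _ _ _ _ _ _ _ _ w srt]) (use * u cells in \<open>simp_all add: s2_def\<close>)
    then show "wp (block [nset ''c'' (NConst 0), nset ''q'' (NConst 0), nset ''f'' (NConst 0),
         nset ''d'' (NConst 0), scan_loop])
       (\<lambda>u s'. t + u \<le> 80 * n + 9 \<and>
         stair (a ` {..<n}) (arr (rmem s' ''E'') (rmem s' ''F'') (nmem s' ''c'' 0)) \<and>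
         (if nmem s' ''d'' 0 = 0 then w < card (mx (a ` {..<n}))
          else set (arr (rmem s' ''E'') (rmem s' ''F'') (nmem s' ''c'' 0)) = mx (a ` {..<n}))) s1"
      unfolding block.simps wp_Seq wp_NStore nval.simps s2_def[symmetric]
      by (rule wp_mono) (use * in auto)
  qed (use cells in simp_all)
  then have "wp attempt (\<lambda>t s'. t \<le> 80 * n + 10 \<and>
       stair (a ` {..<n}) (arr (rmem s' ''E'') (rmem s' ''F'') (nmem s' ''c'' 0)) \<and>
       (if nmem s' ''d'' 0 = 0 then w < card (mx (a ` {..<n}))
        else set (arr (rmem s' ''E'') (rmem s' ''F'') (nmem s' ''c'' 0)) = mx (a ` {..<n}))) s"
    unfolding attempt_def block.simps wp_Seq wp_NStore nval.simps
    by (elim wp_mono) auto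
  from wp_frame[OF this] show ?thesis
    by (rule wp_mono) (use cells in \<open>auto simp: unchanged_def attempt_def scan_loop_def scan_body_def init_loop_def\<close>)
qed

lemma wp_SeqI:
  assumes "wp c P s" "\<And>t s1. P t s1 \<Longrightarrow> unchanged c s s1 \<Longrightarrow> wp d (\<lambda>u. Q (t + u)) s1"
  shows "wp (Seq c d) Q s"
  unfolding wp_Seq using wp_frame[OF assms(1)] by (rule wp_mono) (use assms(2) in blast)

lemma wp_NStore_Seq:
  "wp (Seq (NStore a e f) d) Q s \<longleftrightarrow> wp d (\<lambda>u. Q (1 + u)) (nstore a (nval e s) (nval f s) s)"
  by simp

lemma gsorted_cong: "(\<And>r. r < n \<Longrightarrow> a r = c r) \<Longrightarrow> gsorted w a n \<longleftrightarrow> gsorted w c n"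
  unfolding gsorted_def by (auto dest: less_trans)

definition merge_pass :: cmd where
  "merge_pass = block [
     nset ''k'' (NConst 0),
     nset ''i'' (NConst 0),
     nset ''j'' (NConst 0),
     nset ''m'' (NConst 0),
     nset ''e'' (NConst 0),
     merge_loop,
     nset ''k'' (NConst 0),
     copy_loop,
     nset ''w'' (NAdd (nvar ''w'') (nvar ''w''))]"

lemma wp_merge_pass:
  assumes cells: "nmem s ''N'' 0 = n" "nmem s ''w'' 0 = w" "prs (rmem s ''A'') (rmem s ''B'') = a"
    and w: "w > 0" and srt: "gsorted w a n"
  shows "wp merge_pass (\<lambda>t s'. t \<le> 30 * n + 10 \<and>
     nmem s' ''N'' 0 = n \<and> nmem s' ''w'' 0 = 2 * w \<and> nmem s' ''d'' = nmem s ''d'' \<and>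
     gsorted (2 * w) (prs (rmem s' ''A'') (rmem s' ''B'')) n \<and>
     prs (rmem s' ''A'') (rmem s' ''B'') ` {..<n} = a ` {..<n}) s"
  unfolding merge_pass_def block.simps wp_NStore_Seq
proof (rule wp_SeqI[OF wp_merge_loop[OF _ _ _ _ _ _ _ _ w srt]], goal_cases)
  case (9 t s1)
  then have u: "nmem s1 ''N'' 0 = n" "nmem s1 ''w'' 0 = w" "nmem s1 ''d'' = nmem s ''d''"
    using cells by (auto simp: unchanged_def merge_loop_def)
  show ?case unfolding wp_NStore_Seq
  proof (rule wp_SeqI[OF wp_copy_loop[where n = n]], goal_cases)
    case (3 v s2)
    then have u2: "nmem s2 ''N'' 0 = n" "nmem s2 ''w'' 0 = w" "nmem s2 ''d'' = nmem s ''d''"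
      using u by (auto simp: unchanged_def copy_loop_def)
    let ?a = "prs (rmem s2 ''A'') (rmem s2 ''B'')" and ?c = "prs (rmem s1 ''C'') (rmem s1 ''D'')"
    have eq: "?a r = ?c r" if "r < n" for r using 3(1) that by simp
    have "gsorted (2 * w) ?a n"
      using 9(1) gsorted_cong[of n ?a ?c "2 * w", OF eq] by blast
    moreover have "?a ` {..<n} = ?c ` {..<n}" by (rule image_cong) (use eq in auto)
    ultimately show ?case using 9(1) 3(1) u2 by simp
  qed (use u in simp_all)
qed (use cells in simp_all)

definition stage_loop :: cmd where
  "stage_loop = While (BNot (NLess (NConst 0) (nvar ''d'')))
     (Seq attempt (Cond (NLess (NConst 0) (nvar ''d'')) Skip merge_pass))"

lemma card_mx_le: "card (mx (a ` {..<n::nat})) \<le> n"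
proof -
  have "card (mx (a ` {..<n})) \<le> card (a ` {..<n})"
    by (intro card_mono) (auto simp: mx_def)
  also have "\<dots> \<le> n" using card_image_le[of "{..<n}" a] by simp
  finally show ?thesis .
qed

text \<open>Stage \<open>j\<close> works with sorted groups of size \<open>2 ^ j\<close> and is reached only if \<open>2 ^ (j - 1)\<close> outputs
  were not enough.\<close>

lemma wp_stage_loop:
  assumes cells: "nmem s ''N'' 0 = n" "nmem s ''w'' 0 = 1" "nmem s ''d'' 0 = 0"
    and T: "prs (rmem s ''A'') (rmem s ''B'') ` {..<n} = T" and n: "n > 0"
    and J: "card (mx T) \<le> 2 ^ J"
  shows "wp stage_loop (\<lambda>t s'. t \<le> (J + 1) * (200 * n) + 1 \<and>
     stair T (arr (rmem s' ''E'') (rmem s' ''F'') (nmem s' ''c'' 0)) \<and>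
     set (arr (rmem s' ''E'') (rmem s' ''F'') (nmem s' ''c'' 0)) = mx T) s"
proof -
  define out where "out s = arr (rmem s ''E'') (rmem s ''F'') (nmem s ''c'' 0)" for s :: state
  \<comment> \<open>The budget reserves \<open>200 * n\<close> steps for every stage from
    \<open>j\<close> to \<open>J\<close>; an attempt and a merge pass take at most
    \<open>110 * n + 20\<close>, apart from two tests.\<close>
  define I where "I k s \<longleftrightarrow> (if nmem s ''d'' 0 = 0 then
      nmem s ''N'' 0 = n \<and> prs (rmem s ''A'') (rmem s ''B'') ` {..<n} = T \<and>
      (\<exists>j. nmem s ''w'' 0 = 2 ^ j \<and> gsorted (2 ^ j) (prs (rmem s ''A'') (rmem s ''B'')) n \<and>
         (j = 0 \<or> 2 ^ (j - 1) < card (mx T)) \<and> (J + 1 - j) * (200 * n) \<le> k)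
    else stair T (out s) \<and> set (out s) = mx T)" for k and s :: state
  have cT: "card (mx T) \<le> n" using card_mx_le T by metis
  have "wp stage_loop (\<lambda>t s'. t \<le> (J + 1) * (200 * n) + 1 \<and>
     \<not> bval (BNot (NLess (NConst 0) (nvar ''d''))) s' \<and> (\<exists>k. I k s')) s"
    unfolding stage_loop_def
  proof (rule wp_While[where I = I])
    show "I ((J + 1) * (200 * n)) s"
      using cells T by (auto simp: I_def intro!: exI[of _ 0])
    fix k s assume I: "I k s" and b: "bval (BNot (NLess (NConst 0) (nvar ''d''))) s"
    let ?a = "prs (rmem s ''A'') (rmem s ''B'')"
    have T: "?a ` {..<n} = T" and N: "nmem s ''N'' 0 = n" using I b by (auto simp: I_def)
    obtain j where j: "nmem s ''w'' 0 = 2 ^ j" "gsorted (2 ^ j) ?a n"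
        "j = 0 \<or> 2 ^ (j - 1) < card (mx T)" "(J + 1 - j) * (200 * n) \<le> k"
      using I b by (auto simp: I_def)
    have "j \<le> J"
    proof (cases "j = 0")
      case False
      then have "(2::nat) ^ (j - 1) < 2 ^ J" using j(3) J by linarith
      then have "j - 1 < J" by simp
      then show ?thesis by simp
    qed simp
    \<comment> \<open>The previous size \<open>2 ^ (j - 1)\<close> is smaller than the number of
      maxima, hence than \<open>n\<close>; this bound on the group size is what makes an attempt
      linear.\<close>
    have w: "(2::nat) ^ j \<le> 2 * n"
    proof (cases "j = 0")
      case False
      then have "(2::nat) ^ j = 2 * 2 ^ (j - 1)" by (cases j) auto
      moreover have "2 ^ (j - 1) < n" using False j(3) cT by linarith
      ultimately show ?thesis by linarith
    qed (use n in simp)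
    show "wp (Seq attempt (Cond (NLess (NConst 0) (nvar ''d'')) Skip merge_pass))
      (\<lambda>t s'. \<exists>k'. I k' s' \<and> 1 + t + k' \<le> k) s"
    proof (rule wp_SeqI[OF wp_attempt[OF N j(1) refl _ w j(2)]], goal_cases)
      case (2 t s1)
      have k: "200 * n + (J - j) * (200 * n) \<le> k"
        using j(4) \<open>j \<le> J\<close> by (simp add: Suc_diff_le)
      show ?case
      proof (cases "nmem s1 ''d'' 0 = 0")
        case True
        then have s1: "nmem s1 ''N'' 0 = n" "nmem s1 ''w'' 0 = 2 ^ j"
          "prs (rmem s1 ''A'') (rmem s1 ''B'') = ?a" "2 ^ j < card (mx T)"
          using 2(1) T by auto
        have t: "t \<le> 80 * n + 10" using 2(1) by simp
        have "j < J" using s1(4) J by (metis less_le_trans nat_power_less_imp_less zero_less_numeral)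
        have "wp merge_pass (\<lambda>u s'. \<exists>k'. I k' s' \<and> 1 + (t + (1 + u)) + k' \<le> k) s1"
        proof (rule wp_mono[OF wp_merge_pass[OF s1(1-3) _ j(2)]], goal_cases)
          case (2 u s')
          then have "I ((J - j) * (200 * n)) s'"
            using T True s1(4) by (auto simp: I_def intro!: exI[of _ "Suc j"])
          moreover have "1 + (t + (1 + u)) + (J - j) * (200 * n) \<le> k"
            using k 2 t n by linarith
          ultimately show ?case by blast
        qed simp
        then show ?thesis using True by simp
      next
        case False
        then have "I 0 s1" using 2(1) T by (auto simp: I_def out_def)
        moreover have "1 + (t + (1 + 1)) + 0 \<le> k" using k 2(1) n by linarith
        ultimately show ?thesis using False by auto
      qed
    qed simp
  qed
  then show ?thesis
    by (rule wp_mono) (auto simp: I_def out_def split: if_splits)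
qed

section \<open>The hull program\<close>

definition hull_pass :: "nat \<Rightarrow> cmd" where
  "hull_pass \<kappa> = block [
     pivot \<kappa>,
     survivors_prog \<kappa>,
     nset ''w'' (NConst 1),
     nset ''d'' (NConst 0),
     stage_loop,
     emit \<kappa>]"

definition hull_prog :: cmd where
  "hull_prog = block [hull_pass 2, hull_pass 0, hull_pass (Suc 0)]"

text \<open>Every discarded point is dominated by \<open>z\<close>, which is kept. Correctness thus
  holds with any input point as pivot; its choice affects only the time.\<close>

lemma mx_key_survivors:
  assumes z: "z \<in> set ps"
  shows "mx (key \<kappa> ` set (survivors \<kappa> z ps)) = key \<kappa> ` maxima \<kappa> (set ps)"
proof -
  let ?S = "set ps" and ?T = "set (survivors \<kappa> z ps)"
  have sub: "?T \<subseteq> ?S" using z by (auto simp: survivors_def)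
  have below: "\<exists>t\<in>?T. dom_le (key \<kappa> s) (key \<kappa> t)" if s: "s \<in> ?S" for s
  proof (cases "survives \<kappa> z s")
    case True
    then show ?thesis using s by (intro bexI[of _ s]) (auto simp: survivors_def)
  next
    case False
    then show ?thesis by (intro bexI[of _ z]) (auto simp: survivors_def survives_def dom_le_def)
  qed
  have "maxima \<kappa> ?T = maxima \<kappa> ?S"
  proof (intro subset_antisym subsetI)
    fix m assume m: "m \<in> maxima \<kappa> ?T"
    have "s = m" if s: "s \<in> ?S" "dom_le (key \<kappa> m) (key \<kappa> s)" for s
    proof -
      obtain t where t: "t \<in> ?T" "dom_le (key \<kappa> s) (key \<kappa> t)" using below[OF s(1)] by blast
      have "dom_le (key \<kappa> m) (key \<kappa> t)" using s(2) t(2) by (rule dom_le_trans)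
      then have "t = m" using m t(1) by (simp add: maxima_def)
      then have "key \<kappa> s = key \<kappa> m" using s(2) t(2) by (auto intro: dom_le_antisym)
      then show ?thesis using inj_key[of \<kappa>] by (rule injD[rotated])
    qed
    then show "m \<in> maxima \<kappa> ?S" using m sub by (auto simp: maxima_def)
  next
    fix m assume m: "m \<in> maxima \<kappa> ?S"
    then obtain t where t: "t \<in> ?T" "dom_le (key \<kappa> m) (key \<kappa> t)"
      using below[of m] by (auto simp: maxima_def)
    then have "t = m" using m sub by (auto simp: maxima_def)
    then show "m \<in> maxima \<kappa> ?T" using m t(1) sub by (auto simp: maxima_def)
  qed
  moreover have "mx (key \<kappa> ` ?T) = key \<kappa> ` maxima \<kappa> ?T"
    unfolding mx_def maxima_def by (auto simp: inj_eq[OF inj_key] intro!: imageI simp del: split_paired_All split_paired_Ex)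
  ultimately show ?thesis by simp
qed

text \<open>In the plane this order reads from left to right for \<kappa> = 2 and from right to left
  for \<kappa> = 0 and 1.\<close>

definition key_sorted :: "nat \<Rightarrow> tp2 list \<Rightarrow> bool" where
  "key_sorted \<kappa> = sorted_wrt (\<lambda>p q. fst (key \<kappa> q) < fst (key \<kappa> p) \<and> snd (key \<kappa> p) < snd (key \<kappa> q))"

lemma wp_hull_pass:
  assumes \<kappa>: "\<kappa> < 3" and inp: "has_input ps s" and ne: "ps \<noteq> []"
    and out: "arr (rmem s ''u'') (rmem s ''v'') (nmem s ''h'' 0) = out"
    and J: "card (maxima \<kappa> (set ps)) \<le> 2 ^ J"
  shows "wp (hull_pass \<kappa>) (\<lambda>t s'. has_input ps s' \<and>
    (\<exists>z. is_pivot \<kappa> ps z \<and> t \<le> 300 * (length ps + (J + 1) * length (survivors \<kappa> z ps))) \<and>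
    (\<exists>l. set l = maxima \<kappa> (set ps) \<and> key_sorted \<kappa> l \<and>
       arr (rmem s' ''u'') (rmem s' ''v'') (nmem s' ''h'' 0) = out @ filter (fresh_in out) l)) s"
  unfolding hull_pass_def block.simps
proof (rule wp_SeqI[OF wp_pivot[OF \<kappa> inp ne]], elim conjE exE, goal_cases)
  case (1 t1 s1 z)
  have key_z: "(rmem s1 ''P'' 0, rmem s1 ''Q'' 0) = key \<kappa> z" and piv: "is_pivot \<kappa> ps z"
    and t1: "t1 \<le> 10 * length ps + 10" using 1 by blast+
  have inp1: "has_input ps s1" and out1: "arr (rmem s1 ''u'') (rmem s1 ''v'') (nmem s1 ''h'' 0) = out"
    using inp out 1 by (auto simp: unchanged_def has_input_def pivot_def pivot_loop_def read_key_def)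
  have z: "z \<in> set ps" using piv by (simp add: is_pivot_def)
  have len: "length ps \<ge> 1" using ne by (cases ps) auto
  let ?T = "survivors \<kappa> z ps"
  show ?case
  proof (rule wp_SeqI[OF wp_survivors[OF \<kappa> inp1 key_z]], elim conjE, goal_cases)
    case (1 t2 s2)
    have AB: "arr (rmem s2 ''A'') (rmem s2 ''B'') (nmem s2 ''N'' 0) = map (key \<kappa>) ?T"
      and t2: "t2 \<le> 10 * length ps + 10" using 1 by blast+
    have inp2: "has_input ps s2" and out2: "arr (rmem s2 ''u'') (rmem s2 ''v'') (nmem s2 ''h'' 0) = out"
      using inp1 out1 1 by (auto simp: unchanged_def has_input_def survivors_prog_def filter_loop_def read_key_def)
    have N: "nmem s2 ''N'' 0 = length ?T" using AB by (metis length_arr length_map)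
    have T: "prs (rmem s2 ''A'') (rmem s2 ''B'') ` {..<length ?T} = key \<kappa> ` set ?T"
      using arg_cong[OF AB, of set] unfolding set_arr prs_def N by simp
    have J': "card (mx (key \<kappa> ` set ?T)) \<le> 2 ^ J"
      using J card_image[OF inj_on_subset[OF inj_key[of \<kappa>]], of "maxima \<kappa> (set ps)"]
      unfolding mx_key_survivors[OF z] by simp
    have Tpos: "length ?T > 0" by (simp add: survivors_def)
    show ?case unfolding wp_NStore_Seq
    proof (rule wp_SeqI[OF wp_stage_loop[OF _ _ _ _ Tpos J']], goal_cases)
      case (5 t3 s3)
      have inp3: "has_input ps s3" and out3: "arr (rmem s3 ''u'') (rmem s3 ''v'') (nmem s3 ''h'' 0) = out"
        using inp2 out2 5(2)
        by (auto simp: unchanged_def has_input_def stage_loop_def attempt_def init_loop_def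
            scan_loop_def scan_body_def merge_pass_def merge_loop_def copy_loop_def)
      define E where "E = arr (rmem s3 ''E'') (rmem s3 ''F'') (nmem s3 ''c'' 0)"
      define l where "l = map (unkey \<kappa>) E"
      have E: "E = map (key \<kappa>) l" using \<kappa> by (simp add: l_def o_def)
      have st: "stair (key \<kappa> ` set ?T) E" "set E = key \<kappa> ` maxima \<kappa> (set ps)"
        using 5(1) mx_key_survivors[OF z] by (simp_all add: E_def)
      have "key \<kappa> ` set l = key \<kappa> ` maxima \<kappa> (set ps)" using st(2) by (simp add: E)
      then have l: "set l = maxima \<kappa> (set ps)" using inj_key[of \<kappa>] by (simp add: inj_image_eq_iff)
      have "key_sorted \<kappa> l" using st(1) by (simp add: stair_def E sorted_wrt_map key_sorted_def)
      have "length E \<le> card (mx (key \<kappa> ` set ?T))" by (rule stair_length[OF st(1)]) simp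
      also have "\<dots> \<le> card (set (map (key \<kappa>) ?T))" by (intro card_mono) (auto simp: mx_def)
      also have "\<dots> \<le> length ?T" using card_length[of "map (key \<kappa>) ?T"] by simp
      finally have len_l: "length l \<le> length ?T" by (simp add: l_def)
      show ?case
      proof (rule wp_mono[OF wp_frame[OF wp_emit[OF \<kappa> E[unfolded E_def] out3]]], elim conjE, goal_cases)
        case (1 t4 s4)
        have "has_input ps s4"
          using inp3 1 by (auto simp: unchanged_def has_input_def emit_def emit_loop_def)
        moreover have "t1 + (t2 + (1 + (1 + (t3 + t4)))) \<le> 300 * (length ps + (J + 1) * length ?T)"
        proof -
          define M where "M = (J + 1) * length ?T"
          have "length ?T \<le> M" by (simp add: M_def)
          moreover have "t3 \<le> 200 * M + 1" using 5(1) by (simp add: M_def mult.left_commute)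
          moreover have "t4 \<le> 10 * length l + 10" using 1 by blast
          ultimately show ?thesis
            unfolding M_def[symmetric] using t1 t2 len_l len by auto
        qed
        ultimately show ?case
          using l \<open>key_sorted \<kappa> l\<close> piv 1 by blast
      qed
    qed (use N T in simp_all)
  qed
qed

section \<open>Concatenation of the three staircases\<close>

lemma sorted_wrt_hd_last:
  assumes "sorted_wrt R l" "p \<in> set l"
  shows "p = last l \<or> R p (last l)" "p = hd l \<or> R (hd l) p"
proof -
  have ne: "l \<noteq> []" using assms(2) by auto
  then have "sorted_wrt R (butlast l @ [last l])" "set l = insert (last l) (set (butlast l))"
    using assms(1) by (simp, metis append_butlast_last_id list.simps(15) rotate1.simps(2) set_rotate1)
  then show "p = last l \<or> R p (last l)" using assms(2) by (auto simp: sorted_wrt_append)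
  from ne show "p = hd l \<or> R (hd l) p" using assms by (cases l) auto
qed

text \<open>A point common to orders 2 and 0 is rightmost and ends \<open>l2\<close>; one common to
  2 and 1 is leftmost and begins \<open>l2\<close>; one common to 0 and 1 but not 2 is leftmost on
  staircase 0 and ends \<open>out\<close>. So the two comparisons of \<open>fresh_in\<close> catch
  every duplicate.\<close>

lemma ccw_vertex_list_passes:
  assumes S: "finite S" "S \<noteq> {}"
    and l2: "set l2 = maxima 2 S" "key_sorted 2 l2"
    and l0: "set l0 = maxima 0 S" "key_sorted 0 l0"
    and l1: "set l1 = maxima (Suc 0) S" "key_sorted (Suc 0) l1"
    and out: "out = l2 @ filter (fresh_in l2) l0"
  shows "ccw_vertex_list S (out @ filter (fresh_in out) l1)"
proof -
  have s2: "sorted_wrt (\<lambda>p q. fst p < fst q) l2"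
    using l2(2) unfolding key_sorted_def by (rule sorted_wrt_mono_rel[rotated]) (auto simp: key_simps)
  have s0: "sorted_wrt (\<lambda>p q. fst p > fst q) l0"
    using l0(2) unfolding key_sorted_def by (rule sorted_wrt_mono_rel[rotated]) auto
  have s1: "sorted_wrt (\<lambda>p q. fst p > fst q) l1"
    using l1(2) unfolding key_sorted_def by (rule sorted_wrt_mono_rel[rotated]) (auto simp: key_simps)
  obtain m where "m \<in> maxima 2 S" using ex_maxima_above[OF S(1)] S(2) by blast
  then have ne: "l2 \<noteq> []" using l2(1) by auto
  note sub = maxima_subset
  have f0: "fresh_in l2 p \<longleftrightarrow> p \<notin> maxima 2 S" if p: "p \<in> maxima 0 S" for p
  proof
    assume "fresh_in l2 p"
    show "p \<notin> maxima 2 S"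
    proof
      assume p2: "p \<in> maxima 2 S"
      have "p \<noteq> last l2" using \<open>fresh_in l2 p\<close> ne by (simp add: fresh_in_def)
      moreover from this have "fst p < fst (last l2)"
        using sorted_wrt_hd_last(1)[OF s2, of p] p2 l2(1) by simp
      moreover have "last l2 \<in> S" using last_in_set[OF ne] l2(1) sub by blast
      ultimately show False using maxima_0_2_fst_less[OF p p2, of "last l2"] by simp
    qed
  next
    assume "p \<notin> maxima 2 S"
    then show "fresh_in l2 p"
      using hd_in_set[OF ne] last_in_set[OF ne] l2(1) by (auto simp: fresh_in_def)
  qed
  define l0' where "l0' = filter (fresh_in l2) l0"
  have l0': "set l0' = maxima 0 S - maxima 2 S" using f0 l0(1) by (auto simp: l0'_def)
  have s0': "sorted_wrt (\<lambda>p q. fst p > fst q) l0'"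
    unfolding l0'_def by (rule sorted_wrt_filter[OF s0])
  have out': "out = l2 @ l0'" by (simp add: out l0'_def)
  have f1: "fresh_in out p \<longleftrightarrow> p \<notin> maxima 2 S \<union> maxima 0 S" if p: "p \<in> maxima (Suc 0) S" for p
  proof
    assume fr: "fresh_in out p"
    have "p \<notin> maxima 2 S"
    proof
      assume p2: "p \<in> maxima 2 S"
      have "p \<noteq> hd l2" using fr ne by (simp add: fresh_in_def out')
      moreover from this have "fst (hd l2) < fst p"
        using sorted_wrt_hd_last(2)[OF s2, of p] p2 l2(1) by simp
      moreover have "hd l2 \<in> S" using hd_in_set[OF ne] l2(1) sub by blast
      ultimately show False using maxima_1_2_fst_less[OF p p2, of "hd l2"] by simp
    qed
    moreover have "p \<notin> maxima 0 S"
    proof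
      assume "p \<in> maxima 0 S"
      with \<open>p \<notin> maxima 2 S\<close> have p0: "p \<in> set l0'" by (simp add: l0')
      then have ne0: "l0' \<noteq> []" by auto
      have "p \<noteq> last l0'" using fr ne0 by (simp add: fresh_in_def out')
      moreover from this have "fst (last l0') < fst p"
        using sorted_wrt_hd_last(1)[OF s0' p0] by simp
      moreover have "last l0' \<in> maxima 0 S" using last_in_set[OF ne0] l0' by blast
      ultimately show False using maxima_fst_less[OF p, of "last l0'"] by simp
    qed
    ultimately show "p \<notin> maxima 2 S \<union> maxima 0 S" by simp
  next
    assume "p \<notin> maxima 2 S \<union> maxima 0 S"
    then have "p \<notin> set out" using l2(1) by (simp add: out' l0')
    moreover have "out \<noteq> []" using ne by (simp add: out')
    ultimately show "fresh_in out p"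
      using hd_in_set[of out] last_in_set[of out] by (auto simp: fresh_in_def)
  qed
  define l1' where "l1' = filter (fresh_in out) l1"
  have l1': "set l1' = maxima (Suc 0) S - (maxima 2 S \<union> maxima 0 S)"
    using f1 l1(1) by (auto simp: l1'_def)
  have s1': "sorted_wrt (\<lambda>p q. fst p > fst q) l1'"
    unfolding l1'_def by (rule sorted_wrt_filter[OF s1])
  have sU: "sorted_wrt (\<lambda>p q. fst p > fst q) (l0' @ l1')"
    unfolding sorted_wrt_append using s0' s1' l0' l1' maxima_fst_less by blast
  have disj: "set l2 \<inter> set (l0' @ l1') = {}" using l2(1) l0' l1' by auto
  have dist: "sorted_wrt (\<lambda>p q. fst p > fst q) l \<Longrightarrow> distinct l" for l :: "tp2 list"
    by (induction l) auto
  have "distinct l2" using s2 by (induction l2) auto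
  moreover have "distinct (l0' @ l1')" using sU by (rule dist)
  ultimately have "distinct (l2 @ l0' @ l1')" using disj by simp
  moreover have "set (l2 @ l0' @ l1') = tvertices S"
  proof -
    have "(\<Union>k<3. maxima k S) = maxima 0 S \<union> maxima (Suc 0) S \<union> maxima 2 S"
      by (auto simp: numeral_eq_Suc lessThan_Suc)
    then show ?thesis using l2(1) l0' l1' by (auto simp: tvertices_eq[OF S(1)])
  qed
  moreover have "ccw_along_boundary (tconv S) (l2 @ l0' @ l1')"
    using l2(1) l0' l1' by (intro ccw_along_boundary_tconv S s2 sU disj) auto
  ultimately show ?thesis unfolding ccw_vertex_list_def out' l1'_def[symmetric, unfolded out'] by simp
qed

text \<open>\<open>J\<close> stays free, to be instantiated from \<open>h\<close> or from
  \<open>n\<close>. The pivots are existential because ties are resolved by the order of the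
  input.\<close>

lemma exec_hull_prog:
  assumes ne: "ps \<noteq> []" and J: "card (tvertices (set ps)) \<le> 2 ^ J"
  shows "\<exists>t s' z. exec hull_prog (input_state ps) t s' \<and> ccw_vertex_list (set ps) (output_list s') \<and>
    (\<forall>\<kappa><3. is_pivot \<kappa> ps (z \<kappa>)) \<and>
    t \<le> 300 * (3 * length ps + (J + 1) * (\<Sum>\<kappa><3. length (survivors \<kappa> (z \<kappa>) ps)))"
proof -
  have J': "card (maxima \<kappa> (set ps)) \<le> 2 ^ J" if "\<kappa> < 3" for \<kappa>
  proof -
    have "card (maxima \<kappa> (set ps)) \<le> card (tvertices (set ps))"
      using that finite_subset[OF maxima_subset] unfolding tvertices_eq[OF finite_set]
      by (intro card_mono) auto
    with J show ?thesis by simp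
  qed
  have inp: "has_input ps (input_state ps)"
    by (auto simp: has_input_def input_state_def intro!: nth_equalityI)
  have out: "arr (rmem (input_state ps) ''u'') (rmem (input_state ps) ''v'') (nmem (input_state ps) ''h'' 0) = []"
    by (simp add: input_state_def)
  have "wp hull_prog (\<lambda>t s'. ccw_vertex_list (set ps) (output_list s') \<and>
     (\<exists>z. (\<forall>\<kappa><3. is_pivot \<kappa> ps (z \<kappa>)) \<and>
     t \<le> 300 * (3 * length ps + (J + 1) * (\<Sum>\<kappa><3. length (survivors \<kappa> (z \<kappa>) ps))))) (input_state ps)"
    unfolding hull_prog_def block.simps
  proof (rule wp_SeqI[OF wp_hull_pass[OF _ inp ne out J']], goal_cases)
    case (3 t1 s1)
    obtain z2 l2 where z2: "is_pivot 2 ps z2" "t1 \<le> 300 * (length ps + (J + 1) * length (survivors 2 z2 ps))"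
      and l2: "set l2 = maxima 2 (set ps)" "key_sorted 2 l2"
      and out1: "arr (rmem s1 ''u'') (rmem s1 ''v'') (nmem s1 ''h'' 0) = l2"
      using 3(1) by (auto simp: fresh_in_def simp del: split_paired_Ex)
    have inp1: "has_input ps s1" using 3(1) by simp
    show ?case
    proof (rule wp_SeqI[OF wp_hull_pass[OF _ inp1 ne out1 J']], goal_cases)
      case (3 t2 s2)
      obtain z0 l0 where z0: "is_pivot 0 ps z0" "t2 \<le> 300 * (length ps + (J + 1) * length (survivors 0 z0 ps))"
        and l0: "set l0 = maxima 0 (set ps)" "key_sorted 0 l0"
        and out2: "arr (rmem s2 ''u'') (rmem s2 ''v'') (nmem s2 ''h'' 0) = l2 @ filter (fresh_in l2) l0"
        using 3(1) by (auto simp del: split_paired_Ex)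
      have inp2: "has_input ps s2" using 3(1) by simp
      show ?case
      proof (rule wp_mono[OF wp_hull_pass[OF _ inp2 ne out2 J']], goal_cases)
        case (3 t3 s3)
        obtain z1 l1 where z1: "is_pivot (Suc 0) ps z1"
            "t3 \<le> 300 * (length ps + (J + 1) * length (survivors (Suc 0) z1 ps))"
          and l1: "set l1 = maxima (Suc 0) (set ps)" "key_sorted (Suc 0) l1"
          and out3: "arr (rmem s3 ''u'') (rmem s3 ''v'') (nmem s3 ''h'' 0) =
            (l2 @ filter (fresh_in l2) l0) @ filter (fresh_in (l2 @ filter (fresh_in l2) l0)) l1"
          using 3(1) by (auto simp del: split_paired_Ex)
        have "output_list s3 = arr (rmem s3 ''u'') (rmem s3 ''v'') (nmem s3 ''h'' 0)"
          by (simp add: output_list_def arr_def)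
        then have "ccw_vertex_list (set ps) (output_list s3)"
          unfolding out3 using ne by (simp only:) (rule ccw_vertex_list_passes[OF _ _ l2 l0 l1 refl], simp_all)
        moreover define z where "z = (\<lambda>\<kappa>::nat. if \<kappa> = 0 then z0 else if \<kappa> = Suc 0 then z1 else z2)"
        have "\<forall>\<kappa><3. is_pivot \<kappa> ps (z \<kappa>)"
          unfolding all_less_3 using z0 z1 z2 by (simp add: z_def)
        moreover have "(\<Sum>\<kappa><3. length (survivors \<kappa> (z \<kappa>) ps)) = length (survivors 0 z0 ps) +
            length (survivors (Suc 0) z1 ps) + length (survivors 2 z2 ps)"
          by (simp add: numeral_3_eq_3 z_def) (simp add: numeral_2_eq_2)
        then have "t1 + (t2 + t3) \<le> 300 * (3 * length ps + (J + 1) * (\<Sum>\<kappa><3. length (survivors \<kappa> (z \<kappa>) ps)))"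
          using z0(2) z1(2) z2(2) by (simp add: algebra_simps)
        ultimately show ?case by blast
      qed simp_all
    qed simp_all
  qed simp_all
  then show ?thesis unfolding wp_def by blast
qed

lemma length_survivors: "length (survivors \<kappa> z ps) \<le> length ps + 1"
  by (simp add: survivors_def)

lemma solves_hull_prog: "solves_tropical_hull hull_prog"
  unfolding solves_tropical_hull_def
proof (intro allI impI)
  fix ps :: "tp2 list" assume "ps \<noteq> []"
  then show "\<exists>t s'. exec hull_prog (input_state ps) t s' \<and> ccw_vertex_list (set ps) (output_list s')"
    using exec_hull_prog[of ps "card (tvertices (set ps))"] less_exp[of "card (tvertices (set ps))"]
    by (meson less_imp_le)
qed

lemma run_time_hull_prog:
  assumes "ps \<noteq> []" "card (tvertices (set ps)) \<le> 2 ^ J"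
  shows "\<exists>z. (\<forall>\<kappa><3. is_pivot \<kappa> ps (z \<kappa>)) \<and> run_time hull_prog ps
     \<le> 300 * (3 * length ps + (J + 1) * (\<Sum>\<kappa><3. length (survivors \<kappa> (z \<kappa>) ps)))"
  using exec_hull_prog[OF assms] run_time_eq by metis

lemma tvertices_bounds:
  assumes "ps \<noteq> []"
  shows "0 < card (tvertices (set ps))" "card (tvertices (set ps)) \<le> length ps"
proof -
  have sub: "tvertices (set ps) \<subseteq> set ps"
    unfolding tvertices_eq[OF finite_set] using maxima_subset by blast
  obtain m where "m \<in> maxima 0 (set ps)"
    using ex_maxima_above[of "set ps"] assms by (metis finite_set hd_in_set)
  then have "tvertices (set ps) \<noteq> {}" unfolding tvertices_eq[OF finite_set] by auto
  then show "0 < card (tvertices (set ps))" using finite_subset[OF sub] by (simp add: card_gt_0_iff)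
  have "card (tvertices (set ps)) \<le> card (set ps)" using sub by (intro card_mono) auto
  then show "card (tvertices (set ps)) \<le> length ps" using card_length[of ps] by simp
qed

lemma ex_log2_bound:
  assumes "0 < (h::nat)"
  shows "\<exists>J. h \<le> 2 ^ J \<and> real J \<le> 1 + log 2 (real h)"
proof (intro exI conjI)
  let ?J = "nat \<lceil>log 2 (real h)\<rceil>"
  have l: "0 \<le> log 2 (real h)" using assms by simp
  have "real h = 2 powr log 2 (real h)" using assms by simp
  also have "\<dots> \<le> 2 powr real ?J" using l by (intro powr_mono) linarith+
  finally show "h \<le> 2 ^ ?J" by (simp add: powr_realpow)
  show "real ?J \<le> 1 + log 2 (real h)" using l by linarith
qed

lemma run_time_hull_prog_le:
  assumes ne: "ps \<noteq> []"
  shows "real (run_time hull_prog ps)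
    \<le> 5400 * real (length ps) * (1 + log 2 (real (card (tvertices (set ps)))))"
proof -
  let ?h = "card (tvertices (set ps))" and ?n = "length ps"
  have log_nonneg: "0 \<le> log 2 (real ?h)" using tvertices_bounds(1)[OF ne] by simp
  obtain J where J: "?h \<le> 2 ^ J" "real J \<le> 1 + log 2 (real ?h)"
    using ex_log2_bound tvertices_bounds(1)[OF ne] by blast
  obtain z where "run_time hull_prog ps \<le> 300 * (3 * ?n + (J + 1) * (\<Sum>\<kappa><3. length (survivors \<kappa> (z \<kappa>) ps)))"
    using run_time_hull_prog[OF ne J(1)] by blast
  also have "\<dots> \<le> 300 * (3 * ?n + (J + 1) * (3 * (?n + 1)))"
    using sum_mono[of "{..<3}" "\<lambda>\<kappa>. length (survivors \<kappa> (z \<kappa>) ps)" "\<lambda>_. ?n + 1"] length_survivors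
    by (intro mult_le_mono2 add_le_mono le_refl) simp
  also have "\<dots> \<le> 300 * (3 * (?n * (J + 1)) + (J + 1) * (3 * (2 * ?n)))"
    using ne by (intro mult_le_mono2 add_le_mono) (auto simp: Suc_le_eq)
  \<comment> \<open>\<open>2700 = 300 * (3 + 6)\<close>, as the three survivor lists have at most
    \<open>3 * (n + 1) \<le> 6 * n\<close> points. The later factor 2 absorbs the rounding of the
    logarithm.\<close>
  finally have "real (run_time hull_prog ps) \<le> real (2700 * (?n * (J + 1)))"
    unfolding of_nat_le_iff by (simp add: algebra_simps)
  also have "\<dots> = 2700 * real ?n * (1 + real J)" by (simp add: algebra_simps)
  also have "\<dots> \<le> 2700 * real ?n * (2 * (1 + log 2 (real ?h)))"
    using J(2) log_nonneg by (intro mult_left_mono) auto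
  also have "\<dots> = 5400 * real ?n * (1 + log 2 (real ?h))" by simp
  finally show ?thesis .
qed

section \<open>Random points in the unit square\<close>

definition unit_square :: "tp2 set" where
  "unit_square = {0..1} \<times> {0..1}"

text \<open>A box at the vertex of the square that maximizes the sum of the \<kappa>-keys, which is
  \<open>x + y\<close>, \<open>y - 2 * x\<close> or \<open>x - 2 * y\<close>.\<close>

definition corner :: "nat \<Rightarrow> real \<Rightarrow> tp2 set" where
  "corner \<kappa> \<delta> = (if \<kappa> = 0 then {1 - \<delta>..1} \<times> {1 - \<delta>..1} else if \<kappa> = Suc 0 then {0..\<delta>} \<times> {1 - \<delta>..1}
     else {1 - \<delta>..1} \<times> {0..\<delta>})"

text \<open>Once the corner is hit, the estimates place survivors within \<open>3 * \<delta>\<close>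
  of the boundary; the factor 5 leaves slack.\<close>

definition border :: "real \<Rightarrow> tp2 set" where
  "border \<delta> = {p. fst p < 5 * \<delta> \<or> fst p > 1 - 5 * \<delta> \<or> snd p < 5 * \<delta> \<or> snd p > 1 - 5 * \<delta>}"

text \<open>The pivot is at least as good as a point in the corner, hence itself close to the corner.\<close>

lemma survives_border:
  assumes \<kappa>: "\<kappa> < 3" and piv: "is_pivot \<kappa> ps z" and sq: "set ps \<subseteq> unit_square"
    and q: "q \<in> set ps" "q \<in> corner \<kappa> \<delta>" and p: "p \<in> set ps" "survives \<kappa> z p" and \<delta>: "\<delta> > 0"
  shows "p \<in> border \<delta>"
proof -
  have "z \<in> unit_square" "p \<in> unit_square" using piv sq p by (auto simp: is_pivot_def)
  then have z: "0 \<le> fst z" "fst z \<le> 1" "0 \<le> snd z" "snd z \<le> 1"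
    and p': "0 \<le> fst p" "fst p \<le> 1" "0 \<le> snd p" "snd p \<le> 1"
    by (auto simp: unit_square_def)
  have le: "fst (key \<kappa> q) + snd (key \<kappa> q) \<le> fst (key \<kappa> z) + snd (key \<kappa> z)"
    using piv q by (simp add: is_pivot_def)
  consider "\<kappa> = 0" | "\<kappa> = Suc 0" | "\<kappa> = 2" using \<kappa> by linarith
  then show ?thesis
  proof cases
    case 1
    then have "1 - \<delta> \<le> fst q" "1 - \<delta> \<le> snd q" using q by (auto simp: corner_def)
    then show ?thesis using 1 le z p' p(2) \<delta> by (auto simp: survives_def border_def)
  next
    case 2
    then have "fst q \<le> \<delta>" "1 - \<delta> \<le> snd q" using q by (auto simp: corner_def)
    then show ?thesis using 2 le z p' p(2) \<delta> by (auto simp: survives_def border_def key_1)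
  next
    case 3
    then have "1 - \<delta> \<le> fst q" "snd q \<le> \<delta>" using q by (auto simp: corner_def)
    then show ?thesis using 3 le z p' p(2) \<delta> by (auto simp: survives_def border_def key_2)
  qed
qed

text \<open>If the corner is hit, only the pivot and border points remain; otherwise the trivial
  bound is charged.\<close>

lemma length_survivors_le:
  assumes "\<kappa> < 3" "is_pivot \<kappa> ps z" "set ps \<subseteq> unit_square" "\<delta> > 0"
  shows "length (survivors \<kappa> z ps) \<le> 1 + length (filter (\<lambda>p. p \<in> border \<delta>) ps)
    + length ps * (if set ps \<inter> corner \<kappa> \<delta> = {} then 1 else 0)"
proof (cases "set ps \<inter> corner \<kappa> \<delta> = {}")
  case False
  then obtain q where "q \<in> set ps" "q \<in> corner \<kappa> \<delta>" by blast
  then have *: "p \<in> border \<delta>" if "p \<in> set ps" "survives \<kappa> z p" for p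
    using survives_border[OF assms(1-3) _ _ that assms(4)] by blast
  have "filter (survives \<kappa> z) ps = filter (survives \<kappa> z) (filter (\<lambda>p. p \<in> border \<delta>) ps)"
    unfolding filter_filter using * by (intro filter_cong) auto
  then have "length (filter (survives \<kappa> z) ps) \<le> length (filter (\<lambda>p. p \<in> border \<delta>) ps)"
    by (metis length_filter_le)
  then show ?thesis using False by (simp add: survivors_def)
next
  case True
  then show ?thesis by (simp add: survivors_def trans_le_add2)
qed

text \<open>The bound is linear in counts and indicators, so its expectation is taken term by term.
  \<open>J\<close> comes from the fixed number of points, since the number of vertices is
  random.\<close>

lemma run_time_hull_prog_unit_square:
  assumes ne: "ps \<noteq> []" and J: "length ps \<le> 2 ^ J" and sq: "set ps \<subseteq> unit_square" and \<delta>: "\<delta> > 0"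
  shows "run_time hull_prog ps \<le> 300 * (3 * length ps + (J + 1) * (3 + 3 * length (filter (\<lambda>p. p \<in> border \<delta>) ps)
    + length ps * (\<Sum>\<kappa><3. if set ps \<inter> corner \<kappa> \<delta> = {} then 1 else 0)))"
proof -
  let ?N = "length (filter (\<lambda>p. p \<in> border \<delta>) ps)"
  have "card (tvertices (set ps)) \<le> 2 ^ J" using tvertices_bounds(2)[OF ne] J by simp
  then obtain z where z: "\<forall>\<kappa><3. is_pivot \<kappa> ps (z \<kappa>)"
    "run_time hull_prog ps \<le> 300 * (3 * length ps + (J + 1) * (\<Sum>\<kappa><3. length (survivors \<kappa> (z \<kappa>) ps)))"
    using run_time_hull_prog[OF ne] by blast
  have "(\<Sum>\<kappa><3. length (survivors \<kappa> (z \<kappa>) ps))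
    \<le> (\<Sum>\<kappa><3. 1 + ?N + length ps * (if set ps \<inter> corner \<kappa> \<delta> = {} then 1 else 0))"
    using z(1) by (intro sum_mono length_survivors_le sq \<delta>) auto
  also have "\<dots> = 3 + 3 * ?N + length ps * (\<Sum>\<kappa><3. if set ps \<inter> corner \<kappa> \<delta> = {} then 1 else 0)"
    unfolding sum.distrib sum_distrib_left[symmetric] by simp
  finally show ?thesis using z(2)
    by (elim order_trans) (intro mult_le_mono2 add_le_mono le_refl)
qed

section \<open>Probabilities of corners and border\<close>

lemma emeasure_lborel_rectangle:
  fixes a b c d :: real
  assumes "a \<le> b" "c \<le> d"
  shows "emeasure lborel ({a..b} \<times> {c..d}) = ennreal ((b - a) * (d - c))"
  unfolding lborel_prod[symmetric] using assms
  by (subst lborel.emeasure_pair_measure_Times) (auto simp: ennreal_mult)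

abbreviation unif :: "tp2 measure" where
  "unif \<equiv> uniform_measure lborel ({0..1} \<times> {0..1})"

lemma emeasure_unif:
  "A \<in> sets borel \<Longrightarrow> emeasure unif A = emeasure lborel (unit_square \<inter> A)"
proof -
  assume "A \<in> sets borel"
  moreover have "({0..1} \<times> {0..1} :: tp2 set) \<in> sets borel" by (intro borel_closed closed_Times) auto
  ultimately show ?thesis
    using emeasure_lborel_rectangle[of 0 1 0 1] by (simp add: unit_square_def divide_ennreal_def)
qed

lemma prob_space_unif: "prob_space unif"
  using emeasure_lborel_rectangle[of 0 1 0 1] by (intro prob_space_uniform_measure) simp_all

lemma corner_measure:
  assumes "0 \<le> \<delta>" "\<delta> \<le> 1"
  shows "corner \<kappa> \<delta> \<in> sets borel" "emeasure unif (corner \<kappa> \<delta>) = ennreal (\<delta>\<^sup>2)"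
proof -
  show *: "corner \<kappa> \<delta> \<in> sets borel"
    unfolding corner_def by (auto intro!: borel_closed closed_Times)
  have "unit_square \<inter> corner \<kappa> \<delta> = corner \<kappa> \<delta>" using assms by (auto simp: unit_square_def corner_def)
  then show "emeasure unif (corner \<kappa> \<delta>) = ennreal (\<delta>\<^sup>2)"
    unfolding emeasure_unif[OF *] using assms
    by (simp add: corner_def emeasure_lborel_rectangle power2_eq_square)
qed

lemma border_measure:
  assumes "0 < \<delta>"
  shows "border \<delta> \<in> sets borel" "emeasure unif (border \<delta>) \<le> ennreal (20 * \<delta>)"
proof -
  have "open (border \<delta>)" unfolding border_def
    by (intro open_Collect_disj open_Collect_less continuous_intros)
  then show *: "border \<delta> \<in> sets borel" by (rule borel_open)
  let ?A = "{0..5 * \<delta>} \<times> {0..1::real}" and ?B = "{1 - 5 * \<delta>..1} \<times> {0..1::real}"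
    and ?C = "{0..1::real} \<times> {0..5 * \<delta>}" and ?D = "{0..1::real} \<times> {1 - 5 * \<delta>..1}"
  have rect: "{a..b} \<times> {c..d} \<in> sets lborel" for a b c d :: real
    by (simp add: borel_closed closed_Times)
  have "emeasure unif (border \<delta>) \<le> emeasure lborel (((?A \<union> ?B) \<union> ?C) \<union> ?D)"
    unfolding emeasure_unif[OF *]
    by (intro emeasure_mono sets.Un rect) (auto simp: unit_square_def border_def)
  also have "\<dots> \<le> ((emeasure lborel ?A + emeasure lborel ?B) + emeasure lborel ?C) + emeasure lborel ?D"
    by (intro order_trans[OF emeasure_subadditive] add_mono sets.Un rect order_refl)
  also have "\<dots> = ennreal (20 * \<delta>)"
    using assms by (simp add: emeasure_lborel_rectangle ennreal_plus[symmetric] del: ennreal_plus)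
  finally show "emeasure unif (border \<delta>) \<le> ennreal (20 * \<delta>)" .
qed

lemma random_points_component:
  assumes "i < n" "A \<in> sets borel"
  shows "(\<integral>\<^sup>+ \<omega>. indicator A (\<omega> i) \<partial>random_points n) = emeasure unif A"
proof -
  have "(\<integral>\<^sup>+ \<omega>. indicator A (\<omega> i) \<partial>random_points n)
      = (\<integral>\<^sup>+ x. indicator A x \<partial>distr (random_points n) unif (\<lambda>\<omega>. \<omega> i))"
    unfolding random_points_def using assms by (subst nn_integral_distr) auto
  also have "distr (random_points n) unif (\<lambda>\<omega>. \<omega> i) = unif"
    unfolding random_points_def using assms prob_space_unif
    by (intro distr_PiM_component) auto
  finally show ?thesis using assms by simp
qed

text \<open>Written as a product set, so that independence enters through
  \<open>emeasure_PiM\<close>.\<close>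

definition missed :: "nat \<Rightarrow> tp2 set \<Rightarrow> (nat \<Rightarrow> tp2) set" where
  "missed n A = (\<Pi>\<^sub>E i\<in>{..<n}. - A)"

lemma missed_measure:
  assumes A: "A \<in> sets borel" "emeasure unif A = ennreal p" "0 \<le> p" "p \<le> 1"
  shows "missed n A \<in> sets (random_points n)"
    "emeasure (random_points n) (missed n A) = ennreal ((1 - p) ^ n)"
proof -
  interpret prob_space unif by (rule prob_space_unif)
  interpret P: product_sigma_finite "\<lambda>i::nat. unif" by standard
  have "prob (space unif - A) = 1 - prob A" using A(1) by (intro prob_compl) simp
  moreover have "prob A = p" using A by (simp add: measure_def)
  ultimately have c: "emeasure unif (- A) = ennreal (1 - p)"
    by (simp add: emeasure_eq_measure Compl_eq_Diff_UNIV)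
  have cA: "- A \<in> sets unif" using A(1) by (simp add: Compl_in_sets_lebesgue sets.compl_sets borel_comp)
  show "missed n A \<in> sets (random_points n)"
    unfolding missed_def random_points_def using cA by (intro sets_PiM_I_finite) auto
  show "emeasure (random_points n) (missed n A) = ennreal ((1 - p) ^ n)"
    unfolding missed_def random_points_def using cA A(4)
    by (subst P.emeasure_PiM) (auto simp: c ennreal_power)
qed

lemma length_filter_eq_sum:
  "(of_nat (length (filter P (map \<omega> [0..<n]))) :: ennreal) = (\<Sum>i<n. indicator {x. P x} (\<omega> i))"
  by (induction n) (auto simp: indicator_def)

text \<open>The running time is bounded almost everywhere by a measurable function; monotonicity of
  the nonnegative integral then needs no measurability of the running time itself.\<close>

lemma expected_run_time_le:
  assumes n: "n \<ge> 1" and J: "n \<le> 2 ^ J" and \<delta>: "0 < \<delta>" "\<delta> \<le> 1"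
  shows "expected_run_time hull_prog n \<le> ennreal (300 * (3 * real n + (real J + 1) *
     (3 + 60 * real n * \<delta> + 3 * real n * (1 - \<delta>\<^sup>2) ^ n)))"
proof -
  let ?M = "random_points n"
  let ?X = "\<lambda>\<omega>. \<Sum>i<n. indicator (border \<delta>) (\<omega> i) :: ennreal"
  let ?Y = "\<lambda>\<omega>. \<Sum>\<kappa><3. indicator (missed n (corner \<kappa> \<delta>)) \<omega> :: ennreal"
  interpret prob_space ?M unfolding random_points_def by (intro prob_space_PiM prob_space_unif)
  have \<delta>2: "0 \<le> \<delta>\<^sup>2" "\<delta>\<^sup>2 \<le> 1" using \<delta> by (auto simp: power_le_one)
  note corner = corner_measure[OF less_imp_le[OF \<delta>(1)] \<delta>(2)]
  note miss = missed_measure[OF corner \<delta>2]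
  have sq: "AE \<omega> in ?M. \<forall>i<n. \<omega> i \<in> unit_square"
  proof -
    have "AE x in unif. x \<in> unit_square"
      unfolding unit_square_def by (rule AE_uniform_measureI) (auto intro!: borel_closed closed_Times)
    then have "AE \<omega> in ?M. \<omega> i \<in> unit_square" if "i < n" for i
      unfolding random_points_def using that prob_space_unif by (intro AE_PiM_component) auto
    then have "AE \<omega> in ?M. \<forall>i\<in>{..<n}. \<omega> i \<in> unit_square" by (intro AE_finite_allI) auto
    then show ?thesis unfolding Ball_def lessThan_iff .
  qed
  have mX: "(\<lambda>\<omega>. indicator (border \<delta>) (\<omega> i) :: ennreal) \<in> borel_measurable ?M" if "i < n" for i
  proof -
    have "(\<lambda>\<omega>. \<omega> i) \<in> measurable ?M unif"
      unfolding random_points_def using that by (intro measurable_component_singleton) simp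
    moreover have "indicator (border \<delta>) \<in> borel_measurable unif"
      using border_measure(1)[OF \<delta>(1)] by (intro borel_measurable_indicator) simp
    ultimately show ?thesis by (rule measurable_compose)
  qed
  have "expected_run_time hull_prog n
    \<le> (\<integral>\<^sup>+ \<omega>. 300 * (3 * of_nat n + of_nat (J + 1) * (3 + 3 * ?X \<omega> + of_nat n * ?Y \<omega>)) \<partial>?M)"
    unfolding expected_run_time_def
  proof (rule nn_integral_mono_AE)
    show "AE \<omega> in ?M. of_nat (run_time hull_prog (map \<omega> [0..<n]))
      \<le> 300 * (3 * of_nat n + of_nat (J + 1) * (3 + 3 * ?X \<omega> + of_nat n * ?Y \<omega>))"
      using sq AE_space
    proof eventually_elim
      case (elim \<omega>)
      let ?ps = "map \<omega> [0..<n]"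
      have ind: "of_nat (if set ?ps \<inter> corner \<kappa> \<delta> = {} then 1 else 0)
          = (indicator (missed n (corner \<kappa> \<delta>)) \<omega> :: ennreal)" for \<kappa>
      proof -
        \<comment> \<open>Members of \<open>missed\<close> are extensional, as are all points of the
          product space.\<close>
        have "\<omega> \<in> extensional {..<n}" using elim(2) by (auto simp: random_points_def space_PiM PiE_def)
        then have "set ?ps \<inter> corner \<kappa> \<delta> = {} \<longleftrightarrow> \<omega> \<in> missed n (corner \<kappa> \<delta>)"
          unfolding set_map set_upt atLeast0LessThan by (auto simp: missed_def PiE_def)
        then show ?thesis by (simp add: indicator_def)
      qed
      have "run_time hull_prog ?ps \<le> 300 * (3 * length ?ps + (J + 1) * (3 + 3 * length (filter (\<lambda>p. p \<in> border \<delta>) ?ps)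
        + length ?ps * (\<Sum>\<kappa><3. if set ?ps \<inter> corner \<kappa> \<delta> = {} then 1 else 0)))"
        using n J \<delta>(1) elim(1) by (intro run_time_hull_prog_unit_square) auto
      then have "(of_nat (run_time hull_prog ?ps) :: ennreal) \<le> of_nat (300 * (3 * length ?ps + (J + 1) * (3 +
          3 * length (filter (\<lambda>p. p \<in> border \<delta>) ?ps)
          + length ?ps * (\<Sum>\<kappa><3. if set ?ps \<inter> corner \<kappa> \<delta> = {} then 1 else 0))))"
        by (rule of_nat_mono)
      also have "\<dots> = 300 * (3 * of_nat n + of_nat (J + 1) * (3 + 3 * of_nat (length (filter (\<lambda>p. p \<in> border \<delta>) ?ps))
          + of_nat n * (\<Sum>\<kappa><3. of_nat (if set ?ps \<inter> corner \<kappa> \<delta> = {} then 1 else 0))))"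
        by (simp only: of_nat_mult of_nat_add of_nat_numeral of_nat_sum length_map length_upt minus_nat.diff_0)
      also have "of_nat (length (filter (\<lambda>p. p \<in> border \<delta>) ?ps)) = ?X \<omega>"
        unfolding length_filter_eq_sum by simp
      also have "(\<Sum>\<kappa><3. of_nat (if set ?ps \<inter> corner \<kappa> \<delta> = {} then 1 else 0)) = ?Y \<omega>"
        by (intro sum.cong refl ind)
      finally show ?case .
    qed
  qed
  also have "\<dots> = 300 * (3 * of_nat n + of_nat (J + 1) * (3 + 3 * (\<integral>\<^sup>+ \<omega>. ?X \<omega> \<partial>?M) + of_nat n * (\<integral>\<^sup>+ \<omega>. ?Y \<omega> \<partial>?M)))"
  proof -
    have X: "?X \<in> borel_measurable ?M"
      by (intro borel_measurable_sum mX) simp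
    have Y: "?Y \<in> borel_measurable ?M" using miss(1) by measurable
    show ?thesis
      using X Y by (simp add: nn_integral_cmult nn_integral_add emeasure_space_1)
  qed
  also have "(\<integral>\<^sup>+ \<omega>. ?X \<omega> \<partial>?M) = of_nat n * emeasure unif (border \<delta>)"
  proof -
    have "(\<integral>\<^sup>+ \<omega>. ?X \<omega> \<partial>?M) = (\<Sum>i<n. \<integral>\<^sup>+ \<omega>. indicator (border \<delta>) (\<omega> i) \<partial>?M)"
      by (intro nn_integral_sum mX) simp
    also have "\<dots> = (\<Sum>i<n. emeasure unif (border \<delta>))"
      using border_measure(1)[OF \<delta>(1)] by (intro sum.cong refl random_points_component) auto
    finally show ?thesis by simp
  qed
  also have "(\<integral>\<^sup>+ \<omega>. ?Y \<omega> \<partial>?M) = 3 * ennreal ((1 - \<delta>\<^sup>2) ^ n)"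
    using miss by (subst nn_integral_sum) auto
  also have "300 * (3 * of_nat n + of_nat (J + 1) * (3 + 3 * (of_nat n * emeasure unif (border \<delta>))
      + of_nat n * (3 * ennreal ((1 - \<delta>\<^sup>2) ^ n))))
    \<le> 300 * (3 * of_nat n + of_nat (J + 1) * (3 + 3 * (of_nat n * ennreal (20 * \<delta>))
      + of_nat n * (3 * ennreal ((1 - \<delta>\<^sup>2) ^ n))))"
    using border_measure(2)[OF \<delta>(1)] by (intro mult_left_mono add_mono order_refl) auto
  also have "\<dots> = ennreal (300 * (3 * real n + (real J + 1) *
     (3 + 60 * real n * \<delta> + 3 * real n * (1 - \<delta>\<^sup>2) ^ n)))"
  proof -
    have num: "(300::ennreal) = ennreal 300" "(3::ennreal) = ennreal 3" by simp_all
    show ?thesis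
      unfolding num ennreal_of_nat_eq_real_of_nat using \<delta> \<delta>2
      by (simp add: ennreal_mult'[symmetric] ennreal_plus[symmetric] algebra_simps del: ennreal_plus ennreal_numeral)
  qed
  finally show ?thesis .
qed

lemma expected_run_time_linear:
  "\<exists>C. \<forall>n\<ge>1. expected_run_time hull_prog n \<le> ennreal (C * real n)"
proof -
  \<comment> \<open>\<open>n * g n\<close> bounds the part of the time that carries a logarithm, up
    to the factor 300; since \<open>g\<close> tends to 0, it is bounded.\<close>
  define g where "g n = (2 + ln (real n) / ln 2) * (3 / real n + 60 * real n powr (-1/4)
    + 3 * exp (- (real n powr (1/2))))" for n
  have "g \<longlonglongrightarrow> 0" unfolding g_def by real_asymp
  then have "Bseq g" by (intro convergent_imp_Bseq convergentI)
  then obtain K where K: "\<And>n. norm (g n) \<le> K" by (auto simp: Bseq_def)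
  have "expected_run_time hull_prog n \<le> ennreal (300 * (3 + K) * real n)" if n: "n \<ge> 1" for n
  proof -
    define \<delta> where "\<delta> = real n powr (-1/4)"
    have \<delta>: "0 < \<delta>" "\<delta> \<le> 1" using n by (auto simp: \<delta>_def powr_le_one_le ge_one_powr_ge_zero powr_minus_divide intro: powr_mono2)
    have \<delta>2: "real n * \<delta>\<^sup>2 = real n powr (1/2)"
    proof -
      have "real n * \<delta>\<^sup>2 = real n powr 1 * real n powr (-1/2)"
        using n by (simp add: \<delta>_def powr_power)
      also have "\<dots> = real n powr (1/2)" unfolding powr_add[symmetric] by simp
      finally show ?thesis .
    qed
    \<comment> \<open>From \<open>1 - x \<le> exp (- x)\<close>: the exponent becomes
      \<open>n * \<delta>^2 = sqrt n\<close>.\<close>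
    have "(1 - \<delta>\<^sup>2) ^ n \<le> exp (- (\<delta>\<^sup>2)) ^ n"
      using \<delta> exp_ge_add_one_self[of "- (\<delta>\<^sup>2)"] by (intro power_mono) (auto simp: power_le_one)
    also have "\<dots> = exp (- (real n powr (1/2)))"
      by (simp add: \<delta>2[symmetric] exp_of_nat_mult[symmetric])
    finally have e: "(1 - \<delta>\<^sup>2) ^ n \<le> exp (- (real n powr (1/2)))" .
    obtain J where J: "n \<le> 2 ^ J" "real J \<le> 1 + log 2 (real n)"
      using ex_log2_bound[of n] n by auto
    have "(real J + 1) * (3 + 60 * real n * \<delta> + 3 * real n * (1 - \<delta>\<^sup>2) ^ n)
      \<le> (2 + log 2 (real n)) * (3 + 60 * real n * \<delta> + 3 * real n * exp (- (real n powr (1/2))))"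
    proof (rule mult_mono)
      show "3 + 60 * real n * \<delta> + 3 * real n * (1 - \<delta>\<^sup>2) ^ n
        \<le> 3 + 60 * real n * \<delta> + 3 * real n * exp (- (real n powr (1/2)))"
        using e by (simp add: mult_left_mono)
    qed (use J \<delta> n in \<open>auto simp: power_le_one\<close>)
    also have "\<dots> = g n * real n"
      using n by (simp add: g_def \<delta>_def log_def field_simps)
    also have "\<dots> \<le> K * real n" using K[of n] by (intro mult_right_mono) auto
    finally have "300 * (3 * real n + (real J + 1) * (3 + 60 * real n * \<delta> + 3 * real n * (1 - \<delta>\<^sup>2) ^ n))
        \<le> 300 * (3 + K) * real n" by (simp add: algebra_simps)
    then show ?thesis
      using expected_run_time_le[OF n J(1) \<delta>] by (meson ennreal_leI order_trans)
  qed
  then show ?thesis by blast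
qed

theorem theorem5p3:
  shows "(\<exists>alg (C::real). solves_tropical_hull alg \<and>
            (\<forall>ps. ps \<noteq> [] \<longrightarrow>
               real (run_time alg ps)
                 \<le> C * real (length ps) * (1 + log 2 (real (card (tvertices (set ps)))))))
       \<and> (\<exists>alg (C::real). solves_tropical_hull alg \<and>
            (\<forall>n\<ge>1. expected_run_time alg n \<le> ennreal (C * real n)))"
  using solves_hull_prog run_time_hull_prog_le expected_run_time_linear by blast

end
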